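(* Let $0<a\le1$ and $z_1,z_2\in\mathbb{C}$ with $0<|z_1|,|z_2|\le1$. For $\vec\sigma=(\sigma_1,\sigma_2)$ with $\sigma_1,\sigma_2>0$ and $\vec t=(t_1,t_2)\in\mathbb{R}^2$ put (whenever defined) $$f_{\vec\sigma,a,\vec z}(\vec t):=\Gamma(\sigma_1+{\rm i}t_1)\Gamma(\sigma_2+{\rm i}t_2)\,\Phi_2(\sigma_1+{\rm i}t_1,\sigma_2+{\rm i}t_2,a,z_1,z_2),\qquad F_{\vec\sigma,a,\vec z}(\vec t):=\frac{f_{\vec\sigma,a,\vec z}(\vec t)}{f_{\vec\sigma,a,\vec z}(\vec 0)}.$$ (1) Let $z_1=z_2=1$. Then $F_{\vec\sigma,a,(1,1)}$ is the characteristic function of a probability measure on $\mathbb{R}^2$ for all $0<\sigma_1<1$, $\sigma_2>1$, $1<\sigma_1+\sigma_2<2$ if and only if $a\ge1/2$. Furthermore, in that case the associated probability measure is absolutely continuous with density $$P_{\vec\sigma,a,(1,1)}(\eta,\theta)=\frac{e^{\sigma_1\eta}e^{\sigma_2\theta}}{f_{\vec\sigma,a,(1,1)}(\vec0)}\left(\frac{H(a,e^\eta+e^\theta)}{\exp(e^\theta)-1}+\frac{H(1,e^\theta)}{e^\eta+e^\theta}\right),\qquad\eta,\theta\in\mathbb{R},$$ where $H(a,x):=\frac{e^{(1-a)x}}{e^x-1}-\frac1x$ for $x>0$. (2) Let $z_1=1$ and $z_2\neq1$. Then $F_{\vec\sigma,a,\vec z}$ is the characteristic function of a probability measure for all $\sigma_1>1$,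 $\sigma_2>0$ if and only if $z_2\in[-1,1)$ (and $z_2\ne0$). (3) Let $z_1\neq1$ and $z_2=1$. Then $F_{\vec\sigma,a,\vec z}$ is the characteristic function of a probability measure for all $\sigma_1>0$, $\sigma_2>1$ if and only if $z_1\in[-1,1)$ (and $z_1\ne0$). (4) Let $z_1\neq1$ and $z_2\neq1$. Then $F_{\vec\sigma,a,\vec z}$ is the characteristic function of a probability measure for all $\sigma_1>0$, $\sigma_2>0$ if and only if $z_1,z_2\in[-1,1)$ (both nonzero). In each of the cases (2), (3), (4), when it is a characteristic function, the associated probability measure is absolutely continuous with density $$P_{\vec\sigma,a,\vec z}(\eta,\theta)=\frac{e^{\sigma_1\eta}e^{\sigma_2\theta}\exp\bigl((1-a)(e^\eta+e^\theta)\bigr)}{f_{\vec\sigma,a,\vec z}(\vec0)\,(\exp(e^\theta)-z_2)\,(\exp(e^\eta+e^\theta)-z_1)},\qquad\eta,\theta\in\mathbb{R}.$$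
   Context: For $0<a\le1$, $s_1,s_2\in\mathbb{C}$ and $z_1,z_2\in\mathbb{C}$ with $0<|z_1|,|z_2|\le1$, the Hurwitz–Lerch type Euler–Zagier double zeta function is $$\Phi_2(s_1,s_2,a,z_1,z_2):=\sum_{m=0}^\infty\frac{z_1^m}{(m+a)^{s_1}}\sum_{n=1}^\infty\frac{z_2^{n-1}}{(m+n+a)^{s_2}},$$ convergent absolutely for $\Re s_1>0$, $\Re s_2>1$, $\Re(s_1+s_2)>2$, and understood elsewhere via its meromorphic continuation to $\mathbb{C}^2$. The characteristic function of a probability measure $\mu$ on $\mathbb{R}^2$ is $\int_{\mathbb{R}^2}e^{{\rm i}(t_1\eta+t_2\theta)}\mu(d\eta\,d\theta)$. *)

theory Defs
  imports "HOL-Analysis.Analysis" "HOL-Probability.Probability"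
begin

text \<open>The double series defining the Hurwitz--Lerch type Euler--Zagier double zeta function
  (inner index shifted: n = n' + 1).\<close>
definition Phi2_series :: "complex \<Rightarrow> complex \<Rightarrow> real \<Rightarrow> complex \<Rightarrow> complex \<Rightarrow> complex" where
  "Phi2_series s1 s2 a z1 z2 =
     (\<Sum>m. z1 ^ m / (complex_of_real (real m + a)) powr s1 *
        (\<Sum>n. z2 ^ n / (complex_of_real (real m + real n + 1 + a)) powr s2))"

definition Phi2_acr :: "(complex \<times> complex) set" where
  "Phi2_acr = {(s1, s2). Re s1 > 0 \<and> Re s2 > 1 \<and> Re (s1 + s2) > 2}"

text \<open>Holomorphy in two complex variables (continuous and separately holomorphic;
  equivalent to joint holomorphy by Osgood's lemma).\<close>
definition holo2 :: "(complex \<times> complex \<Rightarrow> complex) \<Rightarrow> (complex \<times> complex) set \<Rightarrow> bool" where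
  "holo2 g U \<longleftrightarrow> open U \<and> continuous_on U g \<and>
     (\<forall>x y. (x, y) \<in> U \<longrightarrow>
        (\<lambda>w. g (w, y)) field_differentiable (at x) \<and> (\<lambda>w. g (x, w)) field_differentiable (at y))"

text \<open>Value of the meromorphic continuation of the double series at a regular point:
  the value at (s1,s2) of any holomorphic function on a connected open set containing (s1,s2)
  that agrees with the series on the (nonempty) part of the absolute convergence region inside it.\<close>
definition Phi2 :: "complex \<Rightarrow> complex \<Rightarrow> real \<Rightarrow> complex \<Rightarrow> complex \<Rightarrow> complex" where
  "Phi2 s1 s2 a z1 z2 =
     (THE v. \<exists>U g. open U \<and> connected U \<and> (s1, s2) \<in> U \<and> holo2 g U \<and>
        U \<inter> Phi2_acr \<noteq> {} \<and>
        (\<forall>p\<in>U \<inter> Phi2_acr. g p = Phi2_series (fst p) (snd p) a z1 z2) \<and>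
        g (s1, s2) = v)"

definition fvec :: "real \<Rightarrow> real \<Rightarrow> real \<Rightarrow> complex \<Rightarrow> complex \<Rightarrow> real \<Rightarrow> real \<Rightarrow> complex" where
  "fvec \<sigma>1 \<sigma>2 a z1 z2 t1 t2 =
     Gamma (Complex \<sigma>1 t1) * Gamma (Complex \<sigma>2 t2) * Phi2 (Complex \<sigma>1 t1) (Complex \<sigma>2 t2) a z1 z2"

definition Fvec :: "real \<Rightarrow> real \<Rightarrow> real \<Rightarrow> complex \<Rightarrow> complex \<Rightarrow> real \<Rightarrow> real \<Rightarrow> complex" where
  "Fvec \<sigma>1 \<sigma>2 a z1 z2 t1 t2 = fvec \<sigma>1 \<sigma>2 a z1 z2 t1 t2 / fvec \<sigma>1 \<sigma>2 a z1 z2 0 0"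

definition char2 :: "(real \<times> real) measure \<Rightarrow> real \<Rightarrow> real \<Rightarrow> complex" where
  "char2 M t1 t2 = (CLINT p|M. cis (t1 * fst p + t2 * snd p))"

definition is_charfun2 :: "(real \<Rightarrow> real \<Rightarrow> complex) \<Rightarrow> (real \<times> real) measure \<Rightarrow> bool" where
  "is_charfun2 F M \<longleftrightarrow> prob_space M \<and> sets M = sets borel \<and> (\<forall>t1 t2. char2 M t1 t2 = F t1 t2)"

definition has_density2 :: "(real \<times> real) measure \<Rightarrow> (real \<Rightarrow> real \<Rightarrow> complex) \<Rightarrow> bool" where
  "has_density2 M P \<longleftrightarrow> (\<forall>\<eta> \<theta>. P \<eta> \<theta> \<in> \<real>) \<and>
     M = density lborel (\<lambda>p. ennreal (Re (P (fst p) (snd p))))"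

definition Hfun :: "real \<Rightarrow> real \<Rightarrow> real" where
  "Hfun a x = exp ((1 - a) * x) / (exp x - 1) - 1 / x"

definition P11 :: "real \<Rightarrow> real \<Rightarrow> real \<Rightarrow> real \<Rightarrow> real \<Rightarrow> complex" where
  "P11 \<sigma>1 \<sigma>2 a \<eta> \<theta> =
     complex_of_real (exp (\<sigma>1 * \<eta>) * exp (\<sigma>2 * \<theta>)) / fvec \<sigma>1 \<sigma>2 a 1 1 0 0 *
     complex_of_real (Hfun a (exp \<eta> + exp \<theta>) / (exp (exp \<theta>) - 1)
                      + Hfun 1 (exp \<theta>) / (exp \<eta> + exp \<theta>))"

definition Pz :: "real \<Rightarrow> real \<Rightarrow> real \<Rightarrow> complex \<Rightarrow> complex \<Rightarrow> real \<Rightarrow> real \<Rightarrow> complex" where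
  "Pz \<sigma>1 \<sigma>2 a z1 z2 \<eta> \<theta> =
     complex_of_real (exp (\<sigma>1 * \<eta>) * exp (\<sigma>2 * \<theta>) * exp ((1 - a) * (exp \<eta> + exp \<theta>))) /
     (fvec \<sigma>1 \<sigma>2 a z1 z2 0 0 * (complex_of_real (exp (exp \<theta>)) - z2) *
      (complex_of_real (exp (exp \<eta> + exp \<theta>)) - z1))"

end

theory Submission
  imports Defs "HOL-Complex_Analysis.Complex_Analysis"
begin

text \<open>In the coordinates \<open>x = e\<^sup>\<eta>\<close>, \<open>y = e\<^sup>\<theta>\<close>, the function \<open>\<Gamma>(s1) \<Gamma>(s2) \<Phi>\<^sub>2(s1, s2)\<close> is the two-sided
  Laplace transform of \<open>exp ((1 - a) (x + y)) / ((e\<^sup>y - z2) (e\<^sup>x\<^sup>+\<^sup>y - z1))\<close>. Hence the normalised function is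
  a characteristic function exactly if the kernel divided by \<open>f(0)\<close> is nonnegative, by uniqueness of Fourier transforms and
  continuity of the kernel. For \<open>z1 = z2 = 1\<close> the integral diverges in the relevant strip; there the singular part
  \<open>1 / (y (x + y))\<close>, cut off at \<open>y < 1\<close>, contributes \<open>b(s1) / (s1 + s2 - 2)\<close>, and beyond the polar line the same
  expression equals minus the integral over \<open>y \<ge> 1\<close>, so that the kernel becomes the one built from \<open>H\<close>.

  That all local continuations of the double series agree is not automatic (the domains are arbitrary connected sets):
  it is derived from a recursion that raises \<open>s2\<close> by one and continues the series, multiplied by a nonzero
  holomorphic factor, to \<open>{Re s2 > 1 - N, Re (s1 + s2) > 2 - N}\<close> for every \<open>N\<close>.\<close>

section \<open>Holomorphic functions of two variables\<close>

text \<open>\<open>Phi2\<close> is a definite description over all connected open domains, so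
  continuations that reach the same point around different sides of the polar loci have to be
  compared. Once the poles are cleared by a factor \<open>D\<close>, two competing continuations
  \<open>g\<close> and \<open>h\<close> satisfy \<open>D * g = G = D * h\<close> near the point;
  this fixes them off the zeros of \<open>D\<close>, and by continuity on them too. Continuation up
  to a factor is enough, and neither residues nor exact polar loci have to be computed. The
  recursion replaces the inner shift \<open>b\<close> by \<open>b + u\<close> and integrates over
  \<open>u\<close>, which is why continuation is carried out for all shifts \<open>b \<ge> a\<close>
  at once, while the series itself has \<open>b = a + 1\<close>. The threshold 1/2 comes from the
  limit of H(a, x) at 0, which is 1/2 - a. For a < 1/2 it makes the kernel positive for small x + y
  and much smaller y, whereas the kernel is negative elsewhere. For a \<ge> 1/2 the kernel is
  negative throughout; then f(0) is negative as well, and the quotient is positive. Only constancy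
  of the sign matters.\<close>

lemma holo2_open: "holo2 g U \<Longrightarrow> open U"
  by (simp add: holo2_def)

lemma holo2_cont: "holo2 g U \<Longrightarrow> continuous_on U g"
  by (simp add: holo2_def)

lemma holo2_subset: "holo2 g U \<Longrightarrow> open V \<Longrightarrow> V \<subseteq> U \<Longrightarrow> holo2 g V"
  by (auto simp: holo2_def intro: continuous_on_subset)

lemma holo2_slice1: "holo2 g U \<Longrightarrow> (\<lambda>w. g (w, y)) holomorphic_on {w. (w, y) \<in> U}"
  by (auto simp: holo2_def holomorphic_on_def intro: field_differentiable_at_within)

lemma holo2_slice2: "holo2 g U \<Longrightarrow> (\<lambda>w. g (x, w)) holomorphic_on {w. (x, w) \<in> U}"
  by (auto simp: holo2_def holomorphic_on_def intro: field_differentiable_at_within)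

lemma holo2_const: "open U \<Longrightarrow> holo2 (\<lambda>_. c) U"
  by (simp add: holo2_def)

lemma holo2_fst: "open U \<Longrightarrow> holo2 fst U"
  by (auto simp: holo2_def intro!: continuous_intros)

lemma holo2_snd: "open U \<Longrightarrow> holo2 snd U"
  by (auto simp: holo2_def intro!: continuous_intros)

lemma holo2_add: "holo2 f U \<Longrightarrow> holo2 g U \<Longrightarrow> holo2 (\<lambda>p. f p + g p) U"
  by (auto simp: holo2_def intro!: continuous_intros field_differentiable_add)

lemma holo2_diff: "holo2 f U \<Longrightarrow> holo2 g U \<Longrightarrow> holo2 (\<lambda>p. f p - g p) U"
  by (auto simp: holo2_def intro!: continuous_intros field_differentiable_diff)

lemma holo2_mult: "holo2 f U \<Longrightarrow> holo2 g U \<Longrightarrow> holo2 (\<lambda>p. f p * g p) U"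
  by (auto simp: holo2_def intro!: continuous_intros field_differentiable_mult)

lemma holo2_minus: "holo2 f U \<Longrightarrow> holo2 (\<lambda>p. - f p) U"
  by (auto simp: holo2_def intro!: continuous_intros field_differentiable_minus)

lemma holo2_divide:
  "holo2 f U \<Longrightarrow> holo2 g U \<Longrightarrow> (\<And>p. p \<in> U \<Longrightarrow> g p \<noteq> 0) \<Longrightarrow> holo2 (\<lambda>p. f p / g p) U"
  by (auto simp: holo2_def intro!: continuous_intros field_differentiable_divide)

lemma holo2_compose:
  assumes "holo2 f U" "h holomorphic_on UNIV"
  shows "holo2 (\<lambda>p. h (f p)) U"
proof -
  have h: "h field_differentiable (at x)" for x
    using assms(2) by (simp add: holomorphic_on_def)
  have "continuous_on UNIV h" using assms(2) by (rule holomorphic_on_imp_continuous_on)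
  then show ?thesis
    using assms(1) h
    by (auto simp: holo2_def intro: continuous_on_compose2 field_differentiable_compose[unfolded o_def])
qed

lemma holo2_shift:
  assumes "holo2 f U"
  shows "holo2 (\<lambda>p. f (fst p + c, snd p + d)) {p. (fst p + c, snd p + d) \<in> U}"
proof -
  let ?T = "\<lambda>p::complex \<times> complex. (fst p + c, snd p + d)"
  have c: "continuous_on UNIV ?T" by (intro continuous_intros)
  have o: "open (?T -` U)"
    using assms by (intro open_vimage c) (simp add: holo2_def)
  have c2: "continuous_on (?T -` U) (\<lambda>p. f (?T p))"
    by (rule continuous_on_compose2[OF holo2_cont[OF assms] continuous_on_subset[OF c]]) auto
  have lin: "(\<lambda>w. w + e) field_differentiable (at u)" for u e :: complex
    by (intro field_differentiable_add field_differentiable_ident field_differentiable_const)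
  have "(\<lambda>w. f (w + c, y + d)) field_differentiable (at x)" 
       "(\<lambda>w. f (x + c, w + d)) field_differentiable (at y)" if "(x + c, y + d) \<in> U" for x y
    using assms that field_differentiable_compose[OF lin, of "\<lambda>w. f (w, y + d)" x c]
      field_differentiable_compose[OF lin, of "\<lambda>w. f (x + c, w)" y d]
    by (auto simp: holo2_def o_def)
  then show ?thesis using o c2 unfolding holo2_def vimage_def by auto
qed

text \<open>The identity theorem of one variable is used twice: along the first coordinate for each
  second coordinate in a small open set, and then along the second coordinate for every first
  one.\<close>

lemma holo2_identity_box:
  assumes h: "holo2 f (B1 \<times> B2)" and B: "open B1" "connected B1" "open B2" "connected B2"
    and V: "open V" "V \<noteq> {}" "V \<subseteq> B1 \<times> B2" "\<And>p. p \<in> V \<Longrightarrow> f p = 0"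
    and p: "p \<in> B1 \<times> B2"
  shows "f p = 0"
proof -
  obtain q1 q2 where q: "(q1, q2) \<in> V" using V by auto
  obtain V1 V2 where VV: "open V1" "open V2" "q1 \<in> V1" "q2 \<in> V2" "V1 \<times> V2 \<subseteq> V"
    using V(1) q by (metis open_prod_elim mem_Sigma_iff)
  have sub: "V1 \<subseteq> B1" "V2 \<subseteq> B2" using VV V(3) by auto
  obtain x y where xy: "p = (x, y)" "x \<in> B1" "y \<in> B2" using p by auto
  have lp: "q1 islimpt V1" "q2 islimpt V2"
    using VV by (auto simp: interior_limit_point interior_open)
  have 1: "f (w, v) = 0" if "w \<in> B1" "v \<in> V2" for w v
  proof (rule analytic_continuation[of "\<lambda>w. f (w, v)" B1 V1 q1])
    show "(\<lambda>w. f (w, v)) holomorphic_on B1"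
      using holo2_slice1[OF h, of v] that sub by (auto simp: subset_iff elim!: holomorphic_on_subset)
  qed (use that VV V sub lp B in auto)
  show ?thesis unfolding xy
  proof (rule analytic_continuation[of "\<lambda>v. f (x, v)" B2 V2 q2])
    show "(\<lambda>v. f (x, v)) holomorphic_on B2"
      using holo2_slice2[OF h, of x] xy by (auto simp: subset_iff elim!: holomorphic_on_subset)
  qed (use xy VV sub lp B 1 in auto)
qed

text \<open>The interior of the zero set is open, and it is also closed in \<open>U\<close>: a
  polydisc around a boundary point meets it in an open set, so \<open>f\<close> vanishes on the
  polydisc by \<open>holo2_identity_box\<close>.\<close>

lemma holo2_identity:
  assumes h: "holo2 f U" and U: "connected U"
    and V: "open V" "V \<noteq> {}" "V \<subseteq> U" "\<And>p. p \<in> V \<Longrightarrow> f p = 0"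
    and p: "p \<in> U"
  shows "f p = 0"
proof -
  define S where "S = {p. \<exists>W. open W \<and> p \<in> W \<and> W \<subseteq> U \<and> (\<forall>q\<in>W. f q = 0)}"
  have oS: "open S"
  proof (subst open_subopen, rule ballI)
    fix q assume "q \<in> S"
    then obtain W where W: "open W" "q \<in> W" "W \<subseteq> U" "\<forall>q\<in>W. f q = 0" by (auto simp: S_def)
    then show "\<exists>T. open T \<and> q \<in> T \<and> T \<subseteq> S" by (intro exI[of _ W]) (auto simp: S_def)
  qed
  have oU: "open U" using h by (rule holo2_open)
  have SU: "S \<subseteq> U" by (auto simp: S_def)
  have "open (U - S)"
  proof (subst open_subopen, rule ballI)
    fix q assume q: "q \<in> U - S"
    obtain A B where AB: "open A" "open B" "fst q \<in> A" "snd q \<in> B" "A \<times> B \<subseteq> U"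
      using oU q by (metis DiffD1 mem_Times_iff open_prod_elim)
    obtain r1 r2 where r: "r1 > 0" "ball (fst q) r1 \<subseteq> A" "r2 > 0" "ball (snd q) r2 \<subseteq> B"
      using AB by (metis open_contains_ball)
    let ?P = "ball (fst q) r1 \<times> ball (snd q) r2"
    have P: "?P \<subseteq> U" "open ?P" "q \<in> ?P"
      using AB r by (auto simp: open_Times mem_Times_iff)
    have "?P \<inter> S = {}"
    proof (rule ccontr)
      assume "?P \<inter> S \<noteq> {}"
      then obtain t W where t: "t \<in> ?P" "t \<in> W" "open W" "\<forall>q\<in>W. f q = 0" by (auto simp: S_def)
      have "f x = 0" if "x \<in> ?P" for x
        by (rule holo2_identity_box[of f "ball (fst q) r1" "ball (snd q) r2" "W \<inter> ?P"])
           (use holo2_subset[OF h P(2,1)] t P that in auto)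
      then have "q \<in> S" using P by (auto simp: S_def)
      then show False using q by auto
    qed
    then show "\<exists>T. open T \<and> q \<in> T \<and> T \<subseteq> U - S" using P by (intro exI[of _ ?P]) auto
  qed
  moreover have "V \<subseteq> S" using V by (auto simp: S_def)
  ultimately have "U - S = {}"
    using connectedD[OF U oS, of "U - S"] V SU by blast
  then show ?thesis using p by (auto simp: S_def)
qed

section \<open>Integrals depending holomorphically on two parameters\<close>

text \<open>Dominated convergence along sequences. The majorant is only local in the parameter, so a
  sequence has to be shifted until it lies in the ball of its limit.\<close>

lemma LINT_continuous_on:
  fixes f :: "'p::metric_space \<Rightarrow> 'a \<Rightarrow> complex"
  assumes meas: "\<And>p. p \<in> U \<Longrightarrow> f p \<in> borel_measurable M"
    and cont: "\<And>x. x \<in> space M \<Longrightarrow> continuous_on U (\<lambda>p. f p x)"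
    and dom: "\<And>p. p \<in> U \<Longrightarrow> \<exists>r>0. \<exists>w. integrable M w \<and>
        (\<forall>q\<in>ball p r \<inter> U. \<forall>x\<in>space M. norm (f q x) \<le> w x)"
  shows "continuous_on U (\<lambda>p. LINT x|M. f p x)"
  unfolding continuous_on_sequentially
proof (intro allI ballI impI)
  fix X p assume p: "p \<in> U" and X: "(\<forall>n. X n \<in> U) \<and> X \<longlonglongrightarrow> p"
  obtain r w where r: "r > 0" and w: "integrable M w"
    and b: "\<And>q x. q \<in> ball p r \<inter> U \<Longrightarrow> x \<in> space M \<Longrightarrow> norm (f q x) \<le> w x"
    using dom[OF p] by blast
  have "\<forall>\<^sub>F n in sequentially. X n \<in> ball p r"
    using X r by (auto simp: tendsto_iff dist_commute)
  then obtain N where N: "\<And>n. n \<ge> N \<Longrightarrow> X n \<in> ball p r" by (auto simp: eventually_sequentially)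
  have "(\<lambda>n. LINT x|M. f (X (n + N)) x) \<longlonglongrightarrow> (LINT x|M. f p x)"
  proof (rule integral_dominated_convergence[where w = w])
    show "AE x in M. (\<lambda>n. f (X (n + N)) x) \<longlonglongrightarrow> f p x"
    proof (rule AE_I2)
      fix x assume "x \<in> space M"
      from cont[OF this] X p have "(\<lambda>n. f (X n) x) \<longlonglongrightarrow> f p x"
        by (auto simp: continuous_on_sequentially o_def)
      then show "(\<lambda>n. f (X (n + N)) x) \<longlonglongrightarrow> f p x" by (rule LIMSEQ_ignore_initial_segment)
    qed
    show "AE x in M. norm (f (X (n + N)) x) \<le> w x" for n
      using N[of "n + N"] X b by (intro AE_I2) auto
  qed (use meas p X w in auto)
  then show "((\<lambda>p. LINT x|M. f p x) \<circ> X) \<longlonglongrightarrow> (LINT x|M. f p x)"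
    unfolding o_def by (rule LIMSEQ_offset)
qed

text \<open>Cauchy's inequality on discs of radius \<open>r / 4\<close> around points of the
  half-sized ball bounds the derivative there, hence the difference quotient. It turns a majorant of
  a family into one of its difference quotients.\<close>

lemma bounded_holomorphic_quotient:
  fixes f :: "complex \<Rightarrow> complex"
  assumes f: "f holomorphic_on ball z r" and b: "\<And>w. w \<in> ball z r \<Longrightarrow> norm (f w) \<le> B"
    and w: "norm (w - z) < r / 2" "w \<noteq> z"
  shows "norm ((f w - f z) / (w - z)) \<le> 4 * B / r"
proof -
  have r: "r > 0" using w norm_ge_zero[of "w - z"] by linarith
  have B: "B \<ge> 0" using b[of z] r order_trans[OF norm_ge_zero[of "f z"]] by simp
  have d: "norm (deriv f u) \<le> 4 * B / r" if "u \<in> ball z (r/2)" for u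
  proof -
    have sub: "cball u (r / 4) \<subseteq> ball z r"
    proof
      fix v assume "v \<in> cball u (r/4)"
      then show "v \<in> ball z r"
        using that r dist_triangle[of z v u] by (auto simp: dist_commute)
    qed
    have "norm ((deriv ^^ 1) f u) \<le> fact 1 * B / (r/4)^1"
    proof (rule Cauchy_inequality)
      show "f holomorphic_on ball u (r/4)"
        by (rule holomorphic_on_subset[OF f order_trans[OF ball_subset_cball sub]])
      show "continuous_on (cball u (r/4)) f"
        by (rule continuous_on_subset[OF holomorphic_on_imp_continuous_on[OF f] sub])
      show "norm (f x) \<le> B" if "norm (u - x) = r/4" for x
        using b[of x] sub that by (auto simp: dist_norm subset_iff)
    qed (use r in auto)
    then show ?thesis unfolding power_one_right fact_1 by (simp add: mult.commute)
  qed
  have "norm (f w - f z) \<le> 4 * B / r * norm (w - z)"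
  proof (rule field_differentiable_bound[of "ball z (r/2)" f "deriv f"])
    show "(f has_field_derivative deriv f u) (at u within ball z (r/2))" if "u \<in> ball z (r/2)" for u
      using that r by (intro DERIV_subset[OF holomorphic_derivI[OF f, of u, of UNIV]]) auto
  qed (use d w(1) r in \<open>simp_all add: dist_norm norm_minus_commute\<close>)
  then show ?thesis using w by (simp add: norm_divide pos_divide_le_eq)
qed

text \<open>Differentiation under the integral sign without a separate hypothesis on the derivative:
  by Cauchy's inequality the majorant \<open>W\<close> yields the majorant \<open>4 * W / r\<close>
  for the quotients.\<close>

lemma LINT_field_differentiable:
  fixes f :: "complex \<Rightarrow> 'a \<Rightarrow> complex"
  assumes r: "r > 0" and meas: "\<And>w. w \<in> ball z r \<Longrightarrow> f w \<in> borel_measurable M"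
    and hol: "\<And>x. x \<in> space M \<Longrightarrow> (\<lambda>w. f w x) holomorphic_on ball z r"
    and W: "integrable M W" and b: "\<And>w x. w \<in> ball z r \<Longrightarrow> x \<in> space M \<Longrightarrow> norm (f w x) \<le> W x"
  shows "(\<lambda>w. LINT x|M. f w x) field_differentiable (at z)"
proof -
  let ?q = "\<lambda>w x. (f w x - f z x) / (w - z)"
  have int: "integrable M (f w)" if "w \<in> ball z r" for w
    using b[OF that] by (intro Bochner_Integration.integrable_bound[OF W meas[OF that]] AE_I2) fastforce
  have lim: "((\<lambda>w. ?q w x) \<longlongrightarrow> deriv (\<lambda>w. f w x) z) (at z)" if "x \<in> space M" for x
    using holomorphic_derivI[OF hol[OF that], of z] r by (auto simp: has_field_derivative_iff)
  have ex: "\<forall>n::nat. z + of_real (r / (2 * (real n + 2))) \<in> ball z r - {z}"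
  proof
    fix n :: nat
    have "r / (2 * (real n + 2)) < r / 1" using r by (intro divide_strict_left_mono) auto
    then show "z + of_real (r / (2 * (real n + 2))) \<in> ball z r - {z}" 
      using r by (auto simp: dist_norm simp del: of_real_divide)
  qed
  \<comment> \<open>Any sequence in the punctured ball with limit \<open>z\<close> would do. Along
    it the derivative is a pointwise limit of measurable quotients, so it is measurable in
    \<open>x\<close>.\<close>
  let ?h = "\<lambda>n::nat. z + of_real (r / (2 * (real n + 2))) :: complex"
  have "(\<lambda>n. r / (2 * (real n + 2))) \<longlonglongrightarrow> 0" by real_asymp
  then have "(\<lambda>n. of_real (r / (2 * (real n + 2))) :: complex) \<longlonglongrightarrow> of_real 0" by (rule tendsto_of_real)
  then have "?h \<longlonglongrightarrow> z" using tendsto_add[OF tendsto_const[of z]] by fastforce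
  then have hf: "filterlim ?h (at z) sequentially" using ex by (auto simp: filterlim_at)
  have dm: "(\<lambda>x. deriv (\<lambda>w. f w x) z) \<in> borel_measurable M"
  proof (rule borel_measurable_LIMSEQ_metric)
    show "(\<lambda>x. ?q (?h n) x) \<in> borel_measurable M" for n
      using meas[of z] meas[of "?h n"] ex r by (intro borel_measurable_divide borel_measurable_diff borel_measurable_const) auto
    show "(\<lambda>n. ?q (?h n) x) \<longlonglongrightarrow> deriv (\<lambda>w. f w x) z" if "x \<in> space M" for x
      using filterlim_compose[OF lim[OF that] hf] .
  qed
  have "((\<lambda>w. (LINT x|M. ?q w x)) \<longlongrightarrow> (LINT x|M. deriv (\<lambda>w. f w x) z)) (at z)"
    unfolding tendsto_at_iff_sequentially
  proof (intro allI impI)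
    fix X assume X: "\<forall>i. X i \<in> UNIV - {z}" and "X \<longlonglongrightarrow> z"
    then have "\<forall>\<^sub>F n in sequentially. X n \<in> ball z (r/2)"
      using r by (auto simp: tendsto_iff dist_commute elim: allE[of _ "r/2"])
    then obtain N where N: "\<And>n. n \<ge> N \<Longrightarrow> X n \<in> ball z (r/2)" by (auto simp: eventually_sequentially)
    have Xf: "filterlim (\<lambda>n. X (n + N)) (at z) sequentially"
      using X LIMSEQ_ignore_initial_segment[OF \<open>X \<longlonglongrightarrow> z\<close>, of N] by (auto simp: filterlim_at)
    have NB: "X (n + N) \<in> ball z r" for n using N[of "n+N"] r by auto
    have "(\<lambda>n. LINT x|M. ?q (X (n + N)) x) \<longlonglongrightarrow> (LINT x|M. deriv (\<lambda>w. f w x) z)"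
    proof (rule integral_dominated_convergence[where w = "\<lambda>x. 4 * W x / r"])
      show "AE x in M. (\<lambda>n. ?q (X (n + N)) x) \<longlonglongrightarrow> deriv (\<lambda>w. f w x) z"
        using filterlim_compose[OF lim Xf] by (intro AE_I2)
      show "AE x in M. norm (?q (X (n + N)) x) \<le> 4 * W x / r" for n
        using N[of "n+N"] X b hol
        by (intro AE_I2 bounded_holomorphic_quotient) (auto simp: dist_norm norm_minus_commute)
      show "?q (X (n + N)) \<in> borel_measurable M" for n
        using meas[OF NB[of n]] meas[of z] r by (intro borel_measurable_divide borel_measurable_diff borel_measurable_const) auto
    qed (use dm W in auto)
    then show "((\<lambda>w. (LINT x|M. ?q w x)) \<circ> X) \<longlonglongrightarrow> (LINT x|M. deriv (\<lambda>w. f w x) z)"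
      unfolding o_def by (rule LIMSEQ_offset)
  qed
  moreover have "\<forall>\<^sub>F w in at z. (LINT x|M. ?q w x) = ((LINT x|M. f w x) - (LINT x|M. f z x)) / (w - z)"
  proof -
    have "\<forall>\<^sub>F w in at z. w \<in> ball z r" using r eventually_at_in_open'[of "ball z r" z] by simp
    then show ?thesis
      by eventually_elim (use r in \<open>simp add: int\<close>)
  qed
  ultimately have "((\<lambda>w. LINT x|M. f w x) has_field_derivative (LINT x|M. deriv (\<lambda>w. f w x) z)) (at z)"
    unfolding has_field_derivative_iff by (rule Lim_transform_eventually)
  then show ?thesis by (auto simp: field_differentiable_def)
qed

lemma holo2_LINT:
  fixes f :: "complex \<times> complex \<Rightarrow> 'a \<Rightarrow> complex"
  assumes U: "open U" and meas: "\<And>p. p \<in> U \<Longrightarrow> f p \<in> borel_measurable M"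
    and hol: "\<And>x. x \<in> space M \<Longrightarrow> holo2 (\<lambda>p. f p x) U"
    and dom: "\<And>p. p \<in> U \<Longrightarrow> \<exists>r>0. \<exists>w. integrable M w \<and>
        (\<forall>q\<in>ball p r \<inter> U. \<forall>x\<in>space M. norm (f q x) \<le> w x)"
  shows "holo2 (\<lambda>p. LINT x|M. f p x) U"
  unfolding holo2_def
proof (intro conjI allI impI)
  show "continuous_on U (\<lambda>p. LINT x|M. f p x)"
    by (rule LINT_continuous_on) (use meas hol dom in \<open>auto simp: holo2_def\<close>)
next
  fix x y assume p: "(x, y) \<in> U"
  obtain r w where r: "r > 0" and w: "integrable M w"
    and b: "\<And>q t. q \<in> ball (x, y) r \<inter> U \<Longrightarrow> t \<in> space M \<Longrightarrow> norm (f q t) \<le> w t"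
    using dom[OF p] by blast
  obtain r' where r': "r' > 0" "ball (x, y) r' \<subseteq> U" using U p by (meson open_contains_ball)
  let ?r = "min r r'"
  have s1: "(v, y) \<in> ball (x, y) r \<inter> U" if "v \<in> ball x ?r" for v
    using that r' by (auto simp: dist_prod_def subset_iff)
  have s2: "(x, v) \<in> ball (x, y) r \<inter> U" if "v \<in> ball y ?r" for v
    using that r' by (auto simp: dist_prod_def subset_iff)
  show "(\<lambda>v. LINT t|M. f (v, y) t) field_differentiable (at x)"
  proof (rule LINT_field_differentiable[of ?r _ _ _ w])
    show "(\<lambda>v. f (v, y) t) holomorphic_on ball x ?r" if "t \<in> space M" for t
      using holo2_slice1[OF hol[OF that], of y] s1 by (auto elim!: holomorphic_on_subset)
  qed (use s1 b w r r' meas in auto)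
  show "(\<lambda>v. LINT t|M. f (x, v) t) field_differentiable (at y)"
  proof (rule LINT_field_differentiable[of ?r _ _ _ w])
    show "(\<lambda>v. f (x, v) t) holomorphic_on ball y ?r" if "t \<in> space M" for t
      using holo2_slice2[OF hol[OF that], of x] s2 by (auto elim!: holomorphic_on_subset)
  qed (use s2 b w r r' meas in auto)
qed (rule U)

section \<open>Independence of the continued value from the chosen domain\<close>

text \<open>A factor may vanish at the very point where the continuation is evaluated. All that is
  asked is that its zero set has empty interior, so that identities can be divided by it on a dense
  set.\<close>

definition nondegenerate :: "(complex \<times> complex \<Rightarrow> complex) \<Rightarrow> bool" where
  "nondegenerate D \<longleftrightarrow> holo2 D UNIV \<and> (\<forall>V. open V \<longrightarrow> V \<noteq> {} \<longrightarrow> (\<exists>p\<in>V. D p \<noteq> 0))"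

text \<open>The double sum converges for \<open>N = 0\<close>; each use of the recursion moves both
  walls to the left by one, and in the limit everything is covered.\<close>

definition Phi2_strip :: "nat \<Rightarrow> (complex \<times> complex) set" where
  "Phi2_strip N = {p. Re (snd p) > 1 - real N \<and> Re (fst p + snd p) > 2 - real N}"

lemma open_Phi2_acr: "open Phi2_acr"
proof -
  have eq: "Phi2_acr = {p. 0 < Re (fst p)} \<inter> {p. 1 < Re (snd p)} \<inter> {p. 2 < Re (fst p + snd p)}"
    by (auto simp: Phi2_acr_def)
  show ?thesis unfolding eq by (intro open_Int open_Collect_less continuous_intros)
qed

lemma open_Phi2_strip: "open (Phi2_strip N)"
  unfolding Phi2_strip_def by (intro open_Collect_conj open_Collect_less continuous_intros)

lemma Phi2_strip_mono: "M \<le> N \<Longrightarrow> Phi2_strip M \<subseteq> Phi2_strip N"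
  by (auto simp: Phi2_strip_def)

lemma Phi2_acr_subset_strip: "Phi2_acr \<subseteq> Phi2_strip N"
  by (auto simp: Phi2_strip_def Phi2_acr_def)

lemma Phi2_strip_cover: "(\<Union>N. Phi2_strip N) = UNIV"
proof -
  have "\<exists>N. p \<in> Phi2_strip N" for p
  proof -
    obtain N :: nat where "real N > 2 + \<bar>Re (snd p)\<bar> + \<bar>Re (fst p + snd p)\<bar>"
      using reals_Archimedean2 by blast
    then show ?thesis by (intro exI[of _ N]) (auto simp: Phi2_strip_def)
  qed
  then show ?thesis by auto
qed

text \<open>A path in \<open>U\<close> from \<open>p\<close> into \<open>A\<close> is compact and
  therefore lies in a single \<open>O' N\<close>; along it \<open>D * g = G\<close> propagates by
  the identity theorem. The bound \<open>N0\<close> comes from the path alone, before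
  \<open>D\<close> and \<open>G\<close> are chosen, so that two continuations can later be served by
  a common \<open>N\<close>.\<close>

lemma continuation_locally_determined:
  assumes g: "holo2 g U" "connected U" "p \<in> U" "q \<in> U \<inter> A" and A: "open A" "\<And>N. A \<subseteq> O' N"
    and ser: "\<And>x. x \<in> U \<inter> A \<Longrightarrow> g x = S x"
    and O': "\<And>N. open (O' N)" "\<And>M N. M \<le> N \<Longrightarrow> O' M \<subseteq> O' N" "(\<Union>N::nat. O' N) = UNIV"
  shows "\<exists>N0. \<forall>N\<ge>N0. \<forall>D G. holo2 D UNIV \<longrightarrow> holo2 G (O' N) \<longrightarrow> (\<forall>x\<in>A. D x * S x = G x) \<longrightarrow>
    (\<exists>W. open W \<and> p \<in> W \<and> W \<subseteq> U \<and> (\<forall>x\<in>W. D x * g x = G x))"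
proof -
  have oU: "open U" using g(1) by (rule holo2_open)
  have "path_connected U" using g(2) oU by (rule connected_open_path_connected[rotated])
  then obtain c where c: "path c" "path_image c \<subseteq> U" "pathstart c = p" "pathfinish c = q"
    using g by (force simp: path_connected_def)
  have "compact (path_image c)" using c(1) by (rule compact_path_image)
  moreover have "path_image c \<subseteq> \<Union> (range O')" using O'(3) by simp
  ultimately obtain I where I: "finite I" "path_image c \<subseteq> \<Union> (O' ` I)"
    using compactE_image[of "path_image c" UNIV O'] O'(1) by auto
  have pI: "path_image c \<subseteq> O' N" if N: "N \<ge> Max (insert 0 I)" for N
  proof
    fix x assume "x \<in> path_image c"
    then obtain i where i: "i \<in> I" "x \<in> O' i" using I by auto
    then have "i \<le> N" using I N by (auto intro: order_trans[OF Max_ge])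
    then show "x \<in> O' N" using O'(2) i by blast
  qed
  show ?thesis
  proof (intro exI[of _ "Max (insert 0 I)"] allI impI)
    fix N D G assume N: "N \<ge> Max (insert 0 I)" and D: "holo2 D UNIV" and G: "holo2 G (O' N)"
      and DG: "\<forall>x\<in>A. D x * S x = G x"
    \<comment> \<open>\<open>U \<inter> O' N\<close> may be disconnected, but the path keeps
      \<open>p\<close> and \<open>q\<close> in one component.\<close>
    let ?C = "connected_component_set (U \<inter> O' N) p"
    have oC: "open ?C" using oU O'(1) by (intro open_connected_component open_Int)
    have CU: "?C \<subseteq> U \<inter> O' N" by (rule connected_component_subset)
    have cpath: "path_image c \<subseteq> ?C"
      using c pI[OF N] by (intro connected_component_maximal connected_path_image) 
        (auto simp: pathstart_in_path_image[of c, unfolded c(3)])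
    have pq: "p \<in> ?C" "q \<in> ?C"
      using cpath pathstart_in_path_image[of c] pathfinish_in_path_image[of c] c by auto
    have h: "holo2 (\<lambda>x. D x * g x - G x) ?C"
      using CU oC by (intro holo2_diff holo2_mult holo2_subset[OF D] holo2_subset[OF g(1)] holo2_subset[OF G]) auto
    have "D x * g x - G x = 0" if "x \<in> ?C" for x
      by (rule holo2_identity[OF h _ _ _ _ _ that, of "?C \<inter> A"])
         (use oC A pq g CU ser DG in auto)
    then show "\<exists>W. open W \<and> p \<in> W \<and> W \<subseteq> U \<and> (\<forall>x\<in>W. D x * g x = G x)"
      using oC pq CU by (intro exI[of _ ?C]) auto
  qed
qed

text \<open>Any two admissible continuations are tied to the same \<open>D\<close> and
  \<open>G\<close> near the point, where \<open>N\<close> is taken large enough for both. Hence the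
  definite description has exactly one candidate and every admissible \<open>g\<close> computes
  it.\<close>

lemma Phi2_eqI:
  assumes cont: "\<And>N. \<exists>D G. nondegenerate D \<and> holo2 G (Phi2_strip N) \<and>
      (\<forall>p\<in>Phi2_acr. D p * Phi2_series (fst p) (snd p) a z1 z2 = G p)"
    and g: "holo2 g U" "connected U" "(s1, s2) \<in> U" "U \<inter> Phi2_acr \<noteq> {}"
    and ser: "\<And>p. p \<in> U \<inter> Phi2_acr \<Longrightarrow> g p = Phi2_series (fst p) (snd p) a z1 z2"
  shows "Phi2 s1 s2 a z1 z2 = g (s1, s2)"
  unfolding Phi2_def
proof (rule the_equality)
  show "\<exists>U h. open U \<and> connected U \<and> (s1, s2) \<in> U \<and> holo2 h U \<and> U \<inter> Phi2_acr \<noteq> {} \<and>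
       (\<forall>p\<in>U \<inter> Phi2_acr. h p = Phi2_series (fst p) (snd p) a z1 z2) \<and> h (s1, s2) = g (s1, s2)"
    using g ser holo2_open by (intro exI[of _ U] exI[of _ g]) auto
next
  let ?S = "\<lambda>p. Phi2_series (fst p) (snd p) a z1 z2"
  fix v assume "\<exists>U g. open U \<and> connected U \<and> (s1, s2) \<in> U \<and> holo2 g U \<and> U \<inter> Phi2_acr \<noteq> {} \<and>
       (\<forall>p\<in>U \<inter> Phi2_acr. g p = ?S p) \<and> g (s1, s2) = v"
  then obtain V h where h: "holo2 h V" "connected V" "(s1, s2) \<in> V" "V \<inter> Phi2_acr \<noteq> {}"
     "\<And>p. p \<in> V \<inter> Phi2_acr \<Longrightarrow> h p = ?S p" "h (s1, s2) = v" by blast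
  note det = continuation_locally_determined[OF _ _ _ _ open_Phi2_acr Phi2_acr_subset_strip _
       open_Phi2_strip Phi2_strip_mono Phi2_strip_cover]
  obtain q where q: "q \<in> U \<inter> Phi2_acr" using g by auto
  obtain q' where q': "q' \<in> V \<inter> Phi2_acr" using h by auto
  obtain N1 where N1: "\<And>N D G. N \<ge> N1 \<Longrightarrow> holo2 D UNIV \<Longrightarrow> holo2 G (Phi2_strip N) \<Longrightarrow>
      (\<forall>x\<in>Phi2_acr. D x * ?S x = G x) \<Longrightarrow>
      \<exists>W. open W \<and> (s1, s2) \<in> W \<and> W \<subseteq> U \<and> (\<forall>x\<in>W. D x * g x = G x)"
    using det[OF g(1-3) q, of ?S, OF ser] by blast
  obtain N2 where N2: "\<And>N D G. N \<ge> N2 \<Longrightarrow> holo2 D UNIV \<Longrightarrow> holo2 G (Phi2_strip N) \<Longrightarrow>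
      (\<forall>x\<in>Phi2_acr. D x * ?S x = G x) \<Longrightarrow>
      \<exists>W. open W \<and> (s1, s2) \<in> W \<and> W \<subseteq> V \<and> (\<forall>x\<in>W. D x * h x = G x)"
    using det[OF h(1-3) q', of ?S, OF h(5)] by blast
  obtain D G where DG: "nondegenerate D" "holo2 G (Phi2_strip (max N1 N2))" "\<forall>p\<in>Phi2_acr. D p * ?S p = G p"
    using cont by blast
  have D: "holo2 D UNIV" using DG(1) by (simp add: nondegenerate_def)
  obtain W where W: "open W" "(s1, s2) \<in> W" "W \<subseteq> U" "\<forall>x\<in>W. D x * g x = G x"
    using N1[OF _ D DG(2,3)] by auto
  obtain W' where W': "open W'" "(s1, s2) \<in> W'" "W' \<subseteq> V" "\<forall>x\<in>W'. D x * h x = G x"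
    using N2[OF _ D DG(2,3)] by auto
  let ?Y = "W \<inter> W'"
  have cd: "continuous_on ?Y (\<lambda>x. g x - h x)"
    using W W' g(1) h(1) by (intro continuous_on_diff) (auto simp: holo2_def intro: continuous_on_subset)
  have "open (?Y \<inter> (\<lambda>x. g x - h x) -` (- {0}))"
    using continuous_on_open_vimage[of ?Y "\<lambda>x. g x - h x"] cd W W'
    by (metis Int_commute open_Compl closed_singleton open_Int)
  \<comment> \<open>Where the two continuations differ \<open>D\<close> must vanish; that set is
    open, so nondegeneracy leaves it empty.\<close>
  moreover have "D x = 0" if "x \<in> ?Y \<inter> (\<lambda>x. g x - h x) -` (- {0})" for x
  proof -
    have "D x * g x = D x * h x" "g x \<noteq> h x" using that W(4) W'(4) by auto
    then show ?thesis by simp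
  qed
  ultimately have "?Y \<inter> (\<lambda>x. g x - h x) -` (- {0}) = {}"
    using DG(1) unfolding nondegenerate_def by blast
  then show "v = g (s1, s2)" using W W' h(6) by auto
qed

section \<open>Holomorphic families and their continuation\<close>

definition unit_interval_measure :: "real measure" where
  "unit_interval_measure = restrict_space lborel {0..1}"

lemma space_unit_interval_measure [simp]: "space unit_interval_measure = {0..1}"
  by (simp add: unit_interval_measure_def space_restrict_space)

lemma finite_unit_interval_measure: "finite_measure unit_interval_measure"
  by (rule finite_measureI) (simp add: unit_interval_measure_def emeasure_restrict_space space_restrict_space)

lemma integrable_unit_interval_const: "integrable unit_interval_measure (\<lambda>_. c :: real)"
  using finite_unit_interval_measure by (rule finite_measure.integrable_const)

lemma measurable_unit_interval:
  fixes f :: "real \<Rightarrow> 'b::real_normed_vector"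
  assumes "continuous_on {0..1} f"
  shows "f \<in> borel_measurable unit_interval_measure"
  using borel_measurable_continuous_on_restrict[OF assms]
  by (simp add: unit_interval_measure_def cong: measurable_cong_sets sets_restrict_space_cong)

lemma integrable_unit_interval:
  fixes f :: "real \<Rightarrow> 'b::euclidean_space"
  assumes "continuous_on {0..1} f"
  shows "integrable unit_interval_measure f"
proof -
  have "compact (f ` {0..1})" using assms by (intro compact_continuous_image) auto
  then have "bounded (f ` {0..1})" by (rule compact_imp_bounded)
  then obtain B where "\<And>x. x \<in> {0..1} \<Longrightarrow> norm (f x) \<le> B"
    unfolding bounded_iff by (meson imageI)
  then show ?thesis
    by (intro Bochner_Integration.integrable_bound[OF integrable_unit_interval_const[of B] measurable_unit_interval[OF assms]] AE_I2)
       force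
qed

lemma unit_interval_FTC:
  fixes F :: "real \<Rightarrow> complex"
  assumes "\<And>x. x \<in> {0..1} \<Longrightarrow> (F has_vector_derivative f x) (at x within {0..1})"
    and "continuous_on {0..1} f"
  shows "(LINT u|unit_interval_measure. f u) = F 1 - F 0"
proof -
  have "has_bochner_integral lborel (\<lambda>x. indicator {0..1} x *\<^sub>R f x) (F 1 - F 0)"
    by (rule has_bochner_integral_FTC_Icc) (use assms in auto)
  then have "(LINT x|lborel. indicator {0..1} x *\<^sub>R f x) = F 1 - F 0"
    by (rule has_bochner_integral_integral_eq)
  then show ?thesis
    by (simp add: unit_interval_measure_def integral_restrict_space)
qed

lemma holo2_cong:
  assumes "holo2 f U" "\<And>p. p \<in> U \<Longrightarrow> f p = g p"
  shows "holo2 g U"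
proof -
  have U: "open U" using assms(1) by (rule holo2_open)
  have "(\<lambda>w. g (w, y)) field_differentiable (at x)" "(\<lambda>w. g (x, w)) field_differentiable (at y)"
    if xy: "(x, y) \<in> U" for x y
  proof -
    obtain A B where AB: "open A" "open B" "x \<in> A" "y \<in> B" "A \<times> B \<subseteq> U"
      using U xy by (auto elim: open_prod_elim)
    have d: "(\<lambda>w. f (w, y)) field_differentiable (at x)" "(\<lambda>w. f (x, w)) field_differentiable (at y)"
      using assms(1) xy by (auto simp: holo2_def)
    show "(\<lambda>w. g (w, y)) field_differentiable (at x)"
      using d(1) has_field_derivative_transform_within_open[OF _ AB(1,3)] AB assms(2)
      unfolding field_differentiable_def by (smt (verit, best) mem_Sigma_iff subset_iff)
    show "(\<lambda>w. g (x, w)) field_differentiable (at y)"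
      using d(2) has_field_derivative_transform_within_open[OF _ AB(2,4)] AB assms(2)
      unfolding field_differentiable_def by (smt (verit, best) mem_Sigma_iff subset_iff)
  qed
  then show ?thesis
    using assms by (auto simp: holo2_def cong: continuous_on_cong)
qed

text \<open>The real parameter \<open>b\<close> is the shift in the summands. Only continuity is
  asked of it, but jointly with \<open>p\<close>, because the recursion integrates over
  \<open>b\<close>.\<close>

definition param_holo ::
  "real \<Rightarrow> (complex \<times> complex) set \<Rightarrow> (complex \<times> complex \<Rightarrow> real \<Rightarrow> complex) \<Rightarrow> bool" where
  "param_holo a U G \<longleftrightarrow> continuous_on (U \<times> {a..}) (\<lambda>(p, b). G p b) \<and> (\<forall>b\<ge>a. holo2 (\<lambda>p. G p b) U)"

lemma param_holo_add: "param_holo a U F \<Longrightarrow> param_holo a U G \<Longrightarrow> param_holo a U (\<lambda>p b. F p b + G p b)"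
  by (auto simp: param_holo_def split_beta intro!: continuous_intros holo2_add)

lemma param_holo_mult: "param_holo a U F \<Longrightarrow> param_holo a U G \<Longrightarrow> param_holo a U (\<lambda>p b. F p b * G p b)"
  by (auto simp: param_holo_def split_beta intro!: continuous_intros holo2_mult)

lemma param_holo_holo2:
  assumes "holo2 f U" shows "param_holo a U (\<lambda>p b. f p)"
proof -
  have "continuous_on (U \<times> {a..}) (\<lambda>x. f (fst x))"
    by (rule continuous_on_compose2[OF holo2_cont[OF assms]]) (auto intro: continuous_intros)
  then show ?thesis using assms by (simp add: param_holo_def split_beta)
qed

lemma param_holo_subset: "param_holo a U F \<Longrightarrow> open V \<Longrightarrow> V \<subseteq> U \<Longrightarrow> param_holo a V F"
  by (auto simp: param_holo_def intro: holo2_subset elim!: continuous_on_subset)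

lemma param_holo_fixed_param:
  assumes "param_holo a U F" "c \<ge> a" shows "param_holo a U (\<lambda>p b. F p c)"
  using assms by (intro param_holo_holo2) (auto simp: param_holo_def)

lemma param_holo_shift:
  assumes "param_holo a U F"
  shows "param_holo a {p. (fst p + c, snd p + d) \<in> U} (\<lambda>p b. F (fst p + c, snd p + d) b)"
proof -
  have "continuous_on ({p. (fst p + c, snd p + d) \<in> U} \<times> {a..})
      (\<lambda>x. (\<lambda>(p, b). F p b) ((fst (fst x) + c, snd (fst x) + d), snd x))"
    by (rule continuous_on_compose2[of "U \<times> {a..}"])
       (use assms in \<open>auto simp: param_holo_def intro!: continuous_intros\<close>)
  then show ?thesis
    using assms holo2_shift[of "\<lambda>p. F p b" U c d for b] by (auto simp: param_holo_def split_beta)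
qed

text \<open>Joint continuity bounds the integrand on compact sets, so constants serve as local
  majorants on the unit interval.\<close>

lemma param_holo_LINT:
  assumes U: "open U"
    and cont: "continuous_on ((U \<times> {a..}) \<times> {0..1}) (\<lambda>(x, u). f x u)"
    and hol: "\<And>b u. b \<ge> a \<Longrightarrow> u \<in> {0..1} \<Longrightarrow> holo2 (\<lambda>p. f (p, b) u) U"
  shows "param_holo a U (\<lambda>p b. LINT u|unit_interval_measure. f (p, b) u)"
proof -
  have c1: "continuous_on {0..1} (f x)" if "x \<in> U \<times> {a..}" for x
    by (rule continuous_on_compose2[OF cont, of _ "\<lambda>u. (x, u)", simplified])
       (use that in \<open>auto intro!: continuous_intros\<close>)
  have c2: "continuous_on (U \<times> {a..}) (\<lambda>x. f x u)" if "u \<in> {0..1}" for u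
    by (rule continuous_on_compose2[OF cont, of _ "\<lambda>x. (x, u)", simplified])
       (use that in \<open>auto intro!: continuous_intros\<close>)
  have dom: "\<exists>r>0. \<exists>B. \<forall>q\<in>ball (p, b) r \<inter> (U \<times> {a..}). \<forall>u\<in>{0..1}. norm (f q u) \<le> B"
    if p: "p \<in> U" "b \<ge> a" for p b
  proof -
    obtain r where r: "r > 0" "cball p r \<subseteq> U" using U p open_contains_cball by blast
    let ?K = "(cball p r \<times> {a..b+1}) \<times> {0..1::real}"
    have "compact ?K" by (intro compact_Times) auto
    then have "compact ((\<lambda>(x, u). f x u) ` ?K)"
      using r by (intro compact_continuous_image continuous_on_subset[OF cont]) auto
    then have "bounded ((\<lambda>(x, u). f x u) ` ?K)" by (rule compact_imp_bounded)
    then obtain B where B: "\<And>y. y \<in> ?K \<Longrightarrow> norm ((\<lambda>(x, u). f x u) y) \<le> B"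
      unfolding bounded_iff by (meson imageI)
    have "norm (f q u) \<le> B" if "q \<in> ball (p, b) (min r 1) \<inter> (U \<times> {a..})" "u \<in> {0..1}" for q u
    proof -
      have "dist p (fst q) \<le> dist (p, b) q" "dist b (snd q) \<le> dist (p, b) q"
        using dist_fst_le[of "(p,b)" q] dist_snd_le[of "(p, b)" q] by auto
      then have "(q, u) \<in> ?K" using that by (auto simp: dist_real_def mem_Times_iff)
      then show ?thesis using B by fastforce
    qed
    then show ?thesis using r by (intro exI[of _ "min r 1"] conjI exI[of _ B]) auto
  qed
  show ?thesis unfolding param_holo_def split_beta
  proof (intro conjI allI impI)
    show "continuous_on (U \<times> {a..}) (\<lambda>x. LINT u|unit_interval_measure. f (fst x, snd x) u)"
      unfolding prod.collapse
    proof (rule LINT_continuous_on)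
      fix x assume x: "x \<in> U \<times> {a..}"
      show "\<exists>r>0. \<exists>w. integrable unit_interval_measure w \<and>
            (\<forall>q\<in>ball x r \<inter> U \<times> {a..}. \<forall>u\<in>space unit_interval_measure. norm (f q u) \<le> w u)"
        using dom[of "fst x" "snd x"] x integrable_unit_interval_const by (simp add: mem_Times_iff) blast
      show "f x \<in> borel_measurable unit_interval_measure"
        using c1[OF x] by (rule measurable_unit_interval)
    qed (use c2 in auto)
  next
    fix b assume b: "b \<ge> a"
    show "holo2 (\<lambda>p. LINT u|unit_interval_measure. f (p, b) u) U"
    proof (rule holo2_LINT[OF U])
      fix p assume p: "p \<in> U"
      show "f (p, b) \<in> borel_measurable unit_interval_measure"
        using c1 p b by (intro measurable_unit_interval) auto
      obtain r B where rB: "r > 0" "\<And>q u. q \<in> ball (p, b) r \<inter> (U \<times> {a..}) \<Longrightarrow> u \<in> {0..1} \<Longrightarrow> norm (f q u) \<le> B"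
        using dom[OF p b] by blast
      have "norm (f (q, b) u) \<le> B" if "q \<in> ball p r \<inter> U" "u \<in> {0..1}" for q u
        using that b by (intro rB) (auto simp: dist_Pair_Pair)
      then show "\<exists>r>0. \<exists>w. integrable unit_interval_measure w \<and>
            (\<forall>q\<in>ball p r \<inter> U. \<forall>u\<in>space unit_interval_measure. norm (f (q, b) u) \<le> w u)"
        using rB(1) integrable_unit_interval_const[of B] by (intro exI[of _ r] conjI exI[of _ "\<lambda>_. B"]) auto
    qed (use hol b in auto)
  qed
qed

text \<open>A Weierstrass test: the series is read as an integral over the counting measure, for
  which continuity and holomorphy under the integral are already available.\<close>

lemma param_holo_suminf:
  assumes U: "open U" and f: "\<And>n::nat. param_holo a U (f n)"
    and dom: "\<And>p B. p \<in> U \<Longrightarrow> B \<ge> a \<Longrightarrow> \<exists>r>0. \<exists>w. summable w \<and>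
       (\<forall>q\<in>ball p r \<inter> U. \<forall>b\<in>{a..B}. \<forall>n. norm (f n q b) \<le> w n)"
  shows "param_holo a U (\<lambda>p b. \<Sum>n. f n p b)"
proof -
  have dom': "\<exists>r>0. \<exists>w. integrable (count_space UNIV) w \<and>
       (\<forall>q\<in>ball p r \<inter> U. \<forall>b\<in>{a..B}. \<forall>n. norm (f n q b) \<le> w n)" if p: "p \<in> U" "B \<ge> a" for p B
  proof -
    obtain r w where rw: "r > 0" "summable w" "\<And>n q b. q\<in>ball p r \<inter> U \<Longrightarrow> b \<in> {a..B} \<Longrightarrow> norm (f n q b) \<le> w n"
      using dom[OF p] by blast
    have "w n \<ge> 0" for n using order_trans[OF norm_ge_zero rw(3)[of p a n]] p rw(1) by auto
    then have "integrable (count_space UNIV) w"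
      using rw(2) by (simp add: integrable_count_space_nat_iff)
    then show ?thesis using rw by blast
  qed
  have eq: "(\<Sum>n. f n p b) = (LINT n|count_space UNIV. f n p b)" if pb: "p \<in> U" "b \<ge> a" for p b
  proof -
    obtain r w where rw: "r > 0" "integrable (count_space UNIV) w"
        "\<And>n q c. q\<in>ball p r \<inter> U \<Longrightarrow> c \<in> {a..b} \<Longrightarrow> norm (f n q c) \<le> w n"
      using dom'[OF pb] by blast
    have "norm (f n p b) \<le> norm (w n)" for n using rw(1) rw(3)[of p b n] pb by auto
    then have "integrable (count_space UNIV) (\<lambda>n. f n p b)"
      by (intro Bochner_Integration.integrable_bound[OF rw(2)]) auto
    then show ?thesis using sums_integral_count_space_nat sums_unique by metis
  qed
  show ?thesis unfolding param_holo_def split_beta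
  proof (intro conjI allI impI)
    have "continuous_on (U \<times> {a..}) (\<lambda>x. LINT n|count_space UNIV. f n (fst x) (snd x))"
    proof (rule LINT_continuous_on)
      fix x assume x: "x \<in> U \<times> {a..}"
      then obtain r w where rw: "r > 0" "integrable (count_space UNIV) w" 
          "\<And>n q b. q\<in>ball (fst x) r \<inter> U \<Longrightarrow> b \<in> {a..snd x + 1} \<Longrightarrow> norm (f n q b) \<le> w n"
        using dom'[of "fst x" "snd x + 1"] by (auto simp: mem_Times_iff)
      have "norm (f n (fst q) (snd q)) \<le> w n" if "q \<in> ball x (min r 1) \<inter> (U \<times> {a..})" for q n
        using that dist_fst_le[of x q] dist_snd_le[of x q]
        by (intro rw) (auto simp: mem_Times_iff dist_real_def)
      then show "\<exists>r>0. \<exists>w. integrable (count_space UNIV) w \<and>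
            (\<forall>q\<in>ball x r \<inter> U \<times> {a..}. \<forall>n\<in>space (count_space UNIV). norm (f n (fst q) (snd q)) \<le> w n)"
        using rw(1,2) by (intro exI[of _ "min r 1"] conjI exI[of _ w]) auto
    qed (use f in \<open>auto simp: param_holo_def split_beta\<close>)
    then show "continuous_on (U \<times> {a..}) (\<lambda>x. \<Sum>n. f n (fst x) (snd x))"
      by (rule continuous_on_eq) (use eq in auto)
  next
    fix b assume b: "b \<ge> a"
    have "holo2 (\<lambda>p. LINT n|count_space UNIV. f n p b) U"
    proof (rule holo2_LINT[OF U])
      fix p assume p: "p \<in> U"
      obtain r w where "r > 0" "integrable (count_space UNIV) w" 
          "\<forall>q\<in>ball p r \<inter> U. \<forall>b\<in>{a..b}. \<forall>n. norm (f n q b) \<le> w n"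
        using dom'[OF p b] by blast
      then show "\<exists>r>0. \<exists>w. integrable (count_space UNIV) w \<and>
            (\<forall>q\<in>ball p r \<inter> U. \<forall>n\<in>space (count_space UNIV). norm (f n q b) \<le> w n)"
        using b by (intro exI[of _ r] conjI exI[of _ w]) auto
    qed (use f b in \<open>auto simp: param_holo_def\<close>)
    then show "holo2 (\<lambda>p. \<Sum>n. f n p b) U"
      by (rule holo2_cong) (use eq b in auto)
  qed
qed

section \<open>Continuation up to a nondegenerate factor\<close>

text \<open>\<open>F\<close> may acquire poles on \<open>U\<close>; \<open>D\<close> clears them. It
  must not depend on \<open>b\<close>, since it has to pass through an integral over the
  shift.\<close>

definition continues :: "real \<Rightarrow> (complex \<times> complex) set \<Rightarrow> (complex \<times> complex) set \<Rightarrow>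
    (complex \<times> complex \<Rightarrow> real \<Rightarrow> complex) \<Rightarrow> bool" where
  "continues a U0 U F \<longleftrightarrow> (\<exists>D G. nondegenerate D \<and> param_holo a U G \<and> (\<forall>p\<in>U0. \<forall>b\<ge>a. D p * F p b = G p b))"

lemma nondegenerate_holo2: "nondegenerate D \<Longrightarrow> open U \<Longrightarrow> holo2 D U"
  unfolding nondegenerate_def by (auto intro: holo2_subset)

lemma nondegenerate_mult:
  assumes D: "nondegenerate D" "nondegenerate E"
  shows "nondegenerate (\<lambda>p. D p * E p)"
  unfolding nondegenerate_def
proof (intro conjI allI impI)
  show "holo2 (\<lambda>p. D p * E p) UNIV" using D by (auto simp: nondegenerate_def intro: holo2_mult)
  fix V :: "(complex \<times> complex) set" assume V: "open V" "V \<noteq> {}"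
  obtain p where p: "p \<in> V" "D p \<noteq> 0" using V D(1) unfolding nondegenerate_def by blast
  have "continuous_on UNIV D" using D(1) by (simp add: nondegenerate_def holo2_def)
  then have "open (D -` (- {0}))" by (intro open_vimage) auto
  then have "open (V \<inter> D -` (- {0}))" "V \<inter> D -` (- {0}) \<noteq> {}" using V p by auto
  then obtain q where "q \<in> V \<inter> D -` (- {0})" "E q \<noteq> 0" using D(2) unfolding nondegenerate_def by blast
  then show "\<exists>p\<in>V. D p * E p \<noteq> 0" by auto
qed

lemma nondegenerate_shift:
  assumes D: "nondegenerate D"
  shows "nondegenerate (\<lambda>p. D (fst p + c, snd p + d))"
  unfolding nondegenerate_def
proof (intro conjI allI impI)
  show "holo2 (\<lambda>p. D (fst p + c, snd p + d)) UNIV"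
    using D holo2_shift[of D UNIV c d] by (simp add: nondegenerate_def)
  fix V :: "(complex \<times> complex) set" assume V: "open V" "V \<noteq> {}"
  have "open ((\<lambda>q. (fst q - c, snd q - d)) -` V)"
    using V by (intro open_vimage continuous_intros)
  moreover from V(2) obtain v where "v \<in> V" by auto
  then have "(fst v + c, snd v + d) \<in> (\<lambda>q. (fst q - c, snd q - d)) -` V" by simp
  ultimately obtain q where "(fst q - c, snd q - d) \<in> V" "D q \<noteq> 0"
    using D unfolding nondegenerate_def by blast
  then show "\<exists>p\<in>V. D (fst p + c, snd p + d) \<noteq> 0"
    by (intro bexI[of _ "(fst q - c, snd q - d)"]) auto
qed

text \<open>With at most one zero on each line of constant first coordinate, no ball consists of
  zeros. This fits the linear factors which the recursions produce.\<close>

lemma nondegenerateI: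
  assumes "holo2 D UNIV" and "\<And>x y e. D (x, y) = 0 \<Longrightarrow> e \<noteq> 0 \<Longrightarrow> D (x, y + e) \<noteq> 0"
  shows "nondegenerate D"
  unfolding nondegenerate_def
proof (intro conjI allI impI assms(1))
  fix V :: "(complex \<times> complex) set" assume V: "open V" "V \<noteq> {}"
  then obtain x y where xy: "(x, y) \<in> V" by auto
  then obtain e where e: "e > 0" "ball (x, y) e \<subseteq> V" using V by (meson open_contains_ball)
  have "(x, y + of_real (e/2)) \<in> ball (x, y) e" using e by (simp add: dist_Pair_Pair dist_norm)
  then show "\<exists>p\<in>V. D p \<noteq> 0"
    using xy e assms(2)[of x y "of_real (e/2)"] by (cases "D (x, y) = 0") auto
qed

text \<open>The recursion expresses \<open>F\<close> at \<open>s2\<close> through \<open>F\<close>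
  at \<open>s2 + 1\<close>, where the continuation is known already. Multiplying by
  \<open>E p * \<alpha> p * D (fst p, snd p + 1)\<close> clears the denominators of the
  inhomogeneous term, of the leading coefficient and of the shifted \<open>F\<close>; the right-hand
  side is then holomorphic on the larger set.\<close>

lemma continues_step:
  assumes F: "continues a U0 U F" and H: "continues a U0 U' H"
    and U': "open U'" "U0 \<subseteq> U'" "\<And>p. p \<in> U' \<Longrightarrow> (fst p, snd p + 1) \<in> U"
    and U0: "\<And>p. p \<in> U0 \<Longrightarrow> (fst p, snd p + 1) \<in> U0"
    and \<alpha>: "nondegenerate \<alpha>" and \<gamma>: "holo2 \<gamma> UNIV"
    and w: "continuous_on ({a..} \<times> {0..1}) (\<lambda>(b, u). w b u :: complex)"
    and \<rho>: "continuous_on ({a..} \<times> {0..1}) (\<lambda>(b, u). \<rho> b u :: real)"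
    and \<rho>a: "\<And>b u. b \<ge> a \<Longrightarrow> 0 \<le> u \<Longrightarrow> u \<le> 1 \<Longrightarrow> \<rho> b u \<ge> a"
    and rec: "\<And>p b. p \<in> U0 \<Longrightarrow> b \<ge> a \<Longrightarrow> \<alpha> p * F p b = H p b + \<gamma> p *
        (LINT u|unit_interval_measure. w b u * F (fst p, snd p + 1) (\<rho> b u))"
  shows "continues a U0 U' F"
proof -
  obtain D G where D: "nondegenerate D" and G: "param_holo a U G"
    and DG: "\<And>p b. p \<in> U0 \<Longrightarrow> b \<ge> a \<Longrightarrow> D p * F p b = G p b" using F by (auto simp: continues_def)
  obtain E K where E: "nondegenerate E" and K: "param_holo a U' K"
    and EK: "\<And>p b. p \<in> U0 \<Longrightarrow> b \<ge> a \<Longrightarrow> E p * H p b = K p b" using H by (auto simp: continues_def)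
  let ?D = "\<lambda>p. D (fst p, snd p + 1)"
  let ?f = "\<lambda>x u. w (snd x) u * G (fst (fst x), snd (fst x) + 1) (\<rho> (snd x) u)"
  have D': "nondegenerate ?D" using nondegenerate_shift[OF D, of 0 1] by simp
  have int: "param_holo a U' (\<lambda>p b. LINT u|unit_interval_measure. ?f (p, b) u)"
  proof (rule param_holo_LINT[OF U'(1)])
    let ?S = "(U' \<times> {a..}) \<times> {0..1::real}"
    have pr: "continuous_on ?S (\<lambda>x. (snd (fst x), snd x))" by (intro continuous_intros)
    have pr2: "(\<lambda>x. (snd (fst x), snd x)) ` ?S \<subseteq> {a..} \<times> {0..1}" by auto
    have 1: "continuous_on ?S (\<lambda>x. w (snd (fst x)) (snd x))"
      using continuous_on_compose2[OF w pr pr2] by (simp add: split_beta)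
    have 2: "continuous_on ?S (\<lambda>x. \<rho> (snd (fst x)) (snd x))"
      using continuous_on_compose2[OF \<rho> pr pr2] by (simp add: split_beta)
    have Gc: "continuous_on (U \<times> {a..}) (\<lambda>(p, b). G p b)" using G by (simp add: param_holo_def)
    have i: "continuous_on ?S (\<lambda>x. ((fst (fst (fst x)), snd (fst (fst x)) + 1), \<rho> (snd (fst x)) (snd x)))"
      by (intro continuous_on_Pair 2 continuous_intros)
    have ii: "(\<lambda>x. ((fst (fst (fst x)), snd (fst (fst x)) + 1), \<rho> (snd (fst x)) (snd x))) ` ?S \<subseteq> U \<times> {a..}"
      using U'(3) \<rho>a by (auto simp: mem_Times_iff)
    have 3: "continuous_on ?S (\<lambda>x. G (fst (fst (fst x)), snd (fst (fst x)) + 1) (\<rho> (snd (fst x)) (snd x)))"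
      using continuous_on_compose2[OF Gc i ii] by simp
    show "continuous_on ?S (\<lambda>(x, u). ?f x u)"
      using continuous_on_mult[OF 1 3] by (simp add: split_beta)
    fix b u :: real assume bu: "b \<ge> a" "u \<in> {0..1}"
    then have "holo2 (\<lambda>p. G p (\<rho> b u)) U" using G \<rho>a by (simp add: param_holo_def)
    from holo2_shift[OF this, of 0 1, unfolded add_0_right] have "holo2 (\<lambda>p. G (fst p, snd p + 1) (\<rho> b u)) U'"
      by (rule holo2_subset) (use U' in auto)
    then show "holo2 (\<lambda>p. ?f (p, b) u) U'"
      using U'(1) by (auto intro!: holo2_mult holo2_const)
  qed
  show ?thesis unfolding continues_def
  proof (intro exI conjI ballI allI impI)
    show "nondegenerate (\<lambda>p. E p * \<alpha> p * ?D p)" by (intro nondegenerate_mult E \<alpha> D')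
    show "param_holo a U' (\<lambda>p b. ?D p * K p b + E p * \<gamma> p * (LINT u|unit_interval_measure. ?f (p, b) u))"
      using U'(1) \<gamma>
      by (intro param_holo_add param_holo_mult int K param_holo_holo2 holo2_mult nondegenerate_holo2[OF D'] nondegenerate_holo2[OF E])
         (auto intro: holo2_subset)
    fix p b assume pb: "p \<in> U0" "b \<ge> a"
    have "?D p * (LINT u|unit_interval_measure. w b u * F (fst p, snd p + 1) (\<rho> b u)) =
       (LINT u|unit_interval_measure. ?D p * (w b u * F (fst p, snd p + 1) (\<rho> b u)))" by simp
    also have "\<dots> = (LINT u|unit_interval_measure. ?f (p, b) u)"
      using DG[OF U0[OF pb(1)]] \<rho>a[OF pb(2)]
      by (intro Bochner_Integration.integral_cong refl) (auto simp: mult_ac)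
    finally have I: "?D p * (LINT u|unit_interval_measure. w b u * F (fst p, snd p + 1) (\<rho> b u)) = \<dots>" .
    have "E p * \<alpha> p * ?D p * F p b = E p * ?D p * (\<alpha> p * F p b)" by (simp add: mult_ac)
    also have "\<dots> = ?D p * (E p * H p b) + E p * \<gamma> p * (?D p * (LINT u|unit_interval_measure. w b u * F (fst p, snd p + 1) (\<rho> b u)))"
      unfolding rec[OF pb] by (simp add: algebra_simps)
    finally show "E p * \<alpha> p * ?D p * F p b = ?D p * K p b + E p * \<gamma> p * (LINT u|unit_interval_measure. ?f (p, b) u)"
      unfolding I EK[OF pb] .
  qed
qed

lemma continues_refl:
  assumes "param_holo a U F" shows "continues a U U F"
proof -
  have "nondegenerate (\<lambda>p. 1)" by (intro nondegenerateI holo2_const) auto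
  then show ?thesis using assms unfolding continues_def by (intro exI[of _ "\<lambda>p. 1"] exI[of _ F]) auto
qed

lemma continues_mono:
  assumes "continues a U0 U F" "V0 \<subseteq> U0" "open V" "V \<subseteq> U"
  shows "continues a V0 V F"
  using assms param_holo_subset unfolding continues_def by (meson subsetD)

lemma continues_fixed_param:
  assumes "continues a U0 U F" "c \<ge> a"
  shows "continues a U0 U (\<lambda>p b. F p c)"
proof -
  obtain D G where "nondegenerate D" "param_holo a U G" "\<forall>p\<in>U0. \<forall>b\<ge>a. D p * F p b = G p b"
    using assms(1) by (auto simp: continues_def)
  then show ?thesis
    using param_holo_fixed_param[OF _ assms(2)] assms(2) unfolding continues_def
    by (intro exI[of _ D] exI[of _ "\<lambda>p b. G p c"]) auto
qed

lemma continues_shift: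
  assumes "continues a U0 U F"
  shows "continues a {p. (fst p + c, snd p + d) \<in> U0} {p. (fst p + c, snd p + d) \<in> U} (\<lambda>p b. F (fst p + c, snd p + d) b)"
proof -
  obtain D G where "nondegenerate D" "param_holo a U G" "\<forall>p\<in>U0. \<forall>b\<ge>a. D p * F p b = G p b"
    using assms(1) by (auto simp: continues_def)
  then show ?thesis
    using nondegenerate_shift param_holo_shift unfolding continues_def
    by (intro exI[of _ "\<lambda>p. D (fst p + c, snd p + d)"] exI[of _ "\<lambda>p b. G (fst p + c, snd p + d) b"]) auto
qed

section \<open>Lerch sums\<close>

text \<open>The power \<open>x\<close> to the \<open>-s\<close> for positive \<open>x\<close>,
  written with the real logarithm so that it is visibly entire in \<open>s\<close> and continuous in
  \<open>x\<close>.\<close>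

definition inv_power :: "real \<Rightarrow> complex \<Rightarrow> complex" where
  "inv_power x s = exp (- s * of_real (ln x))"

lemma norm_inv_power: "x > 0 \<Longrightarrow> norm (inv_power x s) = x powr (- Re s)"
  by (simp add: inv_power_def powr_def)

lemma inv_power_add: "inv_power x (s + t) = inv_power x s * inv_power x t"
  by (simp add: inv_power_def exp_add[symmetric] algebra_simps)

lemma inv_power_add_1: "x > 0 \<Longrightarrow> inv_power x (s + 1) = inv_power x s / of_real x"
  by (simp add: inv_power_add) (simp add: inv_power_def exp_minus exp_of_real divide_inverse)

lemma inv_power_eq_powr: "x > 0 \<Longrightarrow> inv_power x s = 1 / of_real x powr s"
  by (simp add: inv_power_def powr_def exp_minus Ln_of_real divide_inverse)

lemma holo2_inv_power: "holo2 f U \<Longrightarrow> holo2 (\<lambda>p. inv_power x (f p)) U"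
  unfolding inv_power_def
  by (rule holo2_compose[of f U "\<lambda>s. exp (- s * of_real (ln x))"]) (auto intro!: holomorphic_intros)

lemma param_holo_inv_power:
  assumes f: "holo2 f U" and c: "c \<ge> 0" and a: "a > 0"
  shows "param_holo a U (\<lambda>p b. inv_power (c + b) (f p))"
proof -
  have "continuous_on (U \<times> {a..}) (\<lambda>x. f (fst x))"
    by (rule continuous_on_compose2[OF holo2_cont[OF f]]) (auto intro: continuous_intros)
  then have "continuous_on (U \<times> {a..}) (\<lambda>(p, b). inv_power (c + b) (f p))"
    using a c unfolding inv_power_def split_beta by (intro continuous_intros) auto
  then show ?thesis using holo2_inv_power[OF f] by (simp add: param_holo_def)
qed

lemma continuous_on_inv_power:
  assumes "continuous_on S g" "\<And>u. u \<in> S \<Longrightarrow> g u > 0"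
  shows "continuous_on S (\<lambda>u. inv_power (g u) s)"
  unfolding inv_power_def using assms by (intro continuous_intros) (auto simp: less_imp_neq[symmetric])

lemma inv_power_has_vector_derivative:
  assumes "x + d * u > 0"
  shows "((\<lambda>u. inv_power (x + d * u) s) has_vector_derivative (- s * of_real d * inv_power (x + d * u) (s + 1))) (at u within A)"
proof -
  have "((\<lambda>u. ln (x + d * u)) has_real_derivative d / (x + d * u)) (at u within A)"
    using assms by (auto intro!: derivative_eq_intros simp: field_simps)
  then have "((\<lambda>u. complex_of_real (ln (x + d * u))) has_vector_derivative of_real (d / (x + d * u))) (at u within A)"
    by (intro has_vector_derivative_of_real) (simp add: has_real_derivative_iff_has_vector_derivative)
  then have "((\<lambda>u. - s * complex_of_real (ln (x + d * u))) has_vector_derivative - s * of_real (d / (x + d * u))) (at u within A)"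
    by (intro has_vector_derivative_mult_right)
  from field_vector_diff_chain_within[OF this, of exp "exp (- s * complex_of_real (ln (x + d * u)))"]
  have "((exp \<circ> (\<lambda>u. - s * complex_of_real (ln (x + d * u)))) has_vector_derivative
      - s * of_real (d / (x + d * u)) * exp (- s * complex_of_real (ln (x + d * u)))) (at u within A)"
    by (simp add: DERIV_exp DERIV_subset[OF DERIV_exp])
  then show ?thesis
    unfolding inv_power_add_1[OF assms] by (simp add: inv_power_def o_def)
qed

text \<open>The fundamental theorem of calculus along the segment from \<open>x\<close> to
  \<open>x + d\<close>; \<open>d\<close> may be negative, and positivity on the segment follows by
  convexity.\<close>

lemma inv_power_increment:
  assumes "x > 0" "x + d > 0"
  shows "inv_power (x + d) s = inv_power x s - s * of_real d * (LINT u|unit_interval_measure. inv_power (x + d * u) (s + 1))"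
proof -
  have pos: "x + d * u > 0" if "u \<in> {0..1}" for u
  proof -
    have "x + d * u = (1 - u) * x + u * (x + d)" by (simp add: algebra_simps)
    moreover have "(1 - u) * x + u * (x + d) > 0"
      using that assms by (cases "u = 0") (auto intro!: add_nonneg_pos)
    ultimately show ?thesis by simp
  qed
  have "(LINT u|unit_interval_measure. - s * of_real d * inv_power (x + d * u) (s + 1)) =
      inv_power (x + d * 1) s - inv_power (x + d * 0) s"
    using pos by (intro unit_interval_FTC inv_power_has_vector_derivative continuous_intros continuous_on_inv_power) auto
  then show ?thesis by (simp add: algebra_simps)
qed

text \<open>First-order Taylor expansion of \<open>x\<^sup>-\<^sup>s\<close> on unit intervals expresses
  \<open>\<Sum>n. z ^ n * inv_power (n + c) s\<close> by the same sum at \<open>s + 1\<close>. The factor \<open>rec_lead\<close> that has to be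
  divided out vanishes only for \<open>z = 1\<close>; it is the source of the poles.\<close>

definition rec_lead :: "complex \<Rightarrow> complex \<Rightarrow> complex" where
  "rec_lead z s = (if z = 1 then s - 1 else 1 - z)"

text \<open>For \<open>z = 1\<close> the boundary terms come from the primitive of the power, whose
  exponent is \<open>s - 1\<close>; otherwise they are the powers themselves.\<close>

definition rec_shift :: "complex \<Rightarrow> complex" where
  "rec_shift z = (if z = 1 then 1 else 0)"

definition rec_coeff :: "complex \<Rightarrow> complex \<Rightarrow> complex" where
  "rec_coeff z s = (if z = 1 then s * (s - 1) else - z * s)"

definition rec_weight :: "complex \<Rightarrow> real \<Rightarrow> complex" where
  "rec_weight z u = (if z = 1 then of_real (1 - u) else 1)"

lemma rec_weight_norm: "u \<in> {0..1} \<Longrightarrow> norm (rec_weight z u) \<le> 1"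
  by (simp add: rec_weight_def del: of_real_diff)

lemma continuous_on_rec_weight: "continuous_on S g \<Longrightarrow> continuous_on S (\<lambda>u. rec_weight z (g u))"
  unfolding rec_weight_def by (cases "z = 1") (auto intro!: continuous_intros)

text \<open>For \<open>z \<noteq> 1\<close> this is the increment formula on a unit interval. For
  \<open>z = 1\<close> that formula would leave the factor \<open>1 - z = 0\<close>; instead one
  integrates by parts and multiplies by \<open>s - 1\<close>, which turns the integral of the power
  into a difference of powers of exponent \<open>s - 1\<close>.\<close>

lemma inv_power_recursion:
  assumes x: "x > 0"
  shows "rec_lead z s * inv_power x s = inv_power x (s - rec_shift z) - z * inv_power (x + 1) (s - rec_shift z)
     + rec_coeff z s * (LINT u|unit_interval_measure. rec_weight z u * inv_power (x + u) (s + 1))"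
proof (cases "z = 1")
  case False
  have e: "inv_power x s = inv_power (x + 1) s + s * (LINT u|unit_interval_measure. inv_power (x + u) (s + 1))"
    using inv_power_increment[of x 1 s] x by simp
  show ?thesis
    using False unfolding rec_lead_def rec_coeff_def rec_shift_def rec_weight_def
    by (simp add: e) (simp add: algebra_simps)
next
  case True
  let ?f = "\<lambda>u. inv_power (x + u) s"
  let ?g = "\<lambda>u. of_real (1 - u) * inv_power (x + u) (s + 1)"
  have cf: "continuous_on {0..1} ?f" "continuous_on {0..1} ?g"
    using x by (auto intro!: continuous_intros continuous_on_inv_power)
  \<comment> \<open>The weight \<open>1 - u\<close> vanishes at the right end, so only the value at
    \<open>x\<close> survives.\<close>
  have d: "((\<lambda>u. of_real (1 - u) * inv_power (x + u) s) has_vector_derivative - ?f u - s * ?g u) (at u within {0..1})"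
    if "u \<in> {0..1}" for u
  proof -
    have "((\<lambda>u. complex_of_real (1 - u)) has_vector_derivative of_real (-1)) (at u within {0..1})"
      by (intro has_vector_derivative_of_real) (auto intro!: derivative_eq_intros)
    from has_vector_derivative_mult[OF this inv_power_has_vector_derivative[of x 1 u s]]
    show ?thesis using x that by (simp add: algebra_simps)
  qed
  have "(LINT u|unit_interval_measure. - ?f u - s * ?g u) = of_real (1 - 1) * inv_power (x + 1) s - of_real (1 - 0) * inv_power (x + 0) s"
    by (rule unit_interval_FTC[OF d]) (use cf in \<open>auto intro!: continuous_intros\<close>)
  moreover have "(LINT u|unit_interval_measure. - ?f u - s * ?g u) = - (LINT u|unit_interval_measure. ?f u) - s * (LINT u|unit_interval_measure. ?g u)"
    using integrable_unit_interval[OF cf(1)] integrable_unit_interval[OF cf(2)] by simp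
  ultimately have e: "inv_power x s = (LINT u|unit_interval_measure. ?f u) + s * (LINT u|unit_interval_measure. ?g u)"
    by (simp add: algebra_simps)
  have "(s - 1) * (LINT u|unit_interval_measure. ?f u) = inv_power x (s - 1) - inv_power (x + 1) (s - 1)"
    using inv_power_increment[of x 1 "s - 1"] x by simp
  then have "(s - 1) * inv_power x s = inv_power x (s - 1) - inv_power (x + 1) (s - 1) + s * (s - 1) * (LINT u|unit_interval_measure. ?g u)"
    unfolding e[of] by (simp add: algebra_simps)
  then show ?thesis
    using True by (simp add: rec_lead_def rec_coeff_def rec_shift_def rec_weight_def)
qed

text \<open>Makes bounds uniform in an exponent ranging over an interval of length \<open>R\<close>.
  For \<open>x \<ge> 1\<close> the smallest exponent is the worst; the constant
  \<open>a powr - R\<close> pays for \<open>x\<close> in \<open>{a..1}\<close>, where the largest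
  one is.\<close>

lemma powr_local_bound:
  assumes "0 < a" "a \<le> 1" "a \<le> x" "A \<le> t" "t \<le> A + R" 
  shows "x powr - t \<le> a powr - R * x powr - (A::real)"
proof -
  have "x powr - (t - A) \<le> a powr - (t - A)" using assms by (intro powr_mono2') auto
  also have "\<dots> \<le> a powr - R" using assms by (intro powr_mono') auto
  finally have "x powr - (t - A) * x powr - A \<le> a powr - R * x powr - A" by (rule mult_right_mono) simp
  then show ?thesis by (simp add: powr_add[symmetric])
qed

lemma summable_shift_powr:
  assumes "a > 0" "\<rho> > 1"
  shows "summable (\<lambda>n. (real n + a) powr - \<rho>)"
proof (rule summable_comparison_test'[of "\<lambda>n. real n powr - \<rho>" 1])
  show "summable (\<lambda>n. real n powr - \<rho>)" using assms by (simp add: summable_real_powr_iff)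
  show "norm ((real n + a) powr - \<rho>) \<le> real n powr - \<rho>" if "n \<ge> 1" for n
    using assms that by (auto intro!: powr_mono2')
qed

definition lerch_sum :: "complex \<Rightarrow> complex \<Rightarrow> real \<Rightarrow> complex" where
  "lerch_sum z s c = (\<Sum>n. z ^ n * inv_power (real n + c) s)"

lemma norm_lerch_term_le:
  assumes "norm z \<le> 1" "c > 0"
  shows "norm (z ^ n * inv_power (real n + c) s) \<le> (real n + c) powr - Re s"
  using assms power_le_one[of "norm z" n] norm_inv_power[of "real n + c" s]
  by (simp add: norm_mult norm_power mult_left_le_one_le)

lemma summable_lerch:
  assumes "norm z \<le> 1" "c > 0" "Re s > 1"
  shows "summable (\<lambda>n. norm (z ^ n * inv_power (real n + c) s))"
  by (rule summable_comparison_test'[OF summable_shift_powr[of c "Re s"]])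
     (use assms norm_lerch_term_le in auto)

text \<open>The exponent is split: the part \<open>1 + \<epsilon>\<close> is spent on convergence in
  \<open>n\<close>, and the rest, estimated with \<open>real n + c \<ge> real m + a\<close>, is kept
  as decay in the outer index \<open>m\<close>.\<close>

lemma norm_lerch_sum_le:
  assumes z: "norm z \<le> 1" and a: "0 < a" "real m + a \<le> c" and e: "\<epsilon> > 0" "1 + \<epsilon> \<le> Re s"
  shows "norm (lerch_sum z s c) \<le> (\<Sum>n. (real n + a) powr - (1 + \<epsilon>)) * (real m + a) powr (1 + \<epsilon> - Re s)"
proof -
  have c: "c > 0" using a by (smt (verit) of_nat_0_le_iff)
  have s: "Re s > 1" using e by simp
  have le: "(real n + c) powr - Re s \<le> (real n + a) powr - (1 + \<epsilon>) * (real m + a) powr (1 + \<epsilon> - Re s)" for n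
  proof -
    have "(real n + c) powr - Re s = (real n + c) powr - (1 + \<epsilon>) * (real n + c) powr (1 + \<epsilon> - Re s)"
      by (simp add: powr_add[symmetric])
    also have "\<dots> \<le> (real n + a) powr - (1 + \<epsilon>) * (real m + a) powr (1 + \<epsilon> - Re s)"
      using a e by (intro mult_mono powr_mono2') auto
    finally show ?thesis .
  qed
  have sum: "summable (\<lambda>n. (real n + a) powr - (1 + \<epsilon>) * (real m + a) powr (1 + \<epsilon> - Re s))"
    using summable_shift_powr[of a "1 + \<epsilon>"] a e by (intro summable_mult2) auto
  have "norm (lerch_sum z s c) \<le> (\<Sum>n. norm (z ^ n * inv_power (real n + c) s))"
    unfolding lerch_sum_def by (rule summable_norm[OF summable_lerch[OF z c s]])
  also have "\<dots> \<le> (\<Sum>n. (real n + a) powr - (1 + \<epsilon>) * (real m + a) powr (1 + \<epsilon> - Re s))"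
    using le norm_lerch_term_le[OF z c] 
    by (intro suminf_le summable_lerch z c s sum) (meson order_trans)
  also have "\<dots> = (\<Sum>n. (real n + a) powr - (1 + \<epsilon>)) * (real m + a) powr (1 + \<epsilon> - Re s)"
    using summable_shift_powr[of a "1 + \<epsilon>"] a e by (intro suminf_mult2[symmetric]) auto
  finally show ?thesis .
qed

lemma suminf_LINT_unit_interval:
  fixes f :: "nat \<Rightarrow> real \<Rightarrow> complex"
  assumes c: "\<And>n. continuous_on {0..1} (f n)" and b: "\<And>n u. u \<in> {0..1} \<Longrightarrow> norm (f n u) \<le> w n"
    and w: "summable w"
  shows "summable (\<lambda>n. LINT u|unit_interval_measure. f n u)"
    and "(\<Sum>n. LINT u|unit_interval_measure. f n u) = (LINT u|unit_interval_measure. (\<Sum>n. f n u))"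
proof -
  have s: "summable (\<lambda>n. norm (f n u))" if "u \<in> {0..1}" for u
    by (rule summable_comparison_test'[OF w]) (use b that in auto)
  have i: "(LINT u|unit_interval_measure. norm (f n u)) \<le> w n" for n
  proof -
    have "(LINT u|unit_interval_measure. norm (f n u)) \<le> (LINT u|unit_interval_measure. w n)"
      using integrable_unit_interval[OF c[of n]] integrable_unit_interval_const b
      by (intro integral_mono) auto
    also have "\<dots> = w n" by (simp add: unit_interval_measure_def measure_restrict_space)
    finally show ?thesis .
  qed
  have s2: "summable (\<lambda>n. LINT u|unit_interval_measure. norm (f n u))"
    by (rule summable_comparison_test'[OF w]) (use i in \<open>auto simp: Bochner_Integration.integral_nonneg\<close>)
  show "(\<Sum>n. LINT u|unit_interval_measure. f n u) = (LINT u|unit_interval_measure. (\<Sum>n. f n u))"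
    using s s2 integrable_unit_interval[OF c] by (intro integral_suminf[symmetric] AE_I2) auto
  show "summable (\<lambda>n. LINT u|unit_interval_measure. f n u)"
    by (rule summable_comparison_test'[OF s2]) (rule integral_norm_bound)
qed

text \<open>The termwise recursion is multiplied by \<open>z ^ n\<close> and summed. The factor
  \<open>z\<close> in front of the second boundary term makes the boundary terms telescope.\<close>

lemma lerch_sum_recursion:
  assumes z: "norm z \<le> 1" and c: "c > 0" and s: "Re s > 1"
  shows "rec_lead z s * lerch_sum z s c = inv_power c (s - rec_shift z)
     + rec_coeff z s * (LINT u|unit_interval_measure. rec_weight z u * lerch_sum z (s + 1) (c + u))"
proof -
  let ?e = "\<lambda>n. z ^ n * inv_power (real n + c) (s - rec_shift z)"
  let ?f = "\<lambda>n u. rec_weight z u * (z ^ n * inv_power (real n + (c + u)) (s + 1))"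
  have e0: "?e \<longlonglongrightarrow> 0"
  proof (rule Lim_null_comparison)
    show "\<forall>\<^sub>F n in sequentially. norm (?e n) \<le> (real n + c) powr - Re (s - rec_shift z)"
      by (intro always_eventually allI norm_lerch_term_le[OF z c])
    have "Re (s - rec_shift z) > 0" using s by (simp add: rec_shift_def)
    then show "(\<lambda>n. (real n + c) powr - Re (s - rec_shift z)) \<longlonglongrightarrow> 0"
      by (intro tendsto_neg_powr) (simp, real_asymp)
  qed
  \<comment> \<open>Only the term \<open>n = 0\<close> remains, namely
    \<open>inv_power c (s - rec_shift z)\<close>. For \<open>z = 1\<close> the decay of the terms
    uses \<open>Re s > 1\<close>, because of the lowered exponent.\<close>
  have tel: "(\<lambda>n. ?e n - ?e (Suc n)) sums (?e 0 - 0)" by (rule telescope_sums'[OF e0])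
  have b: "norm (?f n u) \<le> (real n + c) powr - (Re s + 1)" if "u \<in> {0..1}" for n u
  proof -
    have "norm (?f n u) \<le> 1 * (real n + (c + u)) powr - (Re (s + 1))"
      unfolding norm_mult[of "rec_weight z u"]
      using that c norm_lerch_term_le[OF z, of "c + u" n "s + 1"] by (intro mult_mono rec_weight_norm) auto
    also have "\<dots> \<le> (real n + c) powr - (Re s + 1)" using that c s by (auto intro!: powr_mono2')
    finally show ?thesis .
  qed
  have cont: "continuous_on {0..1} (?f n)" for n
    using c by (intro continuous_intros continuous_on_rec_weight continuous_on_inv_power) auto
  note I = suminf_LINT_unit_interval[of ?f "\<lambda>n. (real n + c) powr - (Re s + 1)", OF cont b summable_shift_powr[OF c]]
  have sI: "(\<lambda>n. LINT u|unit_interval_measure. ?f n u) sums (LINT u|unit_interval_measure. (\<Sum>n. ?f n u))"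
    using I s by (simp add: sums_iff)
  have inner: "(\<Sum>n. ?f n u) = rec_weight z u * lerch_sum z (s + 1) (c + u)" if "u \<in> {0..1}" for u
    unfolding lerch_sum_def
    using summable_norm_cancel[OF summable_lerch[OF z, of "c + u" "s + 1"]] that c s
    by (intro suminf_mult) auto
  have "rec_lead z s * (z ^ n * inv_power (real n + c) s) =
      (?e n - ?e (Suc n)) + rec_coeff z s * (LINT u|unit_interval_measure. ?f n u)" for n
  proof -
    have "(LINT u|unit_interval_measure. ?f n u) = z ^ n * (LINT u|unit_interval_measure. rec_weight z u * inv_power (real n + c + u) (s + 1))"
      unfolding integral_mult_right_zero[symmetric] by (simp add: mult_ac add_ac)
    moreover have "rec_lead z s * (z ^ n * inv_power (real n + c) s) = z ^ n * (rec_lead z s * inv_power (real n + c) s)"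
      by simp
    ultimately show ?thesis
      using c by (simp only: inv_power_recursion[of "real n + c" z s]) (simp add: algebra_simps inv_power_recursion)
  qed
  moreover have "(\<lambda>n. (?e n - ?e (Suc n)) + rec_coeff z s * (LINT u|unit_interval_measure. ?f n u)) sums
      ((?e 0 - 0) + rec_coeff z s * (LINT u|unit_interval_measure. (\<Sum>n. ?f n u)))"
    by (intro sums_add tel sums_mult sI)
  moreover have "(\<lambda>n. rec_lead z s * (z ^ n * inv_power (real n + c) s)) sums (rec_lead z s * lerch_sum z s c)"
    unfolding lerch_sum_def
    by (rule sums_mult[OF summable_sums[OF summable_norm_cancel[OF summable_lerch[OF z c s]]]])
  ultimately have "rec_lead z s * lerch_sum z s c = ?e 0 + rec_coeff z s * (LINT u|unit_interval_measure. (\<Sum>n. ?f n u))"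
    by (simp add: sums_unique2)
  moreover have "(LINT u|unit_interval_measure. (\<Sum>n. ?f n u)) = (LINT u|unit_interval_measure. rec_weight z u * lerch_sum z (s + 1) (c + u))"
    by (intro Bochner_Integration.integral_cong refl inner) simp
  ultimately show ?thesis by simp
qed

text \<open>Replaces the variable shift \<open>c\<close> by the fixed \<open>a\<close> at the cost
  of a constant. Negative exponents \<open>t\<close> are the case that needs it: there
  \<open>real m + c \<le> (B / a) * (real m + a)\<close>.\<close>

lemma powr_param_bound:
  assumes "0 < a" "a \<le> c" "c \<le> B"
  shows "(real m + c) powr - t \<le> (B / a) powr \<bar>t\<bar> * (real m + a) powr - t"
proof (cases "t \<ge> 0")
  case True
  have "(real m + c) powr - t \<le> 1 * (real m + a) powr - t" using True assms by (auto intro!: powr_mono2')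
  also have "\<dots> \<le> (B / a) powr \<bar>t\<bar> * (real m + a) powr - t"
    using assms by (intro mult_right_mono ge_one_powr_ge_zero) auto
  finally show ?thesis .
next
  case False
  have "real m * a \<le> B * real m" "c * a \<le> B * a"
    using assms mult_right_mono[of a B "real m"] by (simp_all add: mult.commute)
  then have "(real m + c) * a \<le> B * (real m + a)"
    unfolding distrib_left distrib_right by (rule add_mono)
  then have "real m + c \<le> B / a * (real m + a)" using assms by (simp add: pos_le_divide_eq)
  then have "(real m + c) powr - t \<le> (B / a * (real m + a)) powr - t"
    using False assms by (intro powr_mono2) auto
  also have "\<dots> = (B / a) powr \<bar>t\<bar> * (real m + a) powr - t"
    using False assms by (subst powr_mult) auto
  finally show ?thesis .
qed

lemma continuous_Re_near:
  fixes l :: "complex \<times> complex \<Rightarrow> complex"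
  assumes "continuous_on U l" "p \<in> U" "\<delta> > 0"
  obtains r where "r > 0" "\<And>q. q \<in> ball p r \<inter> U \<Longrightarrow> \<bar>Re (l q) - Re (l p)\<bar> < \<delta>"
proof -
  obtain r where r: "r > 0" "\<And>q. q \<in> U \<Longrightarrow> dist q p < r \<Longrightarrow> dist (l q) (l p) < \<delta>"
    using assms unfolding continuous_on_iff by metis
  have "\<bar>Re (l q) - Re (l p)\<bar> < \<delta>" if "q \<in> ball p r \<inter> U" for q
    using r(2)[of q] that abs_Re_le_cmod[of "l q - l p"] by (simp add: dist_norm norm_minus_commute)
  then show ?thesis using r(1) that by blast
qed

lemma param_holo_lerch_sum:
  assumes a: "0 < a" "a \<le> 1" and z: "norm z \<le> 1" and l: "holo2 l U" "\<And>p. p \<in> U \<Longrightarrow> Re (l p) > 1"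
  shows "param_holo a U (\<lambda>p b. lerch_sum z (l p) (real m + b))"
  unfolding lerch_sum_def
proof (rule param_holo_suminf)
  show U: "open U" using l(1) by (rule holo2_open)
  show "param_holo a U (\<lambda>p b. z ^ n * inv_power (real n + (real m + b)) (l p))" for n
    unfolding add.assoc[symmetric] using a l U by (intro param_holo_mult param_holo_inv_power param_holo_holo2 holo2_const) auto
  fix p and B :: real assume p: "p \<in> U" and B: "B \<ge> a"
  \<comment> \<open>Half of the margin to 1: near \<open>p\<close> the exponent stays between
    \<open>1 + ?\<delta>\<close> and \<open>1 + 3 * ?\<delta>\<close>, hence the constant with
    \<open>R = 2 * ?\<delta>\<close>.\<close>
  let ?\<delta> = "(Re (l p) - 1) / 2"
  have \<delta>: "?\<delta> > 0" using l(2)[OF p] by simp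
  obtain r where r: "r > 0" "\<And>q. q \<in> ball p r \<inter> U \<Longrightarrow> \<bar>Re (l q) - Re (l p)\<bar> < ?\<delta>"
    using continuous_Re_near[OF holo2_cont[OF l(1)] p \<delta>] by blast
  have "norm (z ^ n * inv_power (real n + (real m + b)) (l q)) \<le> a powr - (2 * ?\<delta>) * (real n + a) powr - (1 + ?\<delta>)"
    if q: "q \<in> ball p r \<inter> U" and b: "b \<in> {a..B}" for q b n
  proof -
    have "norm (z ^ n * inv_power (real n + (real m + b)) (l q)) \<le> (real n + (real m + b)) powr - Re (l q)"
      using a b by (intro norm_lerch_term_le z) auto
    also have "\<dots> \<le> (real n + a) powr - Re (l q)"
      using a b l(2)[of q] q by (intro powr_mono2') auto
    also have "\<dots> \<le> a powr - (2 * ?\<delta>) * (real n + a) powr - (1 + ?\<delta>)"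
    proof (intro powr_local_bound a)
      show "1 + ?\<delta> \<le> Re (l q)" "Re (l q) \<le> 1 + ?\<delta> + 2 * ?\<delta>" using r(2)[OF q] by argo+
    qed simp
    finally show ?thesis .
  qed
  moreover have "summable (\<lambda>n. a powr - (2 * ?\<delta>) * (real n + a) powr - (1 + ?\<delta>))"
    using a \<delta> by (intro summable_mult summable_shift_powr) auto
  ultimately show "\<exists>r>0. \<exists>w. summable w \<and>
       (\<forall>q\<in>ball p r \<inter> U. \<forall>b\<in>{a..B}. \<forall>n. norm (z ^ n * inv_power (real n + (real m + b)) (l q)) \<le> w n)"
    using r(1) by blast
qed

section \<open>Continuation of the single sums\<close>

definition hurwitz_strip :: "nat \<Rightarrow> (complex \<times> complex) set" where
  "hurwitz_strip N = {p. Re (fst p + snd p) > 1 - real N}"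

lemma open_hurwitz_strip: "open (hurwitz_strip N)"
  unfolding hurwitz_strip_def by (intro open_Collect_less continuous_intros)

lemma nondegenerate_rec_lead_snd: "nondegenerate (\<lambda>p. rec_lead z (snd p))"
proof (rule nondegenerateI)
  show "holo2 (\<lambda>p. rec_lead z (snd p)) UNIV"
    unfolding rec_lead_def by (cases "z = 1") (simp_all add: holo2_diff holo2_snd holo2_const)
qed (auto simp: rec_lead_def split: if_splits)

lemma nondegenerate_rec_lead_sum: "nondegenerate (\<lambda>p. rec_lead z (fst p + snd p))"
proof (rule nondegenerateI)
  show "holo2 (\<lambda>p. rec_lead z (fst p + snd p)) UNIV"
    unfolding rec_lead_def by (cases "z = 1") (simp_all add: holo2_diff holo2_add holo2_fst holo2_snd holo2_const)
qed (auto simp: rec_lead_def add.assoc[symmetric] split: if_splits)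

lemma holo2_rec_coeff: "holo2 f U \<Longrightarrow> holo2 (\<lambda>p. rec_coeff z (f p)) U"
  unfolding rec_coeff_def using holo2_open[of f U]
  by (cases "z = 1") (auto intro!: holo2_mult holo2_diff holo2_const holo2_minus)

lemma continues_lerch_sum:
  assumes a: "0 < a" "a \<le> 1" and z: "norm z \<le> 1"
  shows "continues a (hurwitz_strip 0) (hurwitz_strip N) (\<lambda>p b. lerch_sum z (fst p + snd p) b)"
proof (induction N)
  case 0
  have "param_holo a (hurwitz_strip 0) (\<lambda>p b. lerch_sum z (fst p + snd p) (real 0 + b))"
    using a z by (intro param_holo_lerch_sum holo2_add holo2_fst holo2_snd open_hurwitz_strip) (auto simp: hurwitz_strip_def)
  then show ?case by (intro continues_refl) simp
next
  case (Suc N)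
  have H: "param_holo a (hurwitz_strip (Suc N)) (\<lambda>p b. inv_power (0 + b) (fst p + snd p - rec_shift z))"
    using a by (intro param_holo_inv_power holo2_add holo2_diff holo2_const holo2_fst holo2_snd open_hurwitz_strip) auto
  show ?case
  proof (rule continues_step[OF Suc.IH continues_mono[OF continues_refl[OF H]]])
    show "rec_lead z (fst p + snd p) * lerch_sum z (fst p + snd p) b =
        inv_power (0 + b) (fst p + snd p - rec_shift z) + rec_coeff z (fst p + snd p) *
        (LINT u|unit_interval_measure. rec_weight z u * lerch_sum z (fst (fst p, snd p + 1) + snd (fst p, snd p + 1)) (b + u))"
      if "p \<in> hurwitz_strip 0" "a \<le> b" for p b
      using lerch_sum_recursion[OF z, of b "fst p + snd p"] that a by (simp add: hurwitz_strip_def add.assoc)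
    show "continuous_on ({a..} \<times> {0..1}) (\<lambda>(b, u). rec_weight z u)"
      unfolding split_beta by (intro continuous_on_rec_weight continuous_intros)
    show "open (hurwitz_strip (Suc N))" by (rule open_hurwitz_strip)
    then show "open (hurwitz_strip (Suc N))" .
  qed (auto simp: hurwitz_strip_def split_beta intro!: continuous_intros nondegenerate_rec_lead_sum holo2_rec_coeff holo2_add holo2_fst holo2_snd)
qed

text \<open>The boundary terms that the recursion for the inner sum leaves behind, summed over the
  outer index. The two shifts differ in general; for \<open>b = a\<close> this is a Lerch sum at
  \<open>s1 + s2\<close>.\<close>

definition hurwitz2 :: "complex \<Rightarrow> real \<Rightarrow> complex \<times> complex \<Rightarrow> real \<Rightarrow> complex" where
  "hurwitz2 z a p b = (\<Sum>m. z ^ m * inv_power (real m + a) (fst p) * inv_power (real m + b) (snd p))"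

lemma norm_hurwitz2_term_le:
  assumes "norm z \<le> 1" "0 < a" "a \<le> b" "b \<le> B"
  shows "norm (z ^ m * inv_power (real m + a) s1 * inv_power (real m + b) s2)
    \<le> (B / a) powr \<bar>Re s2\<bar> * (real m + a) powr - Re (s1 + s2)"
proof -
  have "norm (z ^ m * inv_power (real m + a) s1 * inv_power (real m + b) s2)
    \<le> (real m + a) powr - Re s1 * ((B / a) powr \<bar>Re s2\<bar> * (real m + a) powr - Re s2)"
    unfolding norm_mult[of "_ * _"] 
    using assms powr_param_bound[of a b B m "Re s2"] norm_inv_power[of "real m + b" s2]
    by (intro mult_mono norm_lerch_term_le) auto
  also have "\<dots> = (B / a) powr \<bar>Re s2\<bar> * ((real m + a) powr - Re s1 * (real m + a) powr - Re s2)"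
    by simp
  also have "\<dots> = (B / a) powr \<bar>Re s2\<bar> * (real m + a) powr - Re (s1 + s2)"
    unfolding powr_add[symmetric] by simp
  finally show ?thesis .
qed

lemma param_holo_hurwitz2:
  assumes a: "0 < a" "a \<le> 1" and z: "norm z \<le> 1"
  shows "param_holo a (hurwitz_strip 0) (hurwitz2 z a)"
  unfolding hurwitz2_def
proof (rule param_holo_suminf[OF open_hurwitz_strip])
  show "param_holo a (hurwitz_strip 0) (\<lambda>p b. z ^ m * inv_power (real m + a) (fst p) * inv_power (real m + b) (snd p))" for m
    using a by (intro param_holo_mult param_holo_inv_power param_holo_holo2 holo2_const holo2_inv_power
        holo2_fst holo2_snd open_hurwitz_strip) auto
  fix p and B :: real assume p: "p \<in> hurwitz_strip 0" and B: "B \<ge> a"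
  let ?\<delta> = "(Re (fst p + snd p) - 1) / 2"
  have \<delta>: "?\<delta> > 0" using p by (simp add: hurwitz_strip_def)
  have cont_sum: "continuous_on UNIV (\<lambda>p::complex \<times> complex. fst p + snd p)"
    and cont_snd: "continuous_on UNIV (\<lambda>p::complex \<times> complex. snd p)"
    by (intro continuous_intros)+
  obtain r1 where r1: "r1 > 0" "\<And>q. q \<in> ball p r1 \<inter> UNIV \<Longrightarrow> \<bar>Re (fst q + snd q) - Re (fst p + snd p)\<bar> < ?\<delta>"
    using continuous_Re_near[OF cont_sum UNIV_I \<delta>] by blast
  obtain r2 where r2: "r2 > 0" "\<And>q. q \<in> ball p r2 \<inter> UNIV \<Longrightarrow> \<bar>Re (snd q) - Re (snd p)\<bar> < 1"
    using continuous_Re_near[OF cont_snd UNIV_I zero_less_one] by blast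
  let ?w = "\<lambda>m. (B / a) powr (\<bar>Re (snd p)\<bar> + 1) * (a powr - (2 * ?\<delta>) * (real m + a) powr - (1 + ?\<delta>))"
  have "norm (z ^ m * inv_power (real m + a) (fst q) * inv_power (real m + b) (snd q)) \<le> ?w m"
    if q: "q \<in> ball p (min r1 r2)" and b: "b \<in> {a..B}" for q b m
  proof -
    have "norm (z ^ m * inv_power (real m + a) (fst q) * inv_power (real m + b) (snd q))
      \<le> (B / a) powr \<bar>Re (snd q)\<bar> * (real m + a) powr - Re (fst q + snd q)"
      using a b by (intro norm_hurwitz2_term_le z) auto
    also have "\<dots> \<le> ?w m"
    proof (intro mult_mono powr_mono powr_local_bound a)
      have q': "\<bar>Re (fst q + snd q) - Re (fst p + snd p)\<bar> < ?\<delta>" "\<bar>Re (snd q) - Re (snd p)\<bar> < 1"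
        using r1(2)[of q] r2(2)[of q] q by auto
      show "\<bar>Re (snd q)\<bar> \<le> \<bar>Re (snd p)\<bar> + 1" using q'(2) by argo
      show "1 + ?\<delta> \<le> Re (fst q + snd q)" "Re (fst q + snd q) \<le> 1 + ?\<delta> + 2 * ?\<delta>"
        using q'(1) by argo+
    qed (use a B in auto)
    finally show ?thesis .
  qed
  moreover have "summable ?w"
    using a \<delta> by (intro summable_mult summable_shift_powr) auto
  ultimately show "\<exists>r>0. \<exists>w. summable w \<and> (\<forall>q\<in>ball p r \<inter> hurwitz_strip 0. \<forall>b\<in>{a..B}. \<forall>m.
      norm (z ^ m * inv_power (real m + a) (fst q) * inv_power (real m + b) (snd q)) \<le> w m)"
    using r1(1) r2(1) by (intro exI[of _ "min r1 r2"] conjI exI[of _ ?w]) auto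
qed

text \<open>The second shift is moved from \<open>b\<close> to \<open>a\<close> by the increment
  formula. At \<open>b = a\<close> the two powers merge, and the error is an integral of the same
  kind of sum at \<open>s2 + 1\<close> with shifts between \<open>a\<close> and \<open>b\<close>. No
  factor has to be divided out, so all poles come from \<open>lerch_sum\<close>.\<close>

lemma hurwitz2_recursion:
  assumes a: "0 < a" "a \<le> b" and z: "norm z \<le> 1" and p: "p \<in> hurwitz_strip 0"
  shows "hurwitz2 z a p b = lerch_sum z (fst p + snd p) a + - snd p *
    (LINT u|unit_interval_measure. of_real (b - a) * hurwitz2 z a (fst p, snd p + 1) (a + (b - a) * u))"
proof -
  have s: "Re (fst p + snd p) > 1" using p by (simp add: hurwitz_strip_def)
  let ?f = "\<lambda>m u. of_real (b - a) * (z ^ m * inv_power (real m + a) (fst p) * inv_power (real m + (a + (b - a) * u)) (snd p + 1))"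
  let ?w = "\<lambda>m. (b - a) * ((b / a) powr \<bar>Re (snd p + 1)\<bar> * (real m + a) powr - Re (fst p + (snd p + 1)))"
  have cu: "a \<le> a + (b - a) * u" "a + (b - a) * u \<le> b" if "u \<in> {0..1}" for u
    using that a mult_left_le[of u "b - a"] by auto
  have cont: "continuous_on {0..1} (?f m)" for m
  proof -
    have "real m + (a + (b - a) * u) > 0" if "u \<in> {0..1}" for u
      using cu(1)[OF that] a(1) by (simp add: add_nonneg_pos)
    then have "continuous_on {0..1} (\<lambda>u. inv_power (real m + (a + (b - a) * u)) (snd p + 1))"
      by (intro continuous_on_inv_power) (auto intro!: continuous_intros)
    then show ?thesis by (intro continuous_on_mult continuous_on_const)
  qed
  have w: "summable ?w"
    using summable_shift_powr[OF a(1), of "Re (fst p + (snd p + 1))"] s by (intro summable_mult) auto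
  have b: "norm (?f m u) \<le> ?w m" if "u \<in> {0..1}" for m u
    unfolding norm_mult[of "of_real _"] using a cu[OF that] 
    by (intro mult_mono norm_hurwitz2_term_le z) (auto simp del: of_real_diff)
  have I: "summable (\<lambda>m. LINT u|unit_interval_measure. ?f m u)"
      "(\<Sum>m. LINT u|unit_interval_measure. ?f m u) = (LINT u|unit_interval_measure. (\<Sum>m. ?f m u))"
    by (rule suminf_LINT_unit_interval[where f = ?f and w = ?w], fact cont, fact b, fact w)+
  have inner: "(\<Sum>m. ?f m u) = of_real (b - a) * hurwitz2 z a (fst p, snd p + 1) (a + (b - a) * u)" if u: "u \<in> {0..1}" for u
    unfolding hurwitz2_def fst_conv snd_conv
  proof (rule suminf_mult)
    let ?h = "\<lambda>m. z ^ m * inv_power (real m + a) (fst p) * inv_power (real m + (a + (b - a) * u)) (snd p + 1)"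
    show "summable ?h"
    proof (rule summable_comparison_test')
      show "norm (?h m) \<le> (b / a) powr \<bar>Re (snd p + 1)\<bar> * (real m + a) powr - Re (fst p + (snd p + 1))" for m
        by (rule norm_hurwitz2_term_le[OF z a(1) cu[OF u]])
      show "summable (\<lambda>m. (b / a) powr \<bar>Re (snd p + 1)\<bar> * (real m + a) powr - Re (fst p + (snd p + 1)))"
        using s a by (intro summable_mult summable_shift_powr) auto
    qed
  qed
  have "z ^ m * inv_power (real m + a) (fst p) * inv_power (real m + b) (snd p) =
      z ^ m * inv_power (real m + a) (fst p + snd p) + - snd p * (LINT u|unit_interval_measure. ?f m u)" for m
  proof -
    have A: "inv_power (real m + b) (snd p) = inv_power (real m + a) (snd p) - snd p * of_real (b - a) *
        (LINT u|unit_interval_measure. inv_power (real m + a + (b - a) * u) (snd p + 1))"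
      using inv_power_increment[of "real m + a" "b - a" "snd p"] a by simp
    have B: "(LINT u|unit_interval_measure. ?f m u) = of_real (b - a) * (z ^ m * inv_power (real m + a) (fst p) *
        (LINT u|unit_interval_measure. inv_power (real m + a + (b - a) * u) (snd p + 1)))"
      by (simp add: add.assoc)
    show ?thesis unfolding A B inv_power_add[of _ "fst p" "snd p"] by (simp only: algebra_simps mult_minus_left mult_minus_right) simp
  qed
  moreover have "(\<lambda>m. z ^ m * inv_power (real m + a) (fst p + snd p) + - snd p * (LINT u|unit_interval_measure. ?f m u)) sums
     (lerch_sum z (fst p + snd p) a + - snd p * (LINT u|unit_interval_measure. (\<Sum>m. ?f m u)))"
    unfolding I(2)[symmetric] lerch_sum_def
    using summable_norm_cancel[OF summable_lerch[OF z a(1) s]] I(1)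
    by (intro sums_add sums_mult summable_sums) auto
  ultimately have "hurwitz2 z a p b = lerch_sum z (fst p + snd p) a + - snd p * (LINT u|unit_interval_measure. (\<Sum>m. ?f m u))"
    by (simp add: hurwitz2_def sums_iff)
  moreover have "(LINT u|unit_interval_measure. (\<Sum>m. ?f m u)) =
     (LINT u|unit_interval_measure. of_real (b - a) * hurwitz2 z a (fst p, snd p + 1) (a + (b - a) * u))"
    by (intro Bochner_Integration.integral_cong refl inner) simp
  ultimately show ?thesis by simp
qed

lemma continues_hurwitz2:
  assumes a: "0 < a" "a \<le> 1" and z: "norm z \<le> 1"
  shows "continues a (hurwitz_strip 0) (hurwitz_strip N) (hurwitz2 z a)"
proof (induction N)
  case 0
  show ?case by (intro continues_refl param_holo_hurwitz2 a z)
next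
  case (Suc N)
  show ?case
  proof (rule continues_step[OF Suc.IH continues_fixed_param[OF continues_lerch_sum[OF a z] order_refl]])
    show "1 * hurwitz2 z a p b = lerch_sum z (fst p + snd p) a + - snd p *
      (LINT u|unit_interval_measure. of_real (b - a) * hurwitz2 z a (fst p, snd p + 1) (a + (b - a) * u))"
      if "p \<in> hurwitz_strip 0" "a \<le> b" for p b
      using hurwitz2_recursion[OF a(1) that(2) z that(1)] by simp
    show "nondegenerate (\<lambda>p. 1)" by (intro nondegenerateI holo2_const) auto
    show "holo2 (\<lambda>p. - snd p) UNIV" by (intro holo2_minus holo2_snd) auto
    show "open (hurwitz_strip (Suc N))" by (rule open_hurwitz_strip)
  qed (auto simp: hurwitz_strip_def split_beta intro!: continuous_intros)
qed

section \<open>Continuation of the double sum\<close>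

text \<open>The outer shift stays at \<open>a\<close>, while the inner shift \<open>b\<close> is
  free, as the recursion requires. Since the inner index of \<open>Phi2_series\<close> starts at
  distance one from the outer, that series is the case \<open>b = a + 1\<close>.\<close>

definition double_lerch :: "complex \<Rightarrow> complex \<Rightarrow> real \<Rightarrow> complex \<times> complex \<Rightarrow> real \<Rightarrow> complex" where
  "double_lerch z1 z2 a p b = (\<Sum>m. z1 ^ m * inv_power (real m + a) (fst p) * lerch_sum z2 (snd p) (real m + b))"

lemma norm_double_lerch_term_le:
  assumes z: "norm z1 \<le> 1" "norm z2 \<le> 1" and a: "0 < a" "a \<le> b" and e: "\<epsilon> > 0" "1 + \<epsilon> \<le> Re s2"
  shows "norm (z1 ^ m * inv_power (real m + a) s1 * lerch_sum z2 s2 (real m + b))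
    \<le> (\<Sum>n. (real n + a) powr - (1 + \<epsilon>)) * (real m + a) powr - (Re (s1 + s2) - 1 - \<epsilon>)"
proof -
  have "norm (z1 ^ m * inv_power (real m + a) s1 * lerch_sum z2 s2 (real m + b)) \<le>
     (real m + a) powr - Re s1 * ((\<Sum>n. (real n + a) powr - (1 + \<epsilon>)) * (real m + a) powr (1 + \<epsilon> - Re s2))"
    unfolding norm_mult[of "_ * _"] 
    using assms by (intro mult_mono norm_lerch_term_le norm_lerch_sum_le) auto
  also have "\<dots> = (\<Sum>n. (real n + a) powr - (1 + \<epsilon>)) * ((real m + a) powr - Re s1 * (real m + a) powr (1 + \<epsilon> - Re s2))"
    by simp
  also have "\<dots> = (\<Sum>n. (real n + a) powr - (1 + \<epsilon>)) * (real m + a) powr - (Re (s1 + s2) - 1 - \<epsilon>)"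
    unfolding powr_add[symmetric] by (simp add: algebra_simps)
  finally show ?thesis .
qed

lemma suminf_shift_powr_nonneg: "(\<Sum>n. (real n + a) powr - \<rho>) \<ge> 0" if "a > 0" "\<rho> > 1"
  using that by (intro suminf_nonneg summable_shift_powr) auto

lemma param_holo_double_lerch:
  assumes a: "0 < a" "a \<le> 1" and z: "norm z1 \<le> 1" "norm z2 \<le> 1"
  shows "param_holo a (Phi2_strip 0) (double_lerch z1 z2 a)"
  unfolding double_lerch_def
proof (rule param_holo_suminf[OF open_Phi2_strip])
  show "param_holo a (Phi2_strip 0) (\<lambda>p b. z1 ^ m * inv_power (real m + a) (fst p) * lerch_sum z2 (snd p) (real m + b))" for m
    using a z by (intro param_holo_mult param_holo_lerch_sum param_holo_holo2 holo2_const holo2_inv_power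
        holo2_fst holo2_snd holo2_mult open_Phi2_strip) (auto simp: Phi2_strip_def)
  fix p and B :: real assume p: "p \<in> Phi2_strip 0" and B: "B \<ge> a"
  \<comment> \<open>One \<open>\<epsilon>\<close> of \<open>Re s2\<close> is lost to moving
    \<open>p\<close> and one to convergence in \<open>n\<close>. A quarter of the other margin
    leaves the outer exponent \<open>?A\<close> at least \<open>1 + 2 * \<epsilon>\<close>.\<close>
  define \<epsilon> where "\<epsilon> = min ((Re (snd p) - 1) / 2) ((Re (fst p + snd p) - 2) / 4)"
  have e: "\<epsilon> > 0" "2 * \<epsilon> \<le> Re (snd p) - 1" "4 * \<epsilon> \<le> Re (fst p + snd p) - 2"
    using p by (auto simp: \<epsilon>_def Phi2_strip_def min_def)
  have cont_sum: "continuous_on UNIV (\<lambda>p::complex \<times> complex. fst p + snd p)"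
    and cont_snd: "continuous_on UNIV (\<lambda>p::complex \<times> complex. snd p)"
    by (intro continuous_intros)+
  obtain r1 where r1: "r1 > 0" "\<And>q. q \<in> ball p r1 \<inter> UNIV \<Longrightarrow> \<bar>Re (fst q + snd q) - Re (fst p + snd p)\<bar> < \<epsilon>"
    using continuous_Re_near[OF cont_sum UNIV_I e(1)] by blast
  obtain r2 where r2: "r2 > 0" "\<And>q. q \<in> ball p r2 \<inter> UNIV \<Longrightarrow> \<bar>Re (snd q) - Re (snd p)\<bar> < \<epsilon>"
    using continuous_Re_near[OF cont_snd UNIV_I e(1)] by blast
  let ?Q = "\<Sum>n. (real n + a) powr - (1 + \<epsilon>)" and ?A = "Re (fst p + snd p) - 1 - 2 * \<epsilon>"
  let ?w = "\<lambda>m. ?Q * (a powr - (2 * \<epsilon>) * (real m + a) powr - ?A)"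
  have "norm (z1 ^ m * inv_power (real m + a) (fst q) * lerch_sum z2 (snd q) (real m + b)) \<le> ?w m"
    if q: "q \<in> ball p (min r1 r2)" and b: "b \<in> {a..B}" for q b m
  proof -
    have "norm (z1 ^ m * inv_power (real m + a) (fst q) * lerch_sum z2 (snd q) (real m + b))
       \<le> ?Q * (real m + a) powr - (Re (fst q + snd q) - 1 - \<epsilon>)"
      using a b e r2(2)[of q] q by (intro norm_double_lerch_term_le z) auto
    also have "\<dots> \<le> ?w m"
      using a e r1(2)[of q] q
      by (intro mult_left_mono suminf_shift_powr_nonneg powr_local_bound) (auto simp: abs_less_iff)
    finally show ?thesis .
  qed
  moreover have "summable ?w"
    using a e by (intro summable_mult summable_shift_powr) auto
  ultimately show "\<exists>r>0. \<exists>w. summable w \<and> (\<forall>q\<in>ball p r \<inter> Phi2_strip 0. \<forall>b\<in>{a..B}. \<forall>m.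
      norm (z1 ^ m * inv_power (real m + a) (fst q) * lerch_sum z2 (snd q) (real m + b)) \<le> w m)"
    using r1(1) r2(1) by (intro exI[of _ "min r1 r2"] conjI exI[of _ ?w]) auto
qed

lemma Phi2_strip_0_epsilon:
  assumes "p \<in> Phi2_strip 0"
  obtains \<epsilon> where "\<epsilon> > 0" "1 + \<epsilon> \<le> Re (snd p)" "Re (fst p + snd p) - 1 - \<epsilon> > 1"
proof -
  define \<epsilon> where "\<epsilon> = min (Re (snd p) - 1) ((Re (fst p + snd p) - 2) / 2)"
  have "\<epsilon> > 0" "\<epsilon> \<le> Re (snd p) - 1" "\<epsilon> \<le> (Re (fst p + snd p) - 2) / 2"
    using assms unfolding \<epsilon>_def by (simp_all only: min.cobounded1 min.cobounded2) (simp add: Phi2_strip_def)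
  then show ?thesis by (intro that[of \<epsilon>]) auto
qed

text \<open>\<open>lerch_sum_recursion\<close> is applied to each inner sum, with the outer power as
  a coefficient; summation over \<open>m\<close> collects the boundary terms in
  \<open>hurwitz2\<close>.\<close>

lemma double_lerch_recursion:
  assumes a: "0 < a" "a \<le> 1" "a \<le> b" and z: "norm z1 \<le> 1" "norm z2 \<le> 1" and p: "p \<in> Phi2_strip 0"
  shows "rec_lead z2 (snd p) * double_lerch z1 z2 a p b =
    hurwitz2 z1 a (fst p, snd p - rec_shift z2) b + rec_coeff z2 (snd p) *
    (LINT u|unit_interval_measure. rec_weight z2 u * double_lerch z1 z2 a (fst p, snd p + 1) (b + u))"
proof -
  have s: "Re (snd p) > 1" using p by (simp add: Phi2_strip_def)
  obtain \<epsilon> where e: "\<epsilon> > 0" "1 + \<epsilon> \<le> Re (snd p)" "Re (fst p + snd p) - 1 - \<epsilon> > 1"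
    using Phi2_strip_0_epsilon[OF p] .
  let ?c = "\<lambda>m. z1 ^ m * inv_power (real m + a) (fst p)"
  let ?f = "\<lambda>m u. rec_weight z2 u * (?c m * lerch_sum z2 (snd p + 1) (real m + (b + u)))"
  let ?v = "\<lambda>m. (\<Sum>n. (real n + a) powr - (1 + \<epsilon>)) * (real m + a) powr - (Re (fst p + (snd p + 1)) - 1 - \<epsilon>)"
  have w: "summable ?v" using a e by (intro summable_mult summable_shift_powr) auto
  have v: "norm (?c m * lerch_sum z2 (snd p + 1) (real m + (b + u))) \<le> ?v m" if "u \<in> {0..1}" for m u
    using a e that by (intro norm_double_lerch_term_le z) auto
  have b: "norm (?f m u) \<le> ?v m" if "u \<in> {0..1}" for m u
  proof -
    have "norm (?f m u) \<le> 1 * ?v m"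
      unfolding norm_mult[of "rec_weight z2 u"] using v that by (intro mult_mono rec_weight_norm) auto
    then show ?thesis by simp
  qed
  have cont: "continuous_on {0..1} (?f m)" for m
  proof -
    have "param_holo a (Phi2_strip 0) (\<lambda>p c. lerch_sum z2 (snd p) (real m + c))"
      using a z by (intro param_holo_lerch_sum holo2_snd open_Phi2_strip) (auto simp: Phi2_strip_def)
    then have c: "continuous_on (Phi2_strip 0 \<times> {a..}) (\<lambda>(p, c). lerch_sum z2 (snd p) (real m + c))"
      by (simp add: param_holo_def)
    have "continuous_on {0..1} (\<lambda>u. ((fst p, snd p + 1), b + u))" by (intro continuous_intros)
    moreover have "(\<lambda>u. ((fst p, snd p + 1), b + u)) ` {0..1} \<subseteq> Phi2_strip 0 \<times> {a..}"
      using p a by (auto simp: Phi2_strip_def)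
    ultimately have "continuous_on {0..1} (\<lambda>u. lerch_sum z2 (snd p + 1) (real m + (b + u)))"
      using continuous_on_compose2[OF c] by fastforce
    then show ?thesis by (intro continuous_intros continuous_on_rec_weight)
  qed
  have I: "summable (\<lambda>m. LINT u|unit_interval_measure. ?f m u)"
      "(\<Sum>m. LINT u|unit_interval_measure. ?f m u) = (LINT u|unit_interval_measure. (\<Sum>m. ?f m u))"
    by (rule suminf_LINT_unit_interval[where f = ?f and w = ?v], fact cont, fact b, fact w)+
  have inner: "(\<Sum>m. ?f m u) = rec_weight z2 u * double_lerch z1 z2 a (fst p, snd p + 1) (b + u)" if u: "u \<in> {0..1}" for u
    unfolding double_lerch_def fst_conv snd_conv
    by (rule suminf_mult, rule summable_comparison_test'[OF w]) (use v[OF u] in auto)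
  let ?g = "\<lambda>m. ?c m * inv_power (real m + b) (snd p - rec_shift z2)"
  have eq: "rec_lead z2 (snd p) * (?c m * lerch_sum z2 (snd p) (real m + b)) =
     ?g m + rec_coeff z2 (snd p) * (LINT u|unit_interval_measure. ?f m u)" for m
  proof -
    have A: "(LINT u|unit_interval_measure. ?f m u) = ?c m *
        (LINT u|unit_interval_measure. rec_weight z2 u * lerch_sum z2 (snd p + 1) (real m + b + u))"
      unfolding integral_mult_right_zero[symmetric] by (simp add: mult_ac add_ac)
    have B: "rec_lead z2 (snd p) * (?c m * lerch_sum z2 (snd p) (real m + b)) =
        ?c m * (rec_lead z2 (snd p) * lerch_sum z2 (snd p) (real m + b))" by simp
    have C: "rec_lead z2 (snd p) * lerch_sum z2 (snd p) (real m + b) = inv_power (real m + b) (snd p - rec_shift z2)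
        + rec_coeff z2 (snd p) * (LINT u|unit_interval_measure. rec_weight z2 u * lerch_sum z2 (snd p + 1) (real m + b + u))"
      using a s by (intro lerch_sum_recursion z) auto
    show ?thesis unfolding A B C by (simp only: algebra_simps)
  qed
  have g: "summable ?g"
  proof (rule summable_comparison_test')
    show "norm (?g m) \<le> (b / a) powr \<bar>Re (snd p - rec_shift z2)\<bar> * (real m + a) powr - Re (fst p + (snd p - rec_shift z2))" for m
      using a by (intro norm_hurwitz2_term_le z) auto
    show "summable (\<lambda>m. (b / a) powr \<bar>Re (snd p - rec_shift z2)\<bar> * (real m + a) powr - Re (fst p + (snd p - rec_shift z2)))"
      using a e by (intro summable_mult summable_shift_powr) (auto simp: rec_shift_def)
  qed
  have l: "summable (\<lambda>m. ?c m * lerch_sum z2 (snd p) (real m + b))"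
  proof (rule summable_comparison_test')
    show "norm (?c m * lerch_sum z2 (snd p) (real m + b)) \<le> 
       (\<Sum>n. (real n + a) powr - (1 + \<epsilon>)) * (real m + a) powr - (Re (fst p + snd p) - 1 - \<epsilon>)" for m
      using a e by (intro norm_double_lerch_term_le z) auto
    show "summable (\<lambda>m. (\<Sum>n. (real n + a) powr - (1 + \<epsilon>)) * (real m + a) powr - (Re (fst p + snd p) - 1 - \<epsilon>))"
      using a e by (intro summable_mult summable_shift_powr) auto
  qed
  have "(\<lambda>m. ?g m + rec_coeff z2 (snd p) * (LINT u|unit_interval_measure. ?f m u)) sums
     (hurwitz2 z1 a (fst p, snd p - rec_shift z2) b + rec_coeff z2 (snd p) * (LINT u|unit_interval_measure. (\<Sum>m. ?f m u)))"
    unfolding hurwitz2_def fst_conv snd_conv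
    using I by (intro sums_add sums_mult summable_sums g) (simp add: sums_iff)
  moreover have "(\<lambda>m. rec_lead z2 (snd p) * (?c m * lerch_sum z2 (snd p) (real m + b))) sums
      (rec_lead z2 (snd p) * double_lerch z1 z2 a p b)"
    unfolding double_lerch_def by (intro sums_mult summable_sums l)
  ultimately have "rec_lead z2 (snd p) * double_lerch z1 z2 a p b =
     hurwitz2 z1 a (fst p, snd p - rec_shift z2) b + rec_coeff z2 (snd p) * (LINT u|unit_interval_measure. (\<Sum>m. ?f m u))"
    unfolding eq using sums_unique2 by blast
  moreover have "(LINT u|unit_interval_measure. (\<Sum>m. ?f m u)) =
     (LINT u|unit_interval_measure. rec_weight z2 u * double_lerch z1 z2 a (fst p, snd p + 1) (b + u))"
    by (intro Bochner_Integration.integral_cong refl inner) simp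
  ultimately show ?thesis by simp
qed

lemma continues_double_lerch:
  assumes a: "0 < a" "a \<le> 1" and z: "norm z1 \<le> 1" "norm z2 \<le> 1"
  shows "continues a (Phi2_strip 0) (Phi2_strip N) (double_lerch z1 z2 a)"
proof (induction N)
  case 0
  show ?case by (intro continues_refl param_holo_double_lerch a z)
next
  case (Suc N)
  \<comment> \<open>For \<open>z2 = 1\<close> the boundary terms have exponent
    \<open>s2 - 1\<close>. This turns the half-space of \<open>hurwitz2\<close> into
    \<open>Re (s1 + s2) > 2 - (N + 1)\<close>, which is the second wall of
    \<open>Phi2_strip (Suc N)\<close>.\<close>
  have "continues a (Phi2_strip 0) (Phi2_strip (Suc N)) (\<lambda>p b. hurwitz2 z1 a (fst p + 0, snd p + (- rec_shift z2)) b)"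
    by (rule continues_mono[OF continues_shift[OF continues_hurwitz2[OF a z(1), of "Suc N"]] _ open_Phi2_strip])
       (auto simp: Phi2_strip_def hurwitz_strip_def rec_shift_def)
  then have H: "continues a (Phi2_strip 0) (Phi2_strip (Suc N)) (\<lambda>p b. hurwitz2 z1 a (fst p, snd p - rec_shift z2) b)"
    by simp
  show ?case
  proof (rule continues_step[OF Suc.IH H])
    show "rec_lead z2 (snd p) * double_lerch z1 z2 a p b =
      hurwitz2 z1 a (fst p, snd p - rec_shift z2) b + rec_coeff z2 (snd p) *
      (LINT u|unit_interval_measure. rec_weight z2 u * double_lerch z1 z2 a (fst p, snd p + 1) (b + u))"
      if "p \<in> Phi2_strip 0" "a \<le> b" for p b
      using double_lerch_recursion[OF a that(2) z that(1)] .
    show "continuous_on ({a..} \<times> {0..1}) (\<lambda>(b, u). rec_weight z2 u)"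
      unfolding split_beta by (intro continuous_on_rec_weight continuous_intros)
    show "nondegenerate (\<lambda>p. rec_lead z2 (snd p))" by (rule nondegenerate_rec_lead_snd)
    show "holo2 (\<lambda>p. rec_coeff z2 (snd p)) UNIV" by (intro holo2_rec_coeff holo2_snd) auto
    show "open (Phi2_strip (Suc N))" by (rule open_Phi2_strip)
  qed (auto simp: Phi2_strip_def split_beta intro!: continuous_intros)
qed

lemma Phi2_series_eq_double_lerch:
  assumes "a > 0"
  shows "Phi2_series s1 s2 a z1 z2 = double_lerch z1 z2 a (s1, s2) (a + 1)"
proof -
  have "z1 ^ m / complex_of_real (real m + a) powr s1 = z1 ^ m * inv_power (real m + a) s1" for m
    using assms inv_power_eq_powr[of "real m + a" s1] by simp
  moreover have "z2 ^ n / complex_of_real (real m + real n + 1 + a) powr s2 = z2 ^ n * inv_power (real n + (real m + (a + 1))) s2" for m n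
    using assms inv_power_eq_powr[of "real n + (real m + (a + 1))" s2] by (simp add: add_ac)
  ultimately show ?thesis
    unfolding Phi2_series_def double_lerch_def lerch_sum_def fst_conv snd_conv by (simp only:)
qed

lemma Phi2_continuation:
  assumes a: "0 < a" "a \<le> 1" and z: "norm z1 \<le> 1" "norm z2 \<le> 1"
  shows "\<exists>D G. nondegenerate D \<and> holo2 G (Phi2_strip N) \<and>
      (\<forall>p\<in>Phi2_acr. D p * Phi2_series (fst p) (snd p) a z1 z2 = G p)"
proof -
  obtain D G where "nondegenerate D" "param_holo a (Phi2_strip N) G"
     "\<forall>p\<in>Phi2_strip 0. \<forall>b\<ge>a. D p * double_lerch z1 z2 a p b = G p b"
    using continues_double_lerch[OF a z, of N] by (auto simp: continues_def)
  then show ?thesis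
    using Phi2_acr_subset_strip[of 0] Phi2_series_eq_double_lerch[OF a(1)]
    by (intro exI[of _ D] exI[of _ "\<lambda>p. G p (a + 1)"]) (auto simp: param_holo_def subset_iff)
qed

section \<open>Uniqueness of two-dimensional characteristic functions\<close>

lemma integrable_finite_bounded:
  fixes f :: "'a \<Rightarrow> 'b::{banach, second_countable_topology}"
  assumes "finite_measure M" "f \<in> borel_measurable M" "\<And>x. norm (f x) \<le> B"
  shows "integrable M f"
  by (rule finite_measure.integrable_const_bound[OF assms(1) _ assms(2)]) (use assms(3) in auto)

lemma cis_measurable [measurable]: "cis \<in> borel_measurable borel"
  by (intro borel_measurable_continuous_onI continuous_intros)

lemma fst_snd_borel_measurable [measurable]:
  "fst \<in> borel_measurable (borel :: (real \<times> real) measure)" "snd \<in> borel_measurable (borel :: (real \<times> real) measure)"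
  by (intro borel_measurable_continuous_onI continuous_intros)+

text \<open>Levy's uniqueness theorem speaks of probability measures. Frequency 0 shows that the
  masses agree, so both measures are normalised by the same constant, and mass zero is treated
  separately.\<close>

lemma finite_measure_eq_if_char_eq:
  fixes M N :: "real measure"
  assumes fin: "finite_measure M" "finite_measure N" and sets [measurable_cong]: "sets M = sets borel" "sets N = sets borel"
    and eq: "\<And>t. (CLINT x|M. cis (t * x)) = (CLINT x|N. cis (t * x))"
  shows "M = N"
proof -
  interpret M: finite_measure M by fact
  interpret N: finite_measure N by fact
  have sp: "space M = UNIV" "space N = UNIV" using sets sets_eq_imp_space_eq[of _ "borel :: real measure"] by auto
  have mass: "measure M UNIV = measure N UNIV"
    using eq[of 0] by (simp add: sp)
  show ?thesis
  proof (cases "measure M UNIV = 0")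
    case True
    then have "emeasure M UNIV = 0" "emeasure N UNIV = 0"
      using mass by (simp_all add: M.emeasure_eq_measure N.emeasure_eq_measure)
    then have "emeasure M A = 0" "emeasure N A = 0" for A
      using emeasure_mono[of A UNIV M] emeasure_mono[of A UNIV N] sp
      by (metis emeasure_space le_zero_eq)+
    then show ?thesis by (intro measure_eqI) (use sets in auto)
  next
    case False
    let ?m = "measure M UNIV"
    have m: "?m > 0" using False by (simp add: zero_less_measure_iff)
    let ?d = "\<lambda>M :: real measure. density M (\<lambda>_. ennreal (1 / ?m))"
    have "emeasure (?d M) UNIV = 1" "emeasure (?d N) UNIV = 1"
      using m sp mass by (simp_all add: emeasure_density_const M.emeasure_eq_measure N.emeasure_eq_measure ennreal_mult[symmetric])
    then have "prob_space (?d M)" "prob_space (?d N)" using sp by (auto intro!: prob_spaceI)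
    then have rd: "real_distribution (?d M)" "real_distribution (?d N)"
      using sets by (auto simp: real_distribution_def real_distribution_axioms_def)
    have "char (?d M) = char (?d N)"
    proof
      fix t
      have "char (?d L) t = (1 / ?m) *\<^sub>R (CLINT x|L. cis (t * x))" if [measurable_cong]: "sets L = sets borel" for L :: "real measure"
        unfolding char_def cis_conv_exp[symmetric] using m by (subst integral_density) auto
      then show "char (?d M) t = char (?d N) t" using sets eq by simp
    qed
    then have eqd: "?d M = ?d N" using rd by (intro Levy_uniqueness)
    show ?thesis
    proof (rule measure_eqI)
      fix A assume A: "A \<in> Sigma_Algebra.sets M"
      then have "ennreal (1 / ?m) * emeasure M A = ennreal (1 / ?m) * emeasure N A"
        using arg_cong[OF eqd, of "\<lambda>L. emeasure L A"] sets by (simp add: emeasure_density_const)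
      then show "emeasure M A = emeasure N A"
        using m by (simp add: ennreal_mult_cancel_left)
    qed (use sets in simp)
  qed
qed

text \<open>Reduction to one dimension in two rounds. Weighting with a function of the second
  coordinate and projecting to the first gives equality on sets \<open>A\<close> of first
  coordinates; restricting to \<open>A\<close> and projecting to the second gives equality on
  rectangles, which generate the Borel sets.\<close>

lemma char2_finite_measure_unique:
  fixes M N :: "(real \<times> real) measure"
  assumes fin: "finite_measure M" "finite_measure N" and sets [measurable_cong]: "sets M = sets borel" "sets N = sets borel"
    and eq: "\<And>s t. char2 M s t = char2 N s t"
  shows "M = N"
proof -
  interpret M: finite_measure M by fact
  interpret N: finite_measure N by fact
  have sp: "space M = UNIV" "space N = UNIV"
    using sets sets_eq_imp_space_eq[of _ "borel :: (real \<times> real) measure"] by auto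
  \<comment> \<open>Adding 1 keeps the weight nonnegative, so that it defines a measure. The
    transform of the weighted projection is a combination of values of \<open>char2\<close>.\<close>
  let ?h = "\<lambda>s \<phi> p. 1 + cos (s * snd p + \<phi> :: real)"
  let ?D = "\<lambda>L s \<phi>. distr (density L (\<lambda>p. ennreal (?h s \<phi> p))) borel fst :: real measure"
  have hpos: "?h s \<phi> p \<ge> 0" for s \<phi> and p :: "real \<times> real"
    using cos_ge_minus_one[of "s * snd p + \<phi>"] by linarith
  have expand: "(CLINT x|?D L s \<phi>. cis (t * x)) =
      char2 L t 0 + (cis \<phi> * char2 L t s + cis (- \<phi>) * char2 L t (- s)) / 2"
    if L [measurable_cong]: "sets L = sets borel" and fL: "finite_measure L" for L :: "(real \<times> real) measure" and s \<phi> t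
  proof -
    have i: "integrable L (\<lambda>p. cis (u * fst p + v * snd p))" for u v
      by (rule integrable_finite_bounded[OF fL, where B=1]) (auto simp: measurable_cong_sets[OF L refl])
    have "(CLINT x|?D L s \<phi>. cis (t * x)) = (CLINT p|L. ?h s \<phi> p *\<^sub>R cis (t * fst p))"
      using hpos by (subst integral_distr, simp, simp, subst integral_density) auto
    also have "\<dots> = (CLINT p|L. cis (t * fst p + 0 * snd p) +
         (cis \<phi> * cis (t * fst p + s * snd p) + cis (- \<phi>) * cis (t * fst p + (- s) * snd p)) / 2)"
    proof (intro Bochner_Integration.integral_cong refl)
      fix p
      have cos_cis: "complex_of_real (cos \<theta>) = (cis \<theta> + cis (- \<theta>)) / 2" for \<theta>
        by (simp add: complex_eq_iff)
      then show "?h s \<phi> p *\<^sub>R cis (t * fst p) = cis (t * fst p + 0 * snd p) +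
         (cis \<phi> * cis (t * fst p + s * snd p) + cis (- \<phi>) * cis (t * fst p + (- s) * snd p)) / 2"
        unfolding scaleR_conv_of_real of_real_add of_real_1 cos_cis
        by (simp add: cis_mult algebra_simps add_divide_distrib)
    qed
    also have "\<dots> = char2 L t 0 + (cis \<phi> * char2 L t s + cis (- \<phi>) * char2 L t (- s)) / 2"
      unfolding char2_def using i[of t 0] i[of t s] i[of t "- s"] by simp
    finally show ?thesis .
  qed
  have finD: "finite_measure (?D L s \<phi>)" if L [measurable_cong]: "sets L = sets borel" and fL: "finite_measure L" for L :: "(real \<times> real) measure" and s \<phi>
  proof -
    have "integrable L (?h s \<phi>)"
      by (rule integrable_finite_bounded[OF fL, where B=2])
         (auto intro!: order_trans[OF abs_triangle_ineq] simp: measurable_cong_sets[OF L refl])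
    then have "(\<integral>\<^sup>+p. ennreal (?h s \<phi> p) \<partial>L) < \<infinity>" using hpos by (simp add: integrable_iff_bounded)
    then have "finite_measure (density L (\<lambda>p. ennreal (?h s \<phi> p)))"
      by (intro finite_measureI) (simp add: emeasure_density)
    then show ?thesis by (rule finite_measure.finite_measure_distr) simp
  qed
  have D_eq: "?D M s \<phi> = ?D N s \<phi>" for s \<phi>
    using finD expand fin sets eq by (intro finite_measure_eq_if_char_eq) auto
  have wint: "(LINT p|M. indicator A (fst p) * ?h s \<phi> p) = (LINT p|N. indicator A (fst p) * ?h s \<phi> p)"
    if [measurable]: "A \<in> Sigma_Algebra.sets borel" for A s \<phi>
  proof -
    have W: "(LINT x|?D L s \<phi>. indicator A x) = (LINT p|L. indicator A (fst p) * ?h s \<phi> p)"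
      if [measurable_cong]: "Sigma_Algebra.sets L = Sigma_Algebra.sets borel" for L :: "(real \<times> real) measure"
      using hpos by (subst integral_distr, simp, simp, subst integral_density) (auto simp: mult.commute)
    show ?thesis unfolding W[OF sets(1), symmetric] W[OF sets(2), symmetric] D_eq ..
  qed
  have rect: "emeasure M (A \<times> B) = emeasure N (A \<times> B)"
    if AB [measurable]: "A \<in> Sigma_Algebra.sets borel" "B \<in> Sigma_Algebra.sets borel" for A B :: "real set"
  proof -
    have ia: "integrable L (\<lambda>p. indicator A (fst p) * f p)" 
      if L [measurable_cong]: "Sigma_Algebra.sets L = Sigma_Algebra.sets borel" and fL: "finite_measure L" 
       and [measurable]: "f \<in> borel_measurable borel" and "\<And>p. \<bar>f p\<bar> \<le> 1" for L and f :: "real \<times> real \<Rightarrow> real"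
      by (rule integrable_finite_bounded[OF fL, where B=1])
         (use that(4) in \<open>auto simp: measurable_cong_sets[OF L refl] indicator_def\<close>)
    have i1: "integrable L (\<lambda>p. indicator A (fst p) :: real)"
      if L [measurable_cong]: "Sigma_Algebra.sets L = Sigma_Algebra.sets borel" and fL: "finite_measure L" for L :: "(real \<times> real) measure"
      using ia[OF L fL, of "\<lambda>_. 1"] by simp
    \<comment> \<open>Frequency 0 with phase \<open>pi / 2\<close> makes the weight identically 1;
      subtracting this case isolates the cosine.\<close>
    have m: "(LINT p|M. indicator A (fst p) :: real) = (LINT p|N. indicator A (fst p))"
      using wint[of A 0 "pi/2"] by simp
    have c: "(LINT p|M. indicator A (fst p) * cos (s * snd p + \<phi>)) = (LINT p|N. indicator A (fst p) * cos (s * snd p + \<phi>))" for s \<phi>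
    proof -
      have "(LINT p|L. indicator A (fst p) * ?h s \<phi> p) = (LINT p|L. indicator A (fst p)) + (LINT p|L. indicator A (fst p) * cos (s * snd p + \<phi>))"
        if L: "Sigma_Algebra.sets L = Sigma_Algebra.sets borel" and fL: "finite_measure L" for L :: "(real \<times> real) measure"
        using i1[OF L fL] ia[OF L fL, of "\<lambda>p. cos (s * snd p + \<phi>)"] by (simp add: distrib_left)
      then show ?thesis using wint[of A s \<phi>] m sets fin by simp
    qed
    \<comment> \<open>Second round: phases 0 and \<open>- (pi / 2)\<close> supply the real and
      imaginary parts of the transform of the part of \<open>L\<close> over
      \<open>A\<close>.\<close>
    let ?E = "\<lambda>L. distr (density L (\<lambda>p. ennreal (indicator A (fst p)))) borel snd :: real measure"
    have cE: "(CLINT y|?E L. cis (s * y)) = Complex (LINT p|L. indicator A (fst p) * cos (s * snd p + 0)) (LINT p|L. indicator A (fst p) * cos (s * snd p + - (pi / 2)))"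
      if L [measurable_cong]: "Sigma_Algebra.sets L = Sigma_Algebra.sets borel" and fL: "finite_measure L" for L :: "(real \<times> real) measure" and s
    proof -
      have "(CLINT y|?E L. cis (s * y)) = (CLINT p|L. indicator A (fst p) *\<^sub>R cis (s * snd p))"
        by (subst integral_distr, simp, simp, subst integral_density) auto
      also have "\<dots> = (CLINT p|L. complex_of_real (indicator A (fst p) * cos (s * snd p)) + \<i> * complex_of_real (indicator A (fst p) * sin (s * snd p)))"
        by (intro Bochner_Integration.integral_cong refl) (simp add: complex_eq_iff)
      also have "\<dots> = of_real (LINT p|L. indicator A (fst p) * cos (s * snd p)) + \<i> * of_real (LINT p|L. indicator A (fst p) * sin (s * snd p))"
        using ia[OF L fL, of "\<lambda>p. cos (s * snd p)"] ia[OF L fL, of "\<lambda>p. sin (s * snd p)"]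
        by (subst Bochner_Integration.integral_add) (auto simp del: of_real_mult simp add: integral_complex_of_real)
      also have "\<dots> = Complex (LINT p|L. indicator A (fst p) * cos (s * snd p + 0)) (LINT p|L. indicator A (fst p) * cos (s * snd p + - (pi / 2)))"
        by (simp add: complex_eq_iff cos_diff)
      finally show ?thesis .
    qed
    have fE: "finite_measure (?E L)" 
      if L [measurable_cong]: "Sigma_Algebra.sets L = Sigma_Algebra.sets borel" and fL: "finite_measure L" for L :: "(real \<times> real) measure"
    proof -
      have "(\<integral>\<^sup>+p. ennreal (indicator A (fst p)) \<partial>L) < \<infinity>" using i1[OF L fL] by (simp add: integrable_iff_bounded)
      then have "finite_measure (density L (\<lambda>p. ennreal (indicator A (fst p))))"
        by (intro finite_measureI) (simp add: emeasure_density)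
      then show ?thesis by (rule finite_measure.finite_measure_distr) simp
    qed
    have E: "?E M = ?E N"
    proof (rule finite_measure_eq_if_char_eq)
      show "(CLINT y|?E M. cis (s * y)) = (CLINT y|?E N. cis (s * y))" for s
        unfolding cE[OF sets(1) fin(1)] cE[OF sets(2) fin(2)] c ..
    qed (use fE fin sets in auto)
    have W: "emeasure (?E L) B = emeasure L (A \<times> B)" if L [measurable_cong]: "Sigma_Algebra.sets L = Sigma_Algebra.sets borel" for L :: "(real \<times> real) measure"
    proof -
      have spL: "space L = UNIV" using L sets_eq_imp_space_eq by fastforce
      have "emeasure (?E L) B = (\<integral>\<^sup>+p. ennreal (indicator A (fst p)) * indicator (snd -` B) p \<partial>L)"
        using measurable_sets[OF fst_snd_borel_measurable(2) AB(2)] L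
        by (subst emeasure_distr, simp, simp, subst emeasure_density) (auto simp: spL)
      also have "\<dots> = (\<integral>\<^sup>+p. indicator (A \<times> B) p \<partial>L)"
        by (intro nn_integral_cong) (auto simp: indicator_def)
      also have "\<dots> = emeasure L (A \<times> B)"
        using borel_prod[where 'a=real and 'b=real] L by (intro nn_integral_indicator) (metis pair_measureI AB)
      finally show ?thesis .
    qed
    show ?thesis unfolding W[OF sets(1), symmetric] W[OF sets(2), symmetric] E ..
  qed
  show "M = N"
  proof (rule measure_eqI_generator_eq[where E = "{a \<times> b | a b. a \<in> Sigma_Algebra.sets borel \<and> b \<in> Sigma_Algebra.sets borel}" and \<Omega> = UNIV and A = "\<lambda>_. UNIV"])
    show "Int_stable {a \<times> b | a b. a \<in> Sigma_Algebra.sets (borel :: real measure) \<and> b \<in> Sigma_Algebra.sets (borel :: real measure)}"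
      by (rule Int_stable_pair_measure_generator)
    have "Sigma_Algebra.sets (borel :: (real \<times> real) measure) =
        sigma_sets UNIV {a \<times> b | a b. a \<in> Sigma_Algebra.sets (borel :: real measure) \<and> b \<in> Sigma_Algebra.sets (borel :: real measure)}"
      unfolding borel_prod[symmetric] sets_pair_measure by simp
    then show "Sigma_Algebra.sets M = sigma_sets UNIV {a \<times> b | a b. a \<in> Sigma_Algebra.sets (borel :: real measure) \<and> b \<in> Sigma_Algebra.sets (borel :: real measure)}"
      "Sigma_Algebra.sets N = sigma_sets UNIV {a \<times> b | a b. a \<in> Sigma_Algebra.sets (borel :: real measure) \<and> b \<in> Sigma_Algebra.sets (borel :: real measure)}"
      using sets by simp_all
    show "emeasure M UNIV \<noteq> \<infinity>" using M.emeasure_finite sp by simp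
    show "range (\<lambda>_. UNIV) \<subseteq> {a \<times> b | a b. a \<in> Sigma_Algebra.sets (borel :: real measure) \<and> b \<in> Sigma_Algebra.sets (borel :: real measure)}"
      by (auto intro!: exI[of _ "UNIV :: real set"])
  qed (use rect in auto)
qed

section \<open>Sums of measures and recovery of a law from a complex density\<close>

text \<open>Avoids signed measures: that a law has density \<open>f\<close> is first stated as law
  plus negative part of \<open>f\<close> equals positive part of \<open>f\<close>.\<close>

definition sum_measure :: "'a measure \<Rightarrow> 'a measure \<Rightarrow> 'a measure" where
  "sum_measure M N = measure_of (space M) (sets M) (\<lambda>A. emeasure M A + emeasure N A)"

lemma sets_sum_measure [simp, measurable_cong]: "sets (sum_measure M N) = sets M"
  by (simp add: sum_measure_def)

lemma space_sum_measure [simp]: "space (sum_measure M N) = space M"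
  by (simp add: sum_measure_def)

lemma emeasure_sum_measure:
  assumes "sets N = sets M" "A \<in> sets M"
  shows "emeasure (sum_measure M N) A = emeasure M A + emeasure N A"
  unfolding sum_measure_def
proof (rule emeasure_measure_of_sigma)
  show "sigma_algebra (space M) (sets M)" by (rule sets.sigma_algebra_axioms)
  show "positive (sets M) (\<lambda>A. emeasure M A + emeasure N A)" by (simp add: positive_def)
  show "countably_additive (sets M) (\<lambda>A. emeasure M A + emeasure N A)"
    using assms(1) by (intro countably_additiveI) (auto simp: suminf_add[symmetric] suminf_emeasure)
qed (rule assms(2))

lemma nn_integral_sum_measure:
  assumes sets: "sets N = sets M" and f: "f \<in> borel_measurable M"
  shows "(\<integral>\<^sup>+x. f x \<partial>sum_measure M N) = (\<integral>\<^sup>+x. f x \<partial>M) + (\<integral>\<^sup>+x. f x \<partial>N)"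
  using f
proof induction
  case (cong f g)
  have sp: "space N = space M" using sets by (rule sets_eq_imp_space_eq)
  have "(\<integral>\<^sup>+x. f x \<partial>L) = (\<integral>\<^sup>+x. g x \<partial>L)" if "space L = space M" for L
    using cong(3) that by (intro nn_integral_cong) auto
  then show ?case using cong sp by simp
next
  case (set A)
  then show ?case using sets by (simp add: emeasure_sum_measure)
next
  case (mult u c)
  then show ?case using sets by (simp add: nn_integral_cmult distrib_left cong: measurable_cong_sets)
next
  case (add u v)
  then show ?case using sets by (simp add: nn_integral_add add_ac cong: measurable_cong_sets)
next
  case (seq U)
  have m: "U i \<in> borel_measurable L" if "sets L = sets M" for i L
    using seq(1)[of i] that by (simp cong: measurable_cong_sets)
  have L: "(\<integral>\<^sup>+x. (SUP i. U i) x \<partial>L) = (SUP i. \<integral>\<^sup>+x. U i x \<partial>L)" if "sets L = sets M" for L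
    unfolding SUP_apply using seq(3) m[OF that] by (intro nn_integral_monotone_convergence_SUP) auto
  have inc: "incseq (\<lambda>i. \<integral>\<^sup>+x. U i x \<partial>L)" for L
    using seq(3) by (auto simp: incseq_def le_fun_def intro!: nn_integral_mono)
  show ?case
    using L[of M] L[of N] L[of "sum_measure M N"] sets seq(4) inc
    by (simp add: ennreal_SUP_add seq.IH)
qed

text \<open>Nonnegative test functions let the hypothesis be phrased with nonnegative integrals,
  which are additive for \<open>sum_measure\<close>. The phases recover total mass, cosine and sine
  integrals.\<close>

lemma char2_eqI:
  fixes M N :: "(real \<times> real) measure"
  assumes fin: "finite_measure M" "finite_measure N" and sets: "sets M = sets borel" "sets N = sets borel"
    and eq: "\<And>s t \<phi>. (\<integral>\<^sup>+p. ennreal (1 + cos (s * fst p + t * snd p + \<phi>)) \<partial>M) =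
               (\<integral>\<^sup>+p. ennreal (1 + cos (s * fst p + t * snd p + \<phi>)) \<partial>N)"
  shows "M = N"
proof (rule char2_finite_measure_unique[OF fin sets])
  have i: "integrable L (\<lambda>p. cos (s * fst p + t * snd p + \<phi>))"
    if L: "sets L = sets borel" and fL: "finite_measure L" for L :: "(real \<times> real) measure" and s t \<phi>
    by (rule integrable_finite_bounded[OF fL, where B=1]) (auto simp: measurable_cong_sets[OF L refl])
  have i1: "integrable L (\<lambda>p. 1 :: real)" if fL: "finite_measure L" for L :: "(real \<times> real) measure"
    by (rule integrable_finite_bounded[OF fL, where B=1]) auto
  have nonneg: "1 + cos x \<ge> 0" for x :: real using cos_ge_minus_one[of x] by linarith
  have h: "(LINT p|M. 1 + cos (s * fst p + t * snd p + \<phi>)) = (LINT p|N. 1 + cos (s * fst p + t * snd p + \<phi>))" for s t \<phi>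
  proof -
    have "ennreal (LINT p|L. 1 + cos (s * fst p + t * snd p + \<phi>)) = (\<integral>\<^sup>+p. ennreal (1 + cos (s * fst p + t * snd p + \<phi>)) \<partial>L)"
      if L: "sets L = sets borel" and fL: "finite_measure L" for L :: "(real \<times> real) measure"
      using i[OF L fL] i1[OF fL] nonneg by (intro nn_integral_eq_integral[symmetric]) auto
    then have "ennreal (LINT p|M. 1 + cos (s * fst p + t * snd p + \<phi>)) = ennreal (LINT p|N. 1 + cos (s * fst p + t * snd p + \<phi>))"
      using eq fin sets by simp
    then show ?thesis using nonneg by (simp add: Bochner_Integration.integral_nonneg)
  qed
  have h': "(LINT p|L. 1 + cos (s * fst p + t * snd p + \<phi>)) = measure L UNIV + (LINT p|L. cos (s * fst p + t * snd p + \<phi>))"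
    if L: "sets L = sets borel" and fL: "finite_measure L" for L :: "(real \<times> real) measure" and s t \<phi>
    using i[OF L fL] i1[OF fL] sets_eq_imp_space_eq[OF L] by simp
  have m: "measure M UNIV = measure N UNIV"
    using h[of 0 0 "pi/2"] h'[OF sets(1) fin(1), of 0 0 "pi/2"] h'[OF sets(2) fin(2), of 0 0 "pi/2"] by simp
  have c: "(LINT p|M. cos (s * fst p + t * snd p + \<phi>)) = (LINT p|N. cos (s * fst p + t * snd p + \<phi>))" for s t \<phi>
    using h[of s t \<phi>] h'[OF sets(1) fin(1), of s t \<phi>] h'[OF sets(2) fin(2), of s t \<phi>] m by linarith
  have r: "char2 L s t = of_real (LINT p|L. cos (s * fst p + t * snd p + 0)) + \<i> * of_real (LINT p|L. cos (s * fst p + t * snd p + - (pi / 2)))"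
    if L: "sets L = sets borel" and fL: "finite_measure L" for L :: "(real \<times> real) measure" and s t
  proof -
    have "char2 L s t = (CLINT p|L. complex_of_real (cos (s * fst p + t * snd p + 0)) + \<i> * complex_of_real (cos (s * fst p + t * snd p + - (pi / 2))))"
      unfolding char2_def by (intro Bochner_Integration.integral_cong refl) (simp add: complex_eq_iff cos_diff)
    also have "\<dots> = of_real (LINT p|L. cos (s * fst p + t * snd p + 0)) + \<i> * of_real (LINT p|L. cos (s * fst p + t * snd p + - (pi / 2)))"
      using i[OF L fL, of s t 0] i[OF L fL, of s t "- (pi/2)"]
      by (subst Bochner_Integration.integral_add) (auto simp add: integral_complex_of_real)
    finally show ?thesis .
  qed
  show "char2 M s t = char2 N s t" for s t
    unfolding r[OF sets(1) fin(1)] r[OF sets(2) fin(2)] c ..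
qed

lemma integrable_mult_bounded:
  fixes f :: "'a \<Rightarrow> 'b::{real_normed_field, banach, second_countable_topology}"
  assumes "integrable M f" "g \<in> borel_measurable M" "\<And>x. norm (g x) \<le> B"
  shows "integrable M (\<lambda>x. g x * f x)"
proof (rule Bochner_Integration.integrable_bound)
  show "integrable M (\<lambda>x. B * norm (f x))" using assms(1) by simp
  show "(\<lambda>x. g x * f x) \<in> borel_measurable M" using assms by (intro borel_measurable_times) auto
  have "0 \<le> B" for x :: 'a using assms(3)[of x] norm_ge_zero order_trans by blast
  then show "AE x in M. norm (g x * f x) \<le> norm (B * norm (f x))"
    using assms(3) by (intro AE_I2) (auto simp: norm_mult abs_mult intro!: mult_mono)
qed

lemma finite_measure_density_integrable:
  fixes f :: "'a \<Rightarrow> real"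
  assumes "integrable M f" shows "finite_measure (density M (\<lambda>x. ennreal (f x)))"
proof (rule finite_measureI)
  have "(\<integral>\<^sup>+x. ennreal (f x) \<partial>M) \<le> (\<integral>\<^sup>+x. ennreal (norm (f x)) \<partial>M)"
    by (intro nn_integral_mono ennreal_leI) auto
  also have "\<dots> < \<infinity>" using assms by (simp add: integrable_iff_bounded)
  finally show "emeasure (density M (\<lambda>x. ennreal (f x))) (space (density M (\<lambda>x. ennreal (f x)))) \<noteq> \<infinity>"
    using assms by (simp add: emeasure_density)
qed

text \<open>The law is recovered from its complex density by writing the transform identity as an equality
  of transforms of the finite measures built from the positive and negative parts.\<close>

lemma char2_density:
  fixes P :: "real \<times> real \<Rightarrow> complex"
  assumes M: "prob_space M" and sets: "sets M = sets borel" and P: "integrable lborel P"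
    and eq: "\<And>s t. char2 M s t = (CLINT p|lborel. cis (s * fst p + t * snd p) * P p)"
  shows "AE p in lborel. Im (P p) = 0 \<and> Re (P p) \<ge> 0" and "M = density lborel (\<lambda>p. ennreal (Re (P p)))"
proof -
  interpret prob_space M by (rule M)
  have fM: "finite_measure M" by (rule finite_measure_axioms)
  have Pm [measurable]: "P \<in> borel_measurable borel" using borel_measurable_integrable[OF P] by simp
  have RP: "integrable lborel (\<lambda>p. Re (P p))" and IP: "integrable lborel (\<lambda>p. Im (P p))" using P by auto
  have iL: "integrable lborel (\<lambda>p. cis (s * fst p + t * snd p) * P p)" for s t
    by (rule integrable_mult_bounded[OF P, where B=1]) auto
  have iLc: "integrable lborel (\<lambda>p. cis (s * fst p + t * snd p) * of_real (g p))" if "integrable lborel g" for s t and g :: "real \<times> real \<Rightarrow> real"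
    by (rule integrable_mult_bounded[where B=1]) (use that in auto)
  have iM: "integrable M (\<lambda>p. cis (s * fst p + t * snd p))" for s t
    by (rule integrable_finite_bounded[OF fM, where B=1]) (auto simp: measurable_cong_sets[OF sets refl])
  \<comment> \<open>A law is real, so its transform is Hermitian; thus \<open>P\<close> and its
    conjugate have the same transform, and that of \<open>Im P\<close> vanishes.\<close>
  have conj: "(CLINT p|lborel. cis (s * fst p + t * snd p) * cnj (P p)) = char2 M s t" for s t
  proof -
    have "char2 M s t = cnj (char2 M (- s) (- t))"
      unfolding char2_def integral_bounded_linear[OF bounded_linear_cnj iM, symmetric] by (simp add: cis_cnj add.commute)
    also have "\<dots> = (CLINT p|lborel. cnj (cis (- s * fst p + - t * snd p) * P p))"
      unfolding eq by (rule integral_bounded_linear[OF bounded_linear_cnj iL, symmetric])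
    also have "\<dots> = (CLINT p|lborel. cis (s * fst p + t * snd p) * cnj (P p))"
      by (intro Bochner_Integration.integral_cong refl) (simp add: cis_cnj add.commute)
    finally show ?thesis ..
  qed
  have iLcnj: "integrable lborel (\<lambda>p. cis (s * fst p + t * snd p) * cnj (P p))" for s t
    by (rule integrable_mult_bounded[where B=1]) (use P in auto)
  have im0: "(CLINT p|lborel. cis (s * fst p + t * snd p) * of_real (Im (P p))) = 0" for s t
  proof -
    have "0 = (CLINT p|lborel. cis (s * fst p + t * snd p) * P p - cis (s * fst p + t * snd p) * cnj (P p))"
      using iL iLcnj conj eq by simp
    also have "\<dots> = (CLINT p|lborel. 2 * \<i> * (cis (s * fst p + t * snd p) * of_real (Im (P p))))"
      unfolding right_diff_distrib[symmetric] complex_diff_cnj by (intro Bochner_Integration.integral_cong refl) (simp add: mult_ac)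
    also have "\<dots> = 2 * \<i> * (CLINT p|lborel. cis (s * fst p + t * snd p) * of_real (Im (P p)))"
      by (rule integral_mult_right_zero)
    finally show ?thesis by simp
  qed
  have re: "(CLINT p|lborel. cis (s * fst p + t * snd p) * of_real (Re (P p))) = char2 M s t" for s t
  proof -
    have "char2 M s t = (CLINT p|lborel. cis (s * fst p + t * snd p) * of_real (Re (P p)) + \<i> * (cis (s * fst p + t * snd p) * of_real (Im (P p))))"
      unfolding eq by (intro Bochner_Integration.integral_cong refl) (simp add: complex_eq_iff)
    also have "\<dots> = (CLINT p|lborel. cis (s * fst p + t * snd p) * of_real (Re (P p)))"
      using iLc[OF RP] iLc[OF IP] by (simp add: im0)
    finally show ?thesis ..
  qed
  have cosint: "Re (cis \<phi> * (CLINT p|lborel. cis (s * fst p + t * snd p) * of_real (g p))) =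
      (LINT p|lborel. cos (s * fst p + t * snd p + \<phi>) * g p)" if g: "integrable lborel g" for s t \<phi> and g :: "real \<times> real \<Rightarrow> real"
  proof -
    have "cis \<phi> * (CLINT p|lborel. cis (s * fst p + t * snd p) * of_real (g p)) = (CLINT p|lborel. cis (s * fst p + t * snd p + \<phi>) * of_real (g p))"
      unfolding integral_mult_right_zero[symmetric] by (simp add: cis_mult mult.assoc[symmetric] add_ac)
    moreover have "integrable lborel (\<lambda>p. cis (s * fst p + t * snd p + \<phi>) * of_real (g p))"
      by (rule integrable_mult_bounded[where B=1]) (use g in auto)
    ultimately show ?thesis by (simp add: integral_Re[symmetric])
  qed
  have cosM: "Re (cis \<phi> * char2 M s t) = (LINT p|M. cos (s * fst p + t * snd p + \<phi>))" for s t \<phi>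
  proof -
    have "cis \<phi> * char2 M s t = (CLINT p|M. cis (s * fst p + t * snd p + \<phi>))"
      unfolding char2_def integral_mult_right_zero[symmetric] by (simp add: cis_mult add_ac)
    moreover have "integrable M (\<lambda>p. cis (s * fst p + t * snd p + \<phi>))"
      by (rule integrable_finite_bounded[OF fM, where B=1]) (auto simp: measurable_cong_sets[OF sets refl])
    ultimately show ?thesis by (simp add: integral_Re[symmetric])
  qed
  have nonneg: "1 + cos x \<ge> 0" for x :: real using cos_ge_minus_one[of x] by linarith
  have ic: "integrable lborel (\<lambda>p. (1 + cos (s * fst p + t * snd p + \<phi>)) * g p)" "integrable lborel (\<lambda>p. cos (s * fst p + t * snd p + \<phi>) * g p)"
    if g: "integrable lborel g" for s t \<phi> and g :: "real \<times> real \<Rightarrow> real"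
  proof -
    show "integrable lborel (\<lambda>p. cos (s * fst p + t * snd p + \<phi>) * g p)"
      by (rule integrable_mult_bounded[OF g, where B=1]) auto
    then show "integrable lborel (\<lambda>p. (1 + cos (s * fst p + t * snd p + \<phi>)) * g p)"
      using g by (simp add: distrib_right)
  qed
  have dens: "(\<integral>\<^sup>+p. ennreal (1 + cos (s * fst p + t * snd p + \<phi>)) \<partial>density lborel (\<lambda>p. ennreal (g p))) =
      ennreal (LINT p|lborel. (1 + cos (s * fst p + t * snd p + \<phi>)) * max 0 (g p))"
    if g: "integrable lborel g" for s t \<phi> and g :: "real \<times> real \<Rightarrow> real"
  proof -
    have [measurable]: "g \<in> borel_measurable borel" using g by auto
    have "integrable lborel (\<lambda>p. max 0 (g p))" using g by simp
    from ic(1)[OF this, of s t \<phi>] 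
    have "(\<integral>\<^sup>+p. ennreal ((1 + cos (s * fst p + t * snd p + \<phi>)) * max 0 (g p)) \<partial>lborel) =
       ennreal (LINT p|lborel. (1 + cos (s * fst p + t * snd p + \<phi>)) * max 0 (g p))"
      using nonneg by (intro nn_integral_eq_integral) auto
    moreover have "(\<integral>\<^sup>+p. ennreal (1 + cos (s * fst p + t * snd p + \<phi>)) \<partial>density lborel (\<lambda>p. ennreal (g p))) =
        (\<integral>\<^sup>+p. ennreal ((1 + cos (s * fst p + t * snd p + \<phi>)) * max 0 (g p)) \<partial>lborel)"
      using nonneg by (subst nn_integral_density) (auto simp: ennreal_mult mult.commute ennreal_max_0 intro!: nn_integral_cong)
    ultimately show ?thesis by simp
  qed
  have split: "(LINT p|lborel. (1 + cos (s * fst p + t * snd p + \<phi>)) * max 0 (g p)) - (LINT p|lborel. (1 + cos (s * fst p + t * snd p + \<phi>)) * max 0 (- g p))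
      = (LINT p|lborel. g p) + (LINT p|lborel. cos (s * fst p + t * snd p + \<phi>) * g p)"
    if g: "integrable lborel g" for s t \<phi> and g :: "real \<times> real \<Rightarrow> real"
  proof -
    have m: "integrable lborel (\<lambda>p. max 0 (g p))" "integrable lborel (\<lambda>p. max 0 (- g p))" using g by auto
    have "(LINT p|lborel. (1 + cos (s * fst p + t * snd p + \<phi>)) * max 0 (g p)) - (LINT p|lborel. (1 + cos (s * fst p + t * snd p + \<phi>)) * max 0 (- g p))
      = (LINT p|lborel. (1 + cos (s * fst p + t * snd p + \<phi>)) * max 0 (g p) - (1 + cos (s * fst p + t * snd p + \<phi>)) * max 0 (- g p))"
      using ic(1)[OF m(1)] ic(1)[OF m(2)] by simp
    also have "\<dots> = (LINT p|lborel. g p + cos (s * fst p + t * snd p + \<phi>) * g p)"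
      by (intro Bochner_Integration.integral_cong refl) (auto simp: max_def algebra_simps)
    also have "\<dots> = (LINT p|lborel. g p) + (LINT p|lborel. cos (s * fst p + t * snd p + \<phi>) * g p)"
      using g ic(2)[OF g] by simp
    finally show ?thesis .
  qed
  have i0: "(LINT p|lborel. g p) = Re (CLINT p|lborel. cis (0 * fst p + 0 * snd p) * of_real (g p))" if "integrable lborel g" for g :: "real \<times> real \<Rightarrow> real"
    using that by (simp add: integral_complex_of_real)
  \<comment> \<open>\<open>ennreal\<close> sends negative numbers to 0, so these are the positive
    and the negative part of \<open>Im P\<close>. Having equal transforms they coincide, and a
    number with equal positive and negative part is 0.\<close>
  have D: "density lborel (\<lambda>p. ennreal (Im (P p))) = density lborel (\<lambda>p. ennreal (- Im (P p)))"
  proof (rule char2_eqI)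
    fix s t \<phi>
    have "(LINT p|lborel. Im (P p)) = 0" using i0[OF IP] im0[of 0 0] by simp
    moreover have "(LINT p|lborel. cos (s * fst p + t * snd p + \<phi>) * Im (P p)) = 0"
      using cosint[OF IP, of \<phi> s t] im0 by simp
    ultimately show "(\<integral>\<^sup>+p. ennreal (1 + cos (s * fst p + t * snd p + \<phi>)) \<partial>density lborel (\<lambda>p. ennreal (Im (P p)))) =
      (\<integral>\<^sup>+p. ennreal (1 + cos (s * fst p + t * snd p + \<phi>)) \<partial>density lborel (\<lambda>p. ennreal (- Im (P p))))"
      using split[OF IP, of s t \<phi>] IP by (simp add: dens)
  qed (use finite_measure_density_integrable[OF IP]
      finite_measure_density_integrable[OF Bochner_Integration.integrable_minus[OF IP]] in auto)
  have "AE p in lborel. ennreal (Im (P p)) = ennreal (- Im (P p))"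
    by (rule sigma_finite_measure.density_unique[OF sigma_finite_lborel _ _ D]) auto
  then have imAE: "AE p in lborel. Im (P p) = 0"
  proof eventually_elim
    case (elim p)
    then show ?case by (cases "Im (P p) \<ge> 0") (simp_all add: ennreal_neg)
  qed
  let ?T = "density lborel (\<lambda>p. ennreal (Re (P p)))" and ?S = "density lborel (\<lambda>p. ennreal (- Re (P p)))"
  have fT: "finite_measure ?T" "finite_measure ?S" using finite_measure_density_integrable[OF RP]
      finite_measure_density_integrable[OF Bochner_Integration.integrable_minus[OF RP]] by auto
  have mass: "(LINT p|lborel. Re (P p)) = 1"
    using i0[OF RP] unfolding re by (simp add: char2_def prob_space)
  \<comment> \<open>\<open>?T\<close> and \<open>?S\<close> are the positive and the negative part
    of \<open>Re P\<close>; the transform identity reads \<open>M = ?T - ?S\<close>, rearranged here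
    into a sum.\<close>
  have D2: "sum_measure M ?S = ?T"
  proof (rule char2_eqI)
    show "finite_measure (sum_measure M ?S)"
      using emeasure_finite fT(2) sets_eq_imp_space_eq[OF sets]
      by (intro finite_measureI) (simp add: emeasure_sum_measure sets finite_measure.emeasure_finite)
    fix s t \<phi>
    let ?c = "\<lambda>p :: real \<times> real. 1 + cos (s * fst p + t * snd p + \<phi>)"
    have cm: "(\<lambda>p. ennreal (?c p)) \<in> borel_measurable M" by (simp add: measurable_cong_sets[OF sets refl])
    have int: "integrable M (\<lambda>p. cos (s * fst p + t * snd p + \<phi>))"
      by (rule integrable_finite_bounded[OF fM, where B=1]) (auto simp: measurable_cong_sets[OF sets refl])
    have e1: "(\<integral>\<^sup>+p. ennreal (?c p) \<partial>M) = ennreal (LINT p|M. ?c p)"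
      using int nonneg by (intro nn_integral_eq_integral) auto
    have "(LINT p|M. ?c p) = (LINT p|lborel. ?c p * max 0 (Re (P p))) - (LINT p|lborel. ?c p * max 0 (- Re (P p)))"
      using int cosM[of \<phi> s t] cosint[OF RP, of \<phi> s t] mass split[OF RP, of s t \<phi>] by (simp add: re prob_space)
    then have e2: "(LINT p|M. ?c p) + (LINT p|lborel. ?c p * max 0 (- Re (P p))) = (LINT p|lborel. ?c p * max 0 (Re (P p)))"
      by linarith
    have "(LINT p|M. ?c p) \<ge> 0" "(LINT p|lborel. ?c p * max 0 (- Re (P p))) \<ge> 0"
      using nonneg by (intro Bochner_Integration.integral_nonneg; simp)+
    then have "(\<integral>\<^sup>+p. ennreal (?c p) \<partial>M) + ennreal (LINT p|lborel. ?c p * max 0 (- Re (P p))) = ennreal (LINT p|lborel. ?c p * max 0 (Re (P p)))"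
      unfolding e1 e2[symmetric] by (rule ennreal_plus[symmetric])
    then show "(\<integral>\<^sup>+p. ennreal (?c p) \<partial>sum_measure M ?S) = (\<integral>\<^sup>+p. ennreal (?c p) \<partial>?T)"
      using RP by (subst nn_integral_sum_measure[OF _ cm]) (simp_all add: sets dens)
  qed (use fT sets in auto)
  have add: "emeasure M A + emeasure ?S A = emeasure ?T A" if "A \<in> Sigma_Algebra.sets borel" for A
    using arg_cong[OF D2, of "\<lambda>L. emeasure L A"] that sets by (simp add: emeasure_sum_measure)
  \<comment> \<open>The positive part gives this set mass 0. By additivity the negative part, which
    is carried by it, has mass 0 there too.\<close>
  let ?A = "{p. Re (P p) < 0}"
  have A [measurable]: "?A \<in> Sigma_Algebra.sets borel" by measurable
  have "emeasure ?T ?A = 0"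
    by (subst emeasure_density) (auto simp: nn_integral_0_iff_AE indicator_def ennreal_neg)
  then have "emeasure ?S ?A = 0" using add[OF A] by simp
  then have "AE p in lborel. ennreal (- Re (P p)) * indicator ?A p = 0"
    by (subst (asm) emeasure_density) (auto simp: nn_integral_0_iff_AE)
  then have reAE: "AE p in lborel. Re (P p) \<ge> 0"
    by eventually_elim (auto simp: indicator_def ennreal_eq_0_iff split: if_splits)
  show "AE p in lborel. Im (P p) = 0 \<and> Re (P p) \<ge> 0" using imAE reAE by eventually_elim auto
  have "emeasure ?S B = 0" if [measurable]: "B \<in> Sigma_Algebra.sets borel" for B
  proof -
    have "AE p in lborel. ennreal (- Re (P p)) * indicator B p = 0"
      using reAE by eventually_elim (simp add: ennreal_neg)
    then show ?thesis by (subst emeasure_density) (auto simp: nn_integral_0_iff_AE)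
  qed
  then show "M = ?T" using add sets by (intro measure_eqI) auto
qed

section \<open>Two-sided Laplace integrals\<close>

lemma lborel_product_integral:
  fixes f g :: "real \<Rightarrow> 'b::{real_normed_field, banach, second_countable_topology}"
  assumes f: "integrable lborel f" and g: "integrable lborel g"
  shows "integrable lborel (\<lambda>q. f (fst q) * g (snd q))"
    and "(LINT q|lborel. f (fst q) * g (snd q)) = (LINT x|lborel. f x) * (LINT y|lborel. g y)"
proof -
  have [measurable]: "f \<in> borel_measurable borel" "g \<in> borel_measurable borel"
    using borel_measurable_integrable[OF f] borel_measurable_integrable[OF g] by auto
  have i: "integrable (lborel \<Otimes>\<^sub>M lborel) (\<lambda>q. f (fst q) * g (snd q))"
  proof (rule lborel_pair.Fubini_integrable)
    show "integrable lborel (\<lambda>x. LINT y|lborel. norm (f (fst (x, y)) * g (snd (x, y))))"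
      using f by (simp add: norm_mult)
  qed (use g in auto)
  then show "integrable lborel (\<lambda>q. f (fst q) * g (snd q))" by (simp add: lborel_prod)
  have "(LINT x|lborel. LINT y|lborel. f (fst (x, y)) * g (snd (x, y))) = (LINT q|(lborel \<Otimes>\<^sub>M lborel). f (fst q) * g (snd q))"
    by (rule lborel_pair.integral_fst'[OF i])
  then show "(LINT q|lborel. f (fst q) * g (snd q)) = (LINT x|lborel. f x) * (LINT y|lborel. g y)"
    by (simp add: lborel_prod)
qed

text \<open>Euler's integral for \<open>Gamma\<close> after the substitution
  \<open>t = c * exp x\<close>, which maps the real line onto the positive axis.\<close>

lemma Gamma_exp_integral:
  assumes s: "Re s > 0" and c: "c > 0"
  shows "integrable lborel (\<lambda>x. exp (s * of_real x) * of_real (exp (- c * exp x)))"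
    and "(LINT x|lborel. exp (s * of_real x) * of_real (exp (- c * exp x))) = Gamma s * inv_power c s"
proof -
  let ?f = "\<lambda>t. of_real t powr (s - 1) / of_real (exp t) :: complex"
  let ?g = "\<lambda>x. c * exp x"
  let ?h = "\<lambda>x. exp (s * of_real x) * of_real (exp (- c * exp x)) :: complex"
  have img: "range ?g = {0<..}"
  proof
    show "{0<..} \<subseteq> range ?g"
    proof
      fix y :: real assume "y \<in> {0<..}"
      then have "y = ?g (ln (y / c))" using c by simp
      then show "y \<in> range ?g" by (rule range_eqI)
    qed
  qed (use c in auto)
  have "((\<lambda>x. \<bar>c * exp x\<bar> *\<^sub>R ?f (?g x)) absolutely_integrable_on UNIV \<and>
      integral UNIV (\<lambda>x. \<bar>c * exp x\<bar> *\<^sub>R ?f (?g x)) = Gamma s) =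
     (?f absolutely_integrable_on range ?g \<and> integral (range ?g) ?f = Gamma s)"
    by (rule has_absolute_integral_change_of_variables_real)
       (use c in \<open>auto intro!: derivative_eq_intros injI\<close>)
  also have "\<dots>"
    unfolding img using absolutely_integrable_Gamma_integral'[OF s] Gamma_integral_complex'[OF s]
    by (auto simp: integral_unique)
  finally have I: "(\<lambda>x. \<bar>c * exp x\<bar> *\<^sub>R ?f (?g x)) absolutely_integrable_on UNIV"
      "integral UNIV (\<lambda>x. \<bar>c * exp x\<bar> *\<^sub>R ?f (?g x)) = Gamma s" by auto
  have eq: "\<bar>c * exp x\<bar> *\<^sub>R ?f (?g x) = exp (s * of_real (ln c)) * ?h x" for x
  proof -
    have "of_real (c * exp x) powr (s - 1) = exp ((s - 1) * of_real (ln c + x))"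
    proof -
      have "complex_of_real y powr w = exp (w * of_real (ln y))" if "y > 0" for y w
        using that by (simp add: powr_def Ln_of_real)
      from this[of "c * exp x" "s - 1"] show ?thesis using c by (simp add: ln_mult)
    qed
    moreover have "complex_of_real \<bar>c * exp x\<bar> = exp (of_real (ln c + x))"
      using c unfolding exp_of_real by (simp add: exp_add)
    ultimately have "\<bar>c * exp x\<bar> *\<^sub>R ?f (?g x) = exp (of_real (ln c + x)) * exp ((s - 1) * of_real (ln c + x)) / of_real (exp (c * exp x))"
      by (simp add: scaleR_conv_of_real)
    also have "exp (of_real (ln c + x)) * exp ((s - 1) * of_real (ln c + x)) = exp (s * of_real (ln c)) * exp (s * of_real x)"
      unfolding exp_add[symmetric] by (simp add: algebra_simps)
    finally show ?thesis by (simp add: exp_minus divide_inverse mult_ac)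
  qed
  have "integrable lebesgue (\<lambda>x. exp (s * of_real (ln c)) * ?h x)"
    using I(1) unfolding eq by (simp add: set_integrable_def)
  then have "integrable lebesgue (\<lambda>x. exp (- (s * of_real (ln c))) * (exp (s * of_real (ln c)) * ?h x))"
    by (rule integrable_mult_right)
  then have L: "integrable lebesgue ?h"
    unfolding mult.assoc[symmetric, of "exp (- _)"] exp_add[symmetric] by simp
  have hm: "?h \<in> borel_measurable lborel" 
    by (simp add: borel_measurable_continuous_onI continuous_intros)
  show i: "integrable lborel ?h" using L hm by (simp add: integrable_completion)
  have "exp (s * of_real (ln c)) * (LINT x|lborel. ?h x) = (LINT x|lebesgue. exp (s * of_real (ln c)) * ?h x)"
    using hm by (simp add: integral_completion)
  also have "\<dots> = integral UNIV (\<lambda>x. exp (s * of_real (ln c)) * ?h x)"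
    using set_lebesgue_integral_eq_integral(2)[OF I(1)[unfolded eq]] by (simp add: set_lebesgue_integral_def)
  also have "\<dots> = Gamma s" using I(2) unfolding eq .
  finally show "(LINT x|lborel. ?h x) = Gamma s * inv_power c s"
    by (simp add: inv_power_def exp_minus field_simps)
qed

lemma Gamma_exp_integral_real:
  fixes \<sigma> c :: real
  assumes s: "\<sigma> > 0" and c: "c > 0"
  shows "integrable lborel (\<lambda>x. exp (\<sigma> * x) * exp (- c * exp x))"
    and "(LINT x|lborel. exp (\<sigma> * x) * exp (- c * exp x)) = Gamma \<sigma> * c powr - \<sigma>"
proof -
  have eq: "exp (of_real \<sigma> * of_real x) * of_real (exp (- c * exp x)) = complex_of_real (exp (\<sigma> * x) * exp (- c * exp x))" for x
    by (simp add: exp_of_real[symmetric])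
  have i: "integrable lborel (\<lambda>x. complex_of_real (exp (\<sigma> * x) * exp (- c * exp x)))"
    "(LINT x|lborel. complex_of_real (exp (\<sigma> * x) * exp (- c * exp x))) = Gamma (of_real \<sigma>) * inv_power c (of_real \<sigma>)"
    using Gamma_exp_integral[of "of_real \<sigma>" c] s c unfolding eq by auto
  show "integrable lborel (\<lambda>x. exp (\<sigma> * x) * exp (- c * exp x))"
    using i(1) by (simp only: complex_of_real_integrable_eq)
  have "inv_power c (of_real \<sigma>) = of_real (c powr - \<sigma>)"
    using c by (simp add: inv_power_def powr_def exp_of_real[symmetric])
  then have "complex_of_real (LINT x|lborel. exp (\<sigma> * x) * exp (- c * exp x)) = of_real (Gamma \<sigma> * c powr - \<sigma>)"
    using i(2) unfolding integral_complex_of_real by (simp add: Gamma_complex_of_real)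
  then show "(LINT x|lborel. exp (\<sigma> * x) * exp (- c * exp x)) = Gamma \<sigma> * c powr - \<sigma>"
    by (simp only: of_real_eq_iff)
qed

definition laplace2 :: "(real \<times> real \<Rightarrow> complex) \<Rightarrow> complex \<times> complex \<Rightarrow> complex" where
  "laplace2 k p = (LINT q|lborel. exp (fst p * of_real (fst q) + snd p * of_real (snd q)) * k q)"

definition laplace2_conv :: "(real \<times> real \<Rightarrow> complex) \<Rightarrow> real \<Rightarrow> real \<Rightarrow> bool" where
  "laplace2_conv k \<sigma>1 \<sigma>2 \<longleftrightarrow> integrable lborel (\<lambda>q. exp (\<sigma>1 * fst q + \<sigma>2 * snd q) * norm (k q))"

lemma exp_interval_le: "\<bar>x - x0\<bar> \<le> d \<Longrightarrow> exp (x * u) \<le> exp ((x0 + - d) * u) + exp ((x0 + d) * (u::real))"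
proof (cases "u \<ge> 0")
  case True
  assume "\<bar>x - x0\<bar> \<le> d"
  then have "exp (x * u) \<le> exp ((x0 + d) * u)" using True by (auto intro: mult_right_mono)
  then show ?thesis by (simp add: add_increasing)
next
  case False
  assume "\<bar>x - x0\<bar> \<le> d"
  then have "exp (x * u) \<le> exp ((x0 + - d) * u)" using False by (auto intro: mult_right_mono_neg)
  then show ?thesis by (simp add: add_increasing2)
qed

text \<open>On a small square of exponents an exponential is bounded by the sum of its values at the
  four corners, and there the integral converges by hypothesis. This is the local majorant.\<close>

lemma holo2_laplace2:
  assumes U: "open U" and k [measurable]: "k \<in> borel_measurable borel"
    and conv: "\<And>s1 s2. (s1, s2) \<in> U \<Longrightarrow> laplace2_conv k (Re s1) (Re s2)"
  shows "holo2 (laplace2 k) U"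
  unfolding laplace2_def
proof (rule holo2_LINT[OF U])
  fix p assume p: "p \<in> U"
  have "continuous_on UNIV (\<lambda>q::real \<times> real. exp (fst p * of_real (fst q) + snd p * of_real (snd q)))"
    by (intro continuous_intros)
  then have [measurable]: "(\<lambda>q::real \<times> real. exp (fst p * of_real (fst q) + snd p * of_real (snd q))) \<in> borel_measurable borel"
    by (rule borel_measurable_continuous_onI)
  show "(\<lambda>q. exp (fst p * of_real (fst q) + snd p * of_real (snd q)) * k q) \<in> borel_measurable lborel"
    by simp
  obtain r where r: "r > 0" "ball p r \<subseteq> U" using U p by (meson open_contains_ball)
  let ?x = "Re (fst p)" and ?y = "Re (snd p)" and ?d = "r / 2"
  \<comment> \<open>With side offsets \<open>r / 2\<close> the corners are at distance
    \<open>r / sqrt 2 < r\<close> from \<open>p\<close>, hence inside \<open>U\<close>.\<close>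
  have corner: "laplace2_conv k (?x + e1) (?y + e2)" if "\<bar>e1\<bar> = ?d" "\<bar>e2\<bar> = ?d" for e1 e2
  proof -
    have "dist p (fst p + of_real e1, snd p + of_real e2) = sqrt (e1\<^sup>2 + e2\<^sup>2)"
      by (simp add: dist_prod_def dist_norm)
    also have "e1\<^sup>2 + e2\<^sup>2 = r\<^sup>2 / 2"
    proof -
      have "e1\<^sup>2 = (r / 2)\<^sup>2" unfolding that(1)[symmetric] by simp
      moreover have "e2\<^sup>2 = (r / 2)\<^sup>2" unfolding that(2)[symmetric] by simp
      ultimately have e: "e1\<^sup>2 = (r / 2)\<^sup>2" "e2\<^sup>2 = (r / 2)\<^sup>2" .
      show ?thesis unfolding e by (simp add: power_divide)
    qed
    also have "sqrt (r\<^sup>2 / 2) < sqrt (r\<^sup>2)" using r by (intro real_sqrt_less_mono) auto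
    finally have "(fst p + of_real e1, snd p + of_real e2) \<in> U" using r by auto
    from conv[OF this] show ?thesis by simp
  qed
  let ?W = "\<lambda>q. (exp ((?x + - ?d) * fst q) + exp ((?x + ?d) * fst q)) * (exp ((?y + - ?d) * snd q) + exp ((?y + ?d) * snd q)) * norm (k q)"
  have W: "integrable lborel ?W"
  proof -
    have "integrable lborel (\<lambda>q. exp ((?x + e1) * fst q + (?y + e2) * snd q) * norm (k q))" if "\<bar>e1\<bar> = ?d" "\<bar>e2\<bar> = ?d" for e1 e2
      using corner[OF that] by (simp add: laplace2_conv_def)
    note conv4 = this
    have alg: "(a + b) * (c + d) * n = a * c * n + a * d * n + b * c * n + b * d * n" for a b c d n :: real
      by (simp add: algebra_simps)
    show ?thesis
      unfolding alg exp_add[symmetric] using r by (intro Bochner_Integration.integrable_add conv4) auto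
  qed
  have "norm (exp (fst q * of_real (fst t) + snd q * of_real (snd t)) * k t) \<le> ?W t" if "q \<in> ball p ?d" for q t
  proof -
    have "\<bar>Re (fst q) - ?x\<bar> \<le> ?d" "\<bar>Re (snd q) - ?y\<bar> \<le> ?d"
      using that dist_fst_le[of p q] dist_snd_le[of p q] abs_Re_le_cmod[of "fst q - fst p"] abs_Re_le_cmod[of "snd q - snd p"]
      by (auto simp: dist_norm norm_minus_commute)
    then have "exp (Re (fst q) * fst t) * exp (Re (snd q) * snd t) \<le> 
        (exp ((?x + - ?d) * fst t) + exp ((?x + ?d) * fst t)) * (exp ((?y + - ?d) * snd t) + exp ((?y + ?d) * snd t))"
      by (intro mult_mono exp_interval_le) (auto intro: add_nonneg_nonneg)
    then show ?thesis by (simp add: norm_mult norm_exp_eq_Re exp_add[symmetric] mult_right_mono)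
  qed
  then show "\<exists>r>0. \<exists>w. integrable lborel w \<and> (\<forall>q\<in>ball p r \<inter> U. \<forall>t\<in>space lborel.
       norm (exp (fst q * of_real (fst t) + snd q * of_real (snd t)) * k t) \<le> w t)"
    using W r by (intro exI[of _ ?d] conjI exI[of _ ?W]) auto
next
  fix t :: "real \<times> real"
  have "holo2 (\<lambda>p. fst p * of_real (fst t) + snd p * of_real (snd t)) U"
    using U by (intro holo2_add holo2_mult holo2_fst holo2_snd holo2_const)
  then have "holo2 (\<lambda>p. exp (fst p * of_real (fst t) + snd p * of_real (snd t))) U"
    by (rule holo2_compose) (auto intro: holomorphic_intros)
  then show "holo2 (\<lambda>p. exp (fst p * of_real (fst t) + snd p * of_real (snd t)) * k t) U"
    using U by (intro holo2_mult holo2_const)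
qed

section \<open>The kernel of the double series\<close>

definition lerch_kernel :: "real \<Rightarrow> complex \<Rightarrow> complex \<Rightarrow> real \<times> real \<Rightarrow> complex" where
  "lerch_kernel a z1 z2 q = of_real (exp ((1 - a) * (exp (fst q) + exp (snd q)))) /
     ((of_real (exp (exp (snd q))) - z2) * (of_real (exp (exp (fst q) + exp (snd q))) - z1))"

lemma lerch_kernel_measurable [measurable]: "lerch_kernel a z1 z2 \<in> borel_measurable borel"
  unfolding lerch_kernel_def by measurable

lemma inv_power_of_real: "x > 0 \<Longrightarrow> inv_power x (of_real \<sigma>) = of_real (x powr - \<sigma>)"
  by (simp add: inv_power_def powr_def exp_of_real[symmetric])

lemma lerch_sum_1_of_real:
  assumes "c > 0" "\<sigma> > 1"
  shows "lerch_sum 1 (of_real \<sigma>) c = of_real (\<Sum>n. (real n + c) powr - \<sigma>)"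
proof -
  have "lerch_sum 1 (of_real \<sigma>) c = (\<Sum>n. of_real ((real n + c) powr - \<sigma>))"
    unfolding lerch_sum_def using assms by (simp add: inv_power_of_real add_nonneg_pos)
  also have "\<dots> = of_real (\<Sum>n. (real n + c) powr - \<sigma>)"
    using assms by (intro suminf_of_real[symmetric] summable_shift_powr)
  finally show ?thesis .
qed

text \<open>Pulling the exponentials out of both denominators exhibits the kernel as a product of
  two geometric series. Their ratios are strictly below 1 in modulus even for
  \<open>norm z = 1\<close>, because the exponentials are.\<close>

lemma lerch_kernel_geometric:
  assumes z: "norm z1 \<le> 1" "norm z2 \<le> 1"
  defines "r1 \<equiv> \<lambda>q. z1 * of_real (exp (- (exp (fst q) + exp (snd q))))"
    and "r2 \<equiv> \<lambda>q :: real \<times> real. z2 * of_real (exp (- exp (snd q)))"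
  shows "norm (r1 q) < 1" "norm (r2 q) < 1"
    and "lerch_kernel a z1 z2 q = of_real (exp (- a * exp (fst q)) * exp (- (1 + a) * exp (snd q))) / ((1 - r2 q) * (1 - r1 q))"
proof -
  have "norm (r1 q) \<le> 1 * exp (- (exp (fst q) + exp (snd q)))" 
    unfolding r1_def norm_mult using z by (intro mult_mono) auto
  also have "\<dots> < 1" using add_pos_pos[OF exp_gt_zero[of "fst q"] exp_gt_zero[of "snd q"]] by simp
  finally show "norm (r1 q) < 1" .
  have "norm (r2 q) \<le> 1 * exp (- exp (snd q))" unfolding r2_def norm_mult using z by (intro mult_mono) auto
  also have "\<dots> < 1" by simp
  finally show "norm (r2 q) < 1" .
  let ?x = "exp (fst q)" and ?y = "exp (snd q)"
  have 1: "of_real (exp ?y) - z2 = of_real (exp ?y) * (1 - r2 q)"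
    by (simp add: r2_def algebra_simps exp_minus)
  have 2: "of_real (exp (?x + ?y)) - z1 = of_real (exp (?x + ?y)) * (1 - r1 q)"
    unfolding r1_def right_diff_distrib mult.left_commute[of _ z1] of_real_mult[symmetric] exp_add[symmetric] by simp
  have 3: "exp ((1 - a) * (?x + ?y)) = exp (- a * ?x) * exp (- (1 + a) * ?y) * (exp ?y * exp (?x + ?y))"
    unfolding exp_add[symmetric] by (simp add: algebra_simps)
  show "lerch_kernel a z1 z2 q = of_real (exp (- a * ?x) * exp (- (1 + a) * ?y)) / ((1 - r2 q) * (1 - r1 q))"
    unfolding lerch_kernel_def 1 2 3 of_real_mult by (simp add: divide_simps del: of_real_add)
qed

text \<open>Expanding both geometric series gives terms with weight \<open>m + a\<close> on
  \<open>exp (fst q)\<close> and \<open>m + n + 1 + a\<close> on \<open>exp (snd q)\<close>; each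
  integrates to a product of two Gamma integrals. Two exchanges of sum and integral are justified by
  summing the integrals of the norms.\<close>

lemma Phi2_series_eq_laplace2:
  assumes a: "0 < a" "a \<le> 1" and z: "norm z1 \<le> 1" "norm z2 \<le> 1" and s: "(s1, s2) \<in> Phi2_acr"
  shows "Gamma s1 * Gamma s2 * Phi2_series s1 s2 a z1 z2 = laplace2 (lerch_kernel a z1 z2) (s1, s2)"
proof -
  have s1: "Re s1 > 0" and s2: "Re s2 > 1" and s12: "Re (s1 + s2) > 2" using s by (auto simp: Phi2_acr_def)
  obtain \<epsilon> where e: "\<epsilon> > 0" "1 + \<epsilon> \<le> Re s2" "Re (s1 + s2) - 1 - \<epsilon> > 1"
    using Phi2_strip_0_epsilon[of "(s1, s2)"] s Phi2_acr_subset_strip[of 0] by auto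
  let ?f = "\<lambda>m x. exp (s1 * of_real x) * of_real (exp (- (real m + a) * exp x)) :: complex"
  let ?c = "\<lambda>m n. real n + (real m + (a + 1))"
  let ?g = "\<lambda>m n y. exp (s2 * of_real y) * of_real (exp (- ?c m n * exp y)) :: complex"
  let ?t = "\<lambda>m n q. z1 ^ m * z2 ^ n * (?f m (fst q) * ?g m n (snd q))"
  define T where "T m n q = ?t m n q" for m n q
  let ?w = "\<lambda>m n. Gamma (Re s1) * (real m + a) powr - Re s1 * (Gamma (Re s2) * ?c m n powr - Re s2)"
  let ?Gm = "Gamma (Re s1) * Gamma (Re s2)"
  have c: "real m + a > 0" "?c m n > 0" for m n using a by (auto intro: add_nonneg_pos)
  have Gpos: "Gamma (Re s1) \<ge> 0" "Gamma (Re s2) \<ge> 0" using s1 s2 by (auto intro: less_imp_le Gamma_real_pos)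
  have f: "integrable lborel (?f m)" "(LINT x|lborel. ?f m x) = Gamma s1 * inv_power (real m + a) s1" for m
    using Gamma_exp_integral[OF s1 c(1)] by auto
  have g: "integrable lborel (?g m n)" "(LINT x|lborel. ?g m n x) = Gamma s2 * inv_power (?c m n) s2" for m n
    using Gamma_exp_integral[of s2 "?c m n"] c s2 by auto
  have t: "integrable lborel (T m n)"
    "(LINT q|lborel. T m n q) = z1 ^ m * z2 ^ n * (Gamma s1 * inv_power (real m + a) s1 * (Gamma s2 * inv_power (?c m n) s2))" for m n
  proof -
    note I = lborel_product_integral[OF f(1)[of m] g(1)[where m = m and n = n]]
    show "integrable lborel (T m n)" unfolding T_def by (rule integrable_mult_right, rule I(1))
    show "(LINT q|lborel. T m n q) = z1 ^ m * z2 ^ n * (Gamma s1 * inv_power (real m + a) s1 * (Gamma s2 * inv_power (?c m n) s2))"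
      unfolding T_def integral_mult_right_zero I(2) f(2) g(2) ..
  qed
  have tn: "(LINT q|lborel. norm (T m n q)) \<le> ?w m n" for m n
  proof -
    let ?F = "\<lambda>x. exp (Re s1 * x) * exp (- (real m + a) * exp x)" and ?G = "\<lambda>y. exp (Re s2 * y) * exp (- ?c m n * exp y)"
    have F: "integrable lborel ?F" "(LINT x|lborel. ?F x) = Gamma (Re s1) * (real m + a) powr - Re s1"
      and G: "integrable lborel ?G" "(LINT x|lborel. ?G x) = Gamma (Re s2) * ?c m n powr - Re s2"
      using Gamma_exp_integral_real[OF s1 c(1)] Gamma_exp_integral_real[of "Re s2" "?c m n"] s2 c by auto
    have "norm (T m n q) \<le> ?F (fst q) * ?G (snd q)" for q
    proof -
      have "norm (T m n q) = norm z1 ^ m * norm z2 ^ n * (?F (fst q) * ?G (snd q))"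
        by (simp add: T_def norm_mult norm_power norm_exp_eq_Re)
      also have "\<dots> \<le> 1 * (?F (fst q) * ?G (snd q))"
        using z by (intro mult_right_mono mult_le_one power_le_one) auto
      finally show ?thesis by simp
    qed
    then have "(LINT q|lborel. norm (T m n q)) \<le> (LINT q|lborel. ?F (fst q) * ?G (snd q))"
      using lborel_product_integral(1)[OF F(1) G(1)] t(1) by (intro integral_mono) auto
    also have "\<dots> = ?w m n" unfolding lborel_product_integral(2)[OF F(1) G(1)] F(2) G(2) ..
    finally show ?thesis .
  qed
  have w: "summable (?w m)" for m
    using summable_shift_powr[of "real m + (a + 1)" "Re s2"] a s2 by (intro summable_mult) auto
  define A where "A m q = T m 0 q" for m q
  define B where "B q = T 0 0 q" for q
  \<comment> \<open>Terms are geometric in \<open>n\<close> with first term \<open>A m\<close>, and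
    the \<open>A m\<close> are geometric in \<open>m\<close> with first term
    \<open>B\<close>.\<close>
  have t_eq: "T m n q = A m q * (z2 * of_real (exp (- exp (snd q)))) ^ n" for m n q
    unfolding A_def T_def by (simp add: power_mult_distrib exp_add[symmetric] exp_of_nat_mult[symmetric] algebra_simps flip: of_real_power of_real_mult)
  have t_eq0: "A m q = B q * (z1 * of_real (exp (- (exp (fst q) + exp (snd q))))) ^ m" for m q
    unfolding A_def B_def T_def by (simp add: power_mult_distrib exp_add[symmetric] exp_of_nat_mult[symmetric] algebra_simps flip: of_real_power of_real_mult)
  note geo = lerch_kernel_geometric[OF z]
  have norm_sum: "summable (\<lambda>n. norm (T m n q))" for m q
    unfolding t_eq[of m _ q] norm_mult norm_power using geo(2)[of q]
    by (intro summable_mult summable_geometric) (simp add: norm_mult)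
  have tsum: "(\<Sum>n. T m n q) = A m q / (1 - z2 * of_real (exp (- exp (snd q))))" for m q
  proof -
    have "(\<lambda>n. A m q * (z2 * of_real (exp (- exp (snd q)))) ^ n) sums (A m q * (1 / (1 - z2 * of_real (exp (- exp (snd q))))))"
      by (intro sums_mult geometric_sums geo(2))
    then show ?thesis unfolding t_eq[symmetric] by (simp add: sums_iff)
  qed
  have tn_sum: "summable (\<lambda>n. LINT q|lborel. norm (T m n q))" for m
    by (rule summable_comparison_test'[OF w[of m]]) (use tn in \<open>auto simp: Bochner_Integration.integral_nonneg\<close>)
  have ui: "integrable lborel (\<lambda>q. \<Sum>n. T m n q)" and uI: "(LINT q|lborel. (\<Sum>n. T m n q)) = (\<Sum>n. LINT q|lborel. T m n q)" for m
    using t(1) norm_sum tn_sum by (auto intro!: integrable_suminf integral_suminf)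
  have un: "(LINT q|lborel. norm (\<Sum>n. T m n q)) \<le> (\<Sum>n. ?w m n)" for m
  proof -
    have "(LINT q|lborel. norm (\<Sum>n. T m n q)) \<le> (LINT q|lborel. (\<Sum>n. norm (T m n q)))"
      using ui t(1) norm_sum tn_sum
      by (intro integral_mono summable_norm integrable_norm integrable_suminf) auto
    also have "\<dots> = (\<Sum>n. LINT q|lborel. norm (T m n q))"
      using t(1) norm_sum tn_sum by (intro integral_suminf) auto
    also have "\<dots> \<le> (\<Sum>n. ?w m n)" using tn w tn_sum by (intro suminf_le)
    finally show ?thesis .
  qed
  have un_sum: "summable (\<lambda>m. LINT q|lborel. norm (\<Sum>n. T m n q))"
  proof (rule summable_comparison_test')
    let ?Q = "\<Sum>n. (real n + a) powr - (1 + \<epsilon>)"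
    let ?v = "\<lambda>m. ?Gm * (?Q * (real m + a) powr - (Re (s1 + s2) - 1 - \<epsilon>))"
    show "summable ?v" using a e by (intro summable_mult summable_shift_powr) auto
    fix m
    have "(\<Sum>n. ?w m n) = ?Gm * ((real m + a) powr - Re s1 * (\<Sum>n. ?c m n powr - Re s2))"
      using summable_shift_powr[of "real m + (a + 1)" "Re s2"] a s2
      by (subst suminf_mult, intro summable_mult, simp, subst suminf_mult) auto
    \<comment> \<open>The majorant is itself a term of the double sum for \<open>z1 = z2 = 1\<close>
      and real exponents, so the earlier term estimate applies to it.\<close>
    also have "(real m + a) powr - Re s1 * (\<Sum>n. ?c m n powr - Re s2) =
        norm (1 ^ m * inv_power (real m + a) (of_real (Re s1)) * lerch_sum 1 (of_real (Re s2)) (real m + (a + 1)))"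
      using a s2 suminf_shift_powr_nonneg[of "real m + (a + 1)" "Re s2"] c(1)[of m] 
      by (simp add: lerch_sum_1_of_real inv_power_of_real norm_mult del: of_real_add)
    also have "\<dots> \<le> ?Q * (real m + a) powr - (Re (of_real (Re s1) + of_real (Re s2)) - 1 - \<epsilon>)"
      using a e by (intro norm_double_lerch_term_le) auto
    finally have "(\<Sum>n. ?w m n) \<le> ?v m" using Gpos by (simp add: mult_left_mono)
    then show "norm (LINT q|lborel. norm (\<Sum>n. T m n q)) \<le> ?v m"
      using un[of m] by (simp add: Bochner_Integration.integral_nonneg)
  qed
  have norm_sum2: "summable (\<lambda>m. norm (\<Sum>n. T m n q))" for q
    unfolding tsum t_eq0[of _ q] norm_mult norm_power norm_divide using geo(1)[of q]
    by (intro summable_divide summable_mult summable_geometric) (simp add: norm_mult del: of_real_add)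
  have tsum2: "(\<Sum>m. \<Sum>n. T m n q) = exp (s1 * of_real (fst q) + s2 * of_real (snd q)) * lerch_kernel a z1 z2 q" for q
  proof -
    have "(\<lambda>m. B q * (z1 * of_real (exp (- (exp (fst q) + exp (snd q))))) ^ m / (1 - z2 * of_real (exp (- exp (snd q)))))
      sums (B q * (1 / (1 - z1 * of_real (exp (- (exp (fst q) + exp (snd q)))))) / (1 - z2 * of_real (exp (- exp (snd q)))))"
      by (intro sums_divide sums_mult geometric_sums geo(1))
    then have "(\<Sum>m. \<Sum>n. T m n q) = B q * (1 / (1 - z1 * of_real (exp (- (exp (fst q) + exp (snd q)))))) / (1 - z2 * of_real (exp (- exp (snd q))))"
      unfolding tsum t_eq0[symmetric] by (simp add: sums_iff)
    also have "\<dots> = exp (s1 * of_real (fst q) + s2 * of_real (snd q)) * lerch_kernel a z1 z2 q"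
      unfolding B_def T_def geo(3) exp_add by (simp add: divide_inverse mult_ac add_ac)
    finally show ?thesis .
  qed
  have "laplace2 (lerch_kernel a z1 z2) (s1, s2) = (LINT q|lborel. (\<Sum>m. \<Sum>n. T m n q))"
    unfolding laplace2_def tsum2 by simp
  also have "\<dots> = (\<Sum>m. LINT q|lborel. (\<Sum>n. T m n q))"
    using ui norm_sum2 un_sum by (intro integral_suminf) auto
  also have "\<dots> = (\<Sum>m. \<Sum>n. z1 ^ m * z2 ^ n * (Gamma s1 * inv_power (real m + a) s1 * (Gamma s2 * inv_power (?c m n) s2)))"
    unfolding uI t(2) ..
  also have "\<dots> = (\<Sum>m. Gamma s1 * Gamma s2 * (z1 ^ m * inv_power (real m + a) s1 * lerch_sum z2 s2 (real m + (a + 1))))"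
  proof (intro suminf_cong)
    fix m
    have "(\<lambda>n. Gamma s1 * Gamma s2 * (z1 ^ m * inv_power (real m + a) s1) * (z2 ^ n * inv_power (?c m n) s2)) sums
      (Gamma s1 * Gamma s2 * (z1 ^ m * inv_power (real m + a) s1) * lerch_sum z2 s2 (real m + (a + 1)))"
      unfolding lerch_sum_def using a
      by (intro sums_mult summable_sums[OF summable_norm_cancel[OF summable_lerch[OF z(2) _ s2]]]) auto
    then show "(\<Sum>n. z1 ^ m * z2 ^ n * (Gamma s1 * inv_power (real m + a) s1 * (Gamma s2 * inv_power (?c m n) s2))) =
       Gamma s1 * Gamma s2 * (z1 ^ m * inv_power (real m + a) s1 * lerch_sum z2 s2 (real m + (a + 1)))"
      by (simp add: sums_iff mult_ac)
  qed
  also have "\<dots> = Gamma s1 * Gamma s2 * double_lerch z1 z2 a (s1, s2) (a + 1)"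
    unfolding double_lerch_def fst_conv snd_conv
  proof (rule suminf_mult)
    show "summable (\<lambda>m. z1 ^ m * inv_power (real m + a) s1 * lerch_sum z2 s2 (real m + (a + 1)))"
    proof (rule summable_comparison_test')
      show "norm (z1 ^ m * inv_power (real m + a) s1 * lerch_sum z2 s2 (real m + (a + 1))) \<le> 
       (\<Sum>n. (real n + a) powr - (1 + \<epsilon>)) * (real m + a) powr - (Re (s1 + s2) - 1 - \<epsilon>)" for m
        using a e by (intro norm_double_lerch_term_le z) auto
      show "summable (\<lambda>m. (\<Sum>n. (real n + a) powr - (1 + \<epsilon>)) * (real m + a) powr - (Re (s1 + s2) - 1 - \<epsilon>))"
        using a e by (intro summable_mult summable_shift_powr) auto
    qed
  qed
  finally show ?thesis using Phi2_series_eq_double_lerch[OF a(1)] by simp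
qed

section \<open>From kernels to probability measures\<close>

lemma exp_Complex_pair:
  "exp (Complex \<sigma>1 t1 * of_real x + Complex \<sigma>2 t2 * of_real y) = of_real (exp (\<sigma>1 * x + \<sigma>2 * y)) * cis (t1 * x + t2 * y)"
  by (simp add: complex_eq_iff Re_exp Im_exp)

text \<open>To continue \<open>Phi2\<close> itself, \<open>h\<close> is multiplied by the entire
  functions \<open>rGamma\<close> of both variables; in the right half-plane they are the
  reciprocals of the Gamma factors in \<open>fvec\<close>.\<close>

lemma fvec_eqI:
  assumes a: "0 < a" "a \<le> 1" and z: "norm z1 \<le> 1" "norm z2 \<le> 1"
    and h: "holo2 h U" "connected U" "U \<inter> Phi2_acr \<noteq> {}"
    and ser: "\<And>s1 s2. (s1, s2) \<in> U \<inter> Phi2_acr \<Longrightarrow> Gamma s1 * Gamma s2 * Phi2_series s1 s2 a z1 z2 = h (s1, s2)"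
    and s: "(Complex \<sigma>1 t1, Complex \<sigma>2 t2) \<in> U" "\<sigma>1 > 0" "\<sigma>2 > 0"
  shows "fvec \<sigma>1 \<sigma>2 a z1 z2 t1 t2 = h (Complex \<sigma>1 t1, Complex \<sigma>2 t2)"
proof -
  let ?g = "\<lambda>p. h p * (rGamma (fst p) * rGamma (snd p))"
  have U: "open U" using h(1) by (rule holo2_open)
  have nz: "Gamma x * rGamma x = 1" if "Re x > 0" for x :: complex
  proof -
    have "x \<notin> \<int>\<^sub>\<le>\<^sub>0" using that by (auto elim!: nonpos_Ints_cases)
    then show ?thesis by (simp add: rGamma_inverse_Gamma Gamma_eq_zero_iff)
  qed
  have "holo2 (\<lambda>p. rGamma (fst p)) U" "holo2 (\<lambda>p. rGamma (snd p)) U"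
    by (rule holo2_compose[OF holo2_fst[OF U] holomorphic_rGamma], rule holo2_compose[OF holo2_snd[OF U] holomorphic_rGamma])
  then have "holo2 ?g U" by (intro holo2_mult h)
  moreover have "?g p = Phi2_series (fst p) (snd p) a z1 z2" if "p \<in> U \<inter> Phi2_acr" for p
  proof -
    have "Re (fst p) > 0" "Re (snd p) > 0" using that by (auto simp: Phi2_acr_def)
    note nz' = nz[OF this(1)] nz[OF this(2)]
    have "h p = Gamma (fst p) * Gamma (snd p) * Phi2_series (fst p) (snd p) a z1 z2"
      using ser[of "fst p" "snd p"] that by simp
    then have "?g p = (Gamma (fst p) * rGamma (fst p)) * (Gamma (snd p) * rGamma (snd p)) * Phi2_series (fst p) (snd p) a z1 z2"
      by (simp only: mult_ac)
    then show ?thesis unfolding nz' by simp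
  qed
  ultimately have "Phi2 (Complex \<sigma>1 t1) (Complex \<sigma>2 t2) a z1 z2 = ?g (Complex \<sigma>1 t1, Complex \<sigma>2 t2)"
    by (intro Phi2_eqI[OF Phi2_continuation[OF a z] _ h(2) s(1) h(3)])
  then have "fvec \<sigma>1 \<sigma>2 a z1 z2 t1 t2 = (Gamma (Complex \<sigma>1 t1) * rGamma (Complex \<sigma>1 t1)) *
      (Gamma (Complex \<sigma>2 t2) * rGamma (Complex \<sigma>2 t2)) * h (Complex \<sigma>1 t1, Complex \<sigma>2 t2)"
    unfolding fvec_def by (simp only: fst_conv snd_conv mult_ac)
  then show ?thesis using nz[of "Complex \<sigma>1 t1"] nz[of "Complex \<sigma>2 t2"] s by simp
qed

lemma Re_complex_of_real_times: "Re (of_real x * z) = x * Re z" and Im_complex_of_real_times: "Im (of_real x * z) = x * Im z"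
  by simp_all

text \<open>Exponential tilting (Esscher transform) of the kernel, normalised by f(0): the candidate
  for the density, still complex valued.\<close>

definition tilted ::
    "(real \<times> real \<Rightarrow> complex) \<Rightarrow> real \<Rightarrow> real \<Rightarrow> real \<Rightarrow> complex \<Rightarrow> complex \<Rightarrow> real \<times> real \<Rightarrow> complex" where
  "tilted k \<sigma>1 \<sigma>2 a z1 z2 q = of_real (exp (\<sigma>1 * fst q) * exp (\<sigma>2 * snd q)) / fvec \<sigma>1 \<sigma>2 a z1 z2 0 0 * k q"

context
  fixes k :: "real \<times> real \<Rightarrow> complex" and \<sigma>1 \<sigma>2 a :: real and z1 z2 :: complex
  assumes k: "continuous_on UNIV k" and conv: "laplace2_conv k \<sigma>1 \<sigma>2"
    and f: "\<And>t1 t2. fvec \<sigma>1 \<sigma>2 a z1 z2 t1 t2 = laplace2 k (Complex \<sigma>1 t1, Complex \<sigma>2 t2)"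
begin

lemma integrable_exp_kernel: "integrable lborel (\<lambda>q. of_real (exp (\<sigma>1 * fst q + \<sigma>2 * snd q)) * k q)"
proof (rule Bochner_Integration.integrable_bound)
  show "integrable lborel (\<lambda>q. exp (\<sigma>1 * fst q + \<sigma>2 * snd q) * norm (k q))"
    using conv by (simp add: laplace2_conv_def)
  have [measurable]: "k \<in> borel_measurable borel" using k by (rule borel_measurable_continuous_onI)
  show "(\<lambda>q. of_real (exp (\<sigma>1 * fst q + \<sigma>2 * snd q)) * k q) \<in> borel_measurable lborel" by simp
qed (simp add: norm_mult)

lemma tilted_eq: "tilted k \<sigma>1 \<sigma>2 a z1 z2 q = (of_real (exp (\<sigma>1 * fst q + \<sigma>2 * snd q)) * k q) / fvec \<sigma>1 \<sigma>2 a z1 z2 0 0"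
  by (simp add: tilted_def exp_add)

lemma integrable_tilted: "integrable lborel (tilted k \<sigma>1 \<sigma>2 a z1 z2)"
  unfolding tilted_eq[abs_def] by (intro integrable_divide integrable_exp_kernel)

lemma Fvec_eq_tilted: "Fvec \<sigma>1 \<sigma>2 a z1 z2 t1 t2 = (CLINT q|lborel. cis (t1 * fst q + t2 * snd q) * tilted k \<sigma>1 \<sigma>2 a z1 z2 q)"
proof -
  have "fvec \<sigma>1 \<sigma>2 a z1 z2 t1 t2 = (CLINT q|lborel. cis (t1 * fst q + t2 * snd q) * (of_real (exp (\<sigma>1 * fst q + \<sigma>2 * snd q)) * k q))"
    unfolding f laplace2_def fst_conv snd_conv exp_Complex_pair by (simp add: mult_ac)
  \<comment> \<open>If f(0) = 0, both sides are 0 by the convention for division by zero.\<close>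
  then show ?thesis unfolding Fvec_def tilted_eq by simp
qed

text \<open>A characteristic function is 1 at the origin, which excludes f(0) = 0 since the quotient
  would then be 0. Positivity comes almost everywhere from \<open>char2_density\<close>, and
  everywhere by continuity.\<close>

lemma charfun_imp:
  assumes "is_charfun2 (Fvec \<sigma>1 \<sigma>2 a z1 z2) M"
  shows "fvec \<sigma>1 \<sigma>2 a z1 z2 0 0 \<noteq> 0"
    and "\<And>q. Im (k q / fvec \<sigma>1 \<sigma>2 a z1 z2 0 0) = 0 \<and> Re (k q / fvec \<sigma>1 \<sigma>2 a z1 z2 0 0) \<ge> 0"
    and "M = density lborel (\<lambda>q. ennreal (Re (tilted k \<sigma>1 \<sigma>2 a z1 z2 q)))"
proof -
  have M: "prob_space M" "sets M = sets borel" "\<And>t1 t2. char2 M t1 t2 = Fvec \<sigma>1 \<sigma>2 a z1 z2 t1 t2"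
    using assms by (auto simp: is_charfun2_def)
  interpret prob_space M by (rule M)
  have "char2 M 0 0 = 1" by (simp add: char2_def prob_space)
  then show nz: "fvec \<sigma>1 \<sigma>2 a z1 z2 0 0 \<noteq> 0" using M(3)[of 0 0] by (auto simp: Fvec_def)
  note D = char2_density[OF M(1,2) integrable_tilted M(3)[unfolded Fvec_eq_tilted]]
  show "M = density lborel (\<lambda>q. ennreal (Re (tilted k \<sigma>1 \<sigma>2 a z1 z2 q)))" by (rule D(2))
  \<comment> \<open>A closed set that contains almost every point is the whole plane. This is where
    continuity of \<open>k\<close> enters.\<close>
  let ?C = "{q. Im (tilted k \<sigma>1 \<sigma>2 a z1 z2 q) = 0 \<and> Re (tilted k \<sigma>1 \<sigma>2 a z1 z2 q) \<ge> 0}"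
  have "continuous_on UNIV (tilted k \<sigma>1 \<sigma>2 a z1 z2)" unfolding tilted_def using nz by (intro continuous_intros k) auto
  then have "closed ?C"
    by (intro closed_Collect_conj closed_Collect_eq closed_Collect_le continuous_intros)
  moreover have "AE q in lebesgue. q \<in> ?C" using D(1) by (intro AE_completion) auto
  ultimately have "q \<in> ?C" for q by (rule mem_closed_if_AE_lebesgue)
  then have t: "Im (tilted k \<sigma>1 \<sigma>2 a z1 z2 q) = 0" "Re (tilted k \<sigma>1 \<sigma>2 a z1 z2 q) \<ge> 0" for q by auto
  have e: "tilted k \<sigma>1 \<sigma>2 a z1 z2 q = of_real (exp (\<sigma>1 * fst q + \<sigma>2 * snd q)) * (k q / fvec \<sigma>1 \<sigma>2 a z1 z2 0 0)" for q
    by (simp add: tilted_eq)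
  show "Im (k q / fvec \<sigma>1 \<sigma>2 a z1 z2 0 0) = 0 \<and> Re (k q / fvec \<sigma>1 \<sigma>2 a z1 z2 0 0) \<ge> 0" for q
    using t[of q] unfolding e Re_complex_of_real_times Im_complex_of_real_times by (simp add: zero_le_mult_iff del: Re_divide Im_divide)
qed

lemma charfun_density:
  assumes "is_charfun2 (Fvec \<sigma>1 \<sigma>2 a z1 z2) M" "\<And>\<eta> \<theta>. P \<eta> \<theta> = tilted k \<sigma>1 \<sigma>2 a z1 z2 (\<eta>, \<theta>)"
  shows "has_density2 M P"
proof -
  have "tilted k \<sigma>1 \<sigma>2 a z1 z2 q \<in> \<real>" for q
    using charfun_imp(2)[OF assms(1), of q] 
    by (simp add: tilted_eq complex_is_Real_iff times_divide_eq_right[symmetric] del: times_divide_eq_right)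
  then show ?thesis
    using charfun_imp(3)[OF assms(1)] assms(2) by (simp add: has_density2_def)
qed

text \<open>A kernel of constant sign has an integral f(0) of the same strict sign, so the quotient
  is a probability density. The negative case is the one needed for \<open>H_kernel\<close>.\<close>

lemma charfun_exists:
  assumes \<kappa>: "\<And>q. k q = of_real (\<kappa> q)" and sgn: "(\<forall>q. \<kappa> q > 0) \<or> (\<forall>q. \<kappa> q < 0)"
  shows "\<exists>M. is_charfun2 (Fvec \<sigma>1 \<sigma>2 a z1 z2) M"
proof -
  let ?e = "\<lambda>q. exp (\<sigma>1 * fst q + \<sigma>2 * snd q) * \<kappa> q"
  let ?I = "LINT q|lborel. ?e q"
  have ie: "integrable lborel ?e"
    using integrable_exp_kernel unfolding \<kappa> of_real_mult[symmetric] by (simp only: complex_of_real_integrable_eq)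
  have f0: "fvec \<sigma>1 \<sigma>2 a z1 z2 0 0 = of_real ?I"
    unfolding f laplace2_def fst_conv snd_conv exp_Complex_pair \<kappa> integral_complex_of_real[symmetric] by simp
  have nz: "\<not> (AE q in lborel. ?e q = 0)"
  proof
    assume "AE q in lborel. ?e q = 0"
    moreover have "\<kappa> q \<noteq> 0" for q using sgn by (metis less_irrefl)
    ultimately have "AE q :: real \<times> real in lborel. False" by simp
    then have "AE q :: real \<times> real in lebesgue. q \<in> {}" by (intro AE_completion) auto
    from mem_closed_if_AE_lebesgue[OF _ this] show False by auto
  qed
  have pos: "\<kappa> q / ?I \<ge> 0" "?I \<noteq> 0" for q
  proof -
    consider "\<forall>q. \<kappa> q > 0" | "\<forall>q. \<kappa> q < 0" using sgn by blast
    then have "\<kappa> q / ?I \<ge> 0 \<and> ?I \<noteq> 0"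
    proof cases
      case 1
      have e: "?e q \<ge> 0" for q using 1[rule_format, of q] by simp
      then have "?I \<ge> 0" by (intro Bochner_Integration.integral_nonneg) auto
      moreover have "?I \<noteq> 0" using integral_nonneg_eq_0_iff_AE[OF ie] e nz by simp
      moreover have "\<kappa> q \<ge> 0" using 1[rule_format, of q] by simp
      ultimately show ?thesis by (intro conjI divide_nonneg_nonneg)
    next
      case 2
      have e: "- ?e q \<ge> 0" for q using 2[rule_format, of q] by (simp add: mult_nonneg_nonpos)
      have "(LINT q|lborel. - ?e q) \<ge> 0" using e by (intro Bochner_Integration.integral_nonneg) auto
      moreover have "(LINT q|lborel. - ?e q) \<noteq> 0"
        using integral_nonneg_eq_0_iff_AE[OF Bochner_Integration.integrable_minus[OF ie]] e nz by simp
      moreover have "(LINT q|lborel. - ?e q) = - ?I" by (rule Bochner_Integration.integral_minus)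
      ultimately have "?I \<le> 0" "?I \<noteq> 0" by linarith+
      moreover have "\<kappa> q \<le> 0" using 2[rule_format, of q] by simp
      ultimately show ?thesis by (intro conjI divide_nonpos_nonpos)
    qed
    then show "\<kappa> q / ?I \<ge> 0" "?I \<noteq> 0" by auto
  qed
  define g where "g q = exp (\<sigma>1 * fst q + \<sigma>2 * snd q) * (\<kappa> q / ?I)" for q
  have tr: "tilted k \<sigma>1 \<sigma>2 a z1 z2 q = of_real (g q)" for q unfolding tilted_eq f0 \<kappa> g_def by simp
  have it: "integrable lborel g" using ie by (simp add: g_def[abs_def])
  have [measurable]: "g \<in> borel_measurable borel" using borel_measurable_integrable[OF it] by simp
  have t0: "g q \<ge> 0" for q unfolding g_def by (rule mult_nonneg_nonneg[OF _ pos(1)]) simp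
  let ?M = "density lborel (\<lambda>q. ennreal (g q))"
  have "(LINT q|lborel. g q) = 1" using pos(2) by (simp add: g_def)
  then have "(\<integral>\<^sup>+q. ennreal (g q) \<partial>lborel) = 1"
    using nn_integral_eq_integral[OF it] t0 by simp
  then have "prob_space ?M" by (intro prob_spaceI) (simp add: emeasure_density)
  moreover have "char2 ?M t1 t2 = Fvec \<sigma>1 \<sigma>2 a z1 z2 t1 t2" for t1 t2
    unfolding char2_def Fvec_eq_tilted tr using t0
    by (subst integral_density) (auto simp: scaleR_conv_of_real mult.commute)
  ultimately show ?thesis by (auto simp: is_charfun2_def)
qed

end

section \<open>The kernel for \<open>(z1, z2) \<noteq> (1, 1)\<close>\<close>

text \<open>The order of the pole of \<open>1 / (exp t - z)\<close> at \<open>t = 0\<close>, hence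
  the abscissa which the corresponding exponent must exceed.\<close>

definition polar_weight :: "complex \<Rightarrow> real" where
  "polar_weight z = (if z = 1 then 1 else 0)"

lemma polar_weight_nonneg: "polar_weight z \<ge> 0" by (simp add: polar_weight_def)

text \<open>For \<open>z = 1\<close> one uses \<open>exp t - 1 \<ge> t\<close>. Otherwise, with
  \<open>w = exp (- t)\<close> in \<open>{0..1}\<close>, the modulus of \<open>1 - z * w\<close> has
  a positive minimum by compactness: a zero would force \<open>w = 1\<close> and
  \<open>z = 1\<close>.\<close>

lemma inverse_exp_minus_bound:
  assumes z: "norm z \<le> 1"
  obtains C where "C > 0"
    "\<And>t. t > 0 \<Longrightarrow> norm (1 / (of_real (exp t) - z)) \<le> C * exp (- t) * (1 + polar_weight z / t)"
proof (cases "z = 1")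
  case True
  have "norm (1 / (of_real (exp t) - z)) \<le> 1 * exp (- t) * (1 + polar_weight z / t)" if t: "t > 0" for t
  proof -
    have "of_real (exp t) - z = of_real (exp t - 1)" by (simp add: True)
    then have "norm (1 / (of_real (exp t) - z)) = 1 / (exp t - 1)"
      using t by (simp only: norm_divide norm_of_real) simp
    also have "\<dots> \<le> exp (- t) * (1 + 1 / t)"
    proof -
      have "exp t - 1 \<ge> t" using exp_ge_add_one_self[of t] by linarith
      then have "exp t \<le> (1 + 1 / t) * (exp t - 1)" using t by (simp add: field_simps)
      then show ?thesis using t by (simp add: exp_minus field_simps)
    qed
    finally show ?thesis by (simp add: True polar_weight_def)
  qed
  then show ?thesis using that[of 1] by simp
next
  case False
  have "\<exists>x\<in>{0..1}. \<forall>w\<in>{0..1}. norm (1 - z * of_real x) \<le> norm (1 - z * of_real w)"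
    by (intro continuous_attains_inf continuous_intros) auto
  then obtain x where x: "x \<in> {0..1}" "\<And>w. w \<in> {0..1} \<Longrightarrow> norm (1 - z * of_real x) \<le> norm (1 - z * of_real w)"
    by blast
  let ?c = "norm (1 - z * of_real x)"
  have c: "?c > 0"
  proof (rule ccontr)
    assume "\<not> ?c > 0"
    then have zx: "z * of_real x = 1" by simp
    have "norm z * norm (complex_of_real x) = 1" unfolding norm_mult[symmetric] zx by simp
    then have "norm z * x = 1" using x(1) by simp
    moreover have "norm z * x \<le> x" using z x(1) by (intro mult_left_le_one_le) auto
    ultimately have "x = 1" using x(1) by auto
    then show False using zx False by simp
  qed
  have "norm (1 / (of_real (exp t) - z)) \<le> 1 / ?c * exp (- t) * (1 + polar_weight z / t)" if t: "t > 0" for t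
  proof -
    have "of_real (exp t) - z = of_real (exp t) * (1 - z * of_real (exp (- t)))"
      by (simp add: exp_minus algebra_simps)
    then have "norm (of_real (exp t) - z) = exp t * norm (1 - z * of_real (exp (- t)))"
      by (simp add: norm_mult)
    also have "\<dots> \<ge> exp t * ?c" using x(2)[of "exp (- t)"] t by (intro mult_left_mono) auto
    finally have "norm (1 / (of_real (exp t) - z)) \<le> 1 / (exp t * ?c)"
      unfolding norm_divide norm_one by (intro frac_le mult_pos_pos exp_gt_zero c) auto
    then show ?thesis using False by (simp add: polar_weight_def exp_minus field_simps)
  qed
  then show ?thesis using that[of "1 / ?c"] c by simp
qed

lemma integrable_exp_polar:
  assumes "c > 0" "\<epsilon> \<ge> 0" "\<sigma> > \<epsilon>" "\<epsilon> = 0 \<or> \<epsilon> = 1"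
  shows "integrable lborel (\<lambda>x. exp (\<sigma> * x) * exp (- c * exp x) * (1 + \<epsilon> * exp (- x)) :: real)"
proof (cases "\<epsilon> = 0")
  case True then show ?thesis using Gamma_exp_integral_real(1)[of \<sigma> c] assms by simp
next
  case False
  then have e: "\<epsilon> = 1" using assms by auto
  have "integrable lborel (\<lambda>x. exp (\<sigma> * x) * exp (- c * exp x) + exp ((\<sigma> - 1) * x) * exp (- c * exp x))"
    using assms e by (intro Bochner_Integration.integrable_add Gamma_exp_integral_real(1)) auto
  then show ?thesis
  proof (rule Bochner_Integration.integrable_cong[THEN iffD1, rotated -1])
    fix x :: real
    have "exp ((\<sigma> - 1) * x) = exp (\<sigma> * x) * exp (- x)" by (simp add: exp_add[symmetric] algebra_simps)
    then show "exp (\<sigma> * x) * exp (- c * exp x) + exp ((\<sigma> - 1) * x) * exp (- c * exp x) =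
        exp (\<sigma> * x) * exp (- c * exp x) * (1 + \<epsilon> * exp (- x))"
      unfolding e by (simp add: algebra_simps)
  qed simp
qed

text \<open>The bounds on the two denominators separate the variables, leaving a product of
  Gamma-type integrals; each polar term lowers the exponent by one.\<close>

lemma laplace2_conv_lerch_kernel:
  assumes a: "0 < a" "a \<le> 1" and z: "norm z1 \<le> 1" "norm z2 \<le> 1"
    and \<sigma>: "\<sigma>1 > polar_weight z1" "\<sigma>2 > polar_weight z2"
  shows "laplace2_conv (lerch_kernel a z1 z2) \<sigma>1 \<sigma>2"
proof -
  obtain C1 where C1: "C1 > 0" "\<And>t. t > 0 \<Longrightarrow> norm (1 / (of_real (exp t) - z1)) \<le> C1 * exp (- t) * (1 + polar_weight z1 / t)"
    using inverse_exp_minus_bound[OF z(1)] by blast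
  obtain C2 where C2: "C2 > 0" "\<And>t. t > 0 \<Longrightarrow> norm (1 / (of_real (exp t) - z2)) \<le> C2 * exp (- t) * (1 + polar_weight z2 / t)"
    using inverse_exp_minus_bound[OF z(2)] by blast
  let ?F = "\<lambda>x. exp (\<sigma>1 * x) * exp (- a * exp x) * (1 + polar_weight z1 * exp (- x))"
  let ?G = "\<lambda>y. exp (\<sigma>2 * y) * exp (- (1 + a) * exp y) * (1 + polar_weight z2 * exp (- y))"
  have FG: "integrable lborel (\<lambda>q. C1 * C2 * (?F (fst q) * ?G (snd q)))"
    using a \<sigma> by (intro integrable_mult_right lborel_product_integral(1) integrable_exp_polar polar_weight_nonneg) (auto simp: polar_weight_def)
  have "exp (\<sigma>1 * fst q + \<sigma>2 * snd q) * norm (lerch_kernel a z1 z2 q) \<le> C1 * C2 * (?F (fst q) * ?G (snd q))" for q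
  proof -
    let ?x = "exp (fst q)" and ?y = "exp (snd q)"
    have 1: "norm (1 / (of_real (exp (?x + ?y)) - z1)) \<le> C1 * exp (- (?x + ?y)) * (1 + polar_weight z1 * exp (- fst q))"
    proof -
      have "norm (1 / (of_real (exp (?x + ?y)) - z1)) \<le> C1 * exp (- (?x + ?y)) * (1 + polar_weight z1 / (?x + ?y))"
        by (intro C1 add_pos_pos) auto
      \<comment> \<open>Enlarging the polar term from \<open>x + y\<close> to \<open>x\<close>
        decouples the variables at no cost in the range of exponents.\<close>
      also have "\<dots> \<le> C1 * exp (- (?x + ?y)) * (1 + polar_weight z1 / ?x)"
        using C1(1) polar_weight_nonneg by (intro mult_left_mono add_left_mono divide_left_mono mult_pos_pos add_pos_pos) auto
      finally show ?thesis by (simp add: exp_minus divide_inverse)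
    qed
    have 2: "norm (1 / (of_real (exp ?y) - z2)) \<le> C2 * exp (- ?y) * (1 + polar_weight z2 * exp (- snd q))"
      using C2(2)[of ?y] by (simp add: exp_minus divide_inverse)
    have "norm (lerch_kernel a z1 z2 q) = exp ((1 - a) * (?x + ?y)) * (norm (1 / (of_real (exp ?y) - z2)) * norm (1 / (of_real (exp (?x + ?y)) - z1)))"
      by (simp add: lerch_kernel_def norm_mult norm_divide del: of_real_add)
    also have "\<dots> \<le> exp ((1 - a) * (?x + ?y)) * ((C2 * exp (- ?y) * (1 + polar_weight z2 * exp (- snd q))) *
         (C1 * exp (- (?x + ?y)) * (1 + polar_weight z1 * exp (- fst q))))"
      using C2(1) polar_weight_nonneg by (intro mult_left_mono mult_mono 1 2) (auto intro!: mult_nonneg_nonneg add_nonneg_nonneg)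
    also have "\<dots> = (exp ((1 - a) * (?x + ?y)) * exp (- ?y) * exp (- (?x + ?y))) * (C1 * C2 * (1 + polar_weight z1 * exp (- fst q)) * (1 + polar_weight z2 * exp (- snd q)))"
      by (simp only: mult_ac)
    also have "exp ((1 - a) * (?x + ?y)) * exp (- ?y) * exp (- (?x + ?y)) = exp (- a * ?x) * exp (- (1 + a) * ?y)"
      unfolding exp_add[symmetric] by (simp add: algebra_simps)
    finally have "exp (\<sigma>1 * fst q + \<sigma>2 * snd q) * norm (lerch_kernel a z1 z2 q) \<le> exp (\<sigma>1 * fst q + \<sigma>2 * snd q) *
      (exp (- a * ?x) * exp (- (1 + a) * ?y) * (C1 * C2 * (1 + polar_weight z1 * exp (- fst q)) * (1 + polar_weight z2 * exp (- snd q))))"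
      by (rule mult_left_mono) simp
    also have "\<dots> = C1 * C2 * (?F (fst q) * ?G (snd q))" unfolding exp_add by (simp only: mult_ac)
    finally show ?thesis .
  qed
  then show ?thesis
    unfolding laplace2_conv_def by (intro Bochner_Integration.integrable_bound[OF FG]) (auto intro!: AE_I2 order_trans[OF _ abs_ge_self])
qed

lemma fvec_eq_laplace2:
  assumes a: "0 < a" "a \<le> 1" and z: "norm z1 \<le> 1" "norm z2 \<le> 1"
    and \<sigma>: "\<sigma>1 > polar_weight z1" "\<sigma>2 > polar_weight z2"
  shows "fvec \<sigma>1 \<sigma>2 a z1 z2 t1 t2 = laplace2 (lerch_kernel a z1 z2) (Complex \<sigma>1 t1, Complex \<sigma>2 t2)"
proof (rule fvec_eqI[OF a z])
  let ?U = "{s. Re s > polar_weight z1} \<times> {s. Re s > polar_weight z2}"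
  have U: "open ?U" by (intro open_Times open_halfspace_Re_gt)
  show "holo2 (laplace2 (lerch_kernel a z1 z2)) ?U"
    by (rule holo2_laplace2[OF U lerch_kernel_measurable]) (auto intro!: laplace2_conv_lerch_kernel a z)
  show "connected ?U" by (intro connected_Times convex_connected convex_halfspace_Re_gt)
  have "(3, 3) \<in> ?U \<inter> Phi2_acr" by (simp add: polar_weight_def Phi2_acr_def)
  then show "?U \<inter> Phi2_acr \<noteq> {}" by blast
  show "Gamma s1 * Gamma s2 * Phi2_series s1 s2 a z1 z2 = laplace2 (lerch_kernel a z1 z2) (s1, s2)"
    if "(s1, s2) \<in> ?U \<inter> Phi2_acr" for s1 s2
    using that by (intro Phi2_series_eq_laplace2 a z) auto
  show "(Complex \<sigma>1 t1, Complex \<sigma>2 t2) \<in> ?U" using \<sigma> by simp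
  show "\<sigma>1 > 0" "\<sigma>2 > 0" using \<sigma> polar_weight_nonneg[of z1] polar_weight_nonneg[of z2] by linarith+
qed

lemma exp_neq_small: "norm z \<le> 1 \<Longrightarrow> t > 0 \<Longrightarrow> of_real (exp t) \<noteq> z"
  for z :: complex
  by auto

lemma continuous_on_lerch_kernel:
  assumes "norm z1 \<le> 1" "norm z2 \<le> 1"
  shows "continuous_on UNIV (lerch_kernel a z1 z2)"
  unfolding lerch_kernel_def[abs_def] using assms
  by (intro continuous_intros) (auto simp: exp_neq_small add_pos_pos simp del: of_real_add)

lemma lerch_kernel_real_pos:
  assumes "x1 \<le> 1" "x2 \<le> 1"
  shows "\<exists>\<kappa>. (\<forall>q. lerch_kernel a (of_real x1) (of_real x2) q = of_real (\<kappa> q)) \<and> (\<forall>q. \<kappa> q > 0)"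
proof (intro exI conjI allI)
  let ?k = "\<lambda>q. exp ((1 - a) * (exp (fst q) + exp (snd q))) / ((exp (exp (snd q)) - x2) * (exp (exp (fst q) + exp (snd q)) - x1))"
  fix q :: "real \<times> real"
  show "lerch_kernel a (of_real x1) (of_real x2) q = of_real (?k q)" by (simp add: lerch_kernel_def)
  have "exp (exp (snd q)) > 1" by simp
  moreover have "exp (exp (fst q) + exp (snd q)) > 1" using add_pos_pos[OF exp_gt_zero exp_gt_zero] by simp
  ultimately have "exp (exp (snd q)) - x2 > 0" "exp (exp (fst q) + exp (snd q)) - x1 > 0" using assms by linarith+
  then show "?k q > 0" by (intro divide_pos_pos mult_pos_pos exp_gt_zero)
qed

lemma real_if_affine_real:
  fixes c w :: complex
  assumes "c \<noteq> 0" "u \<noteq> v" and r: "c * (of_real u - w) \<in> \<real>" "c * (of_real v - w) \<in> \<real>"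
  shows "c \<in> \<real>" "w \<in> \<real>"
proof -
  have "c * (of_real u - w) - c * (of_real v - w) \<in> \<real>" using r by (rule Reals_diff)
  then have "c * of_real (u - v) \<in> \<real>" by (simp add: algebra_simps)
  then have "c * of_real (u - v) / of_real (u - v) \<in> \<real>" by (intro Reals_divide) auto
  then show c: "c \<in> \<real>" using assms(2) by simp
  have "of_real u - (c * (of_real u - w)) / c \<in> \<real>" using r(1) c by (intro Reals_diff Reals_divide) auto
  then show "w \<in> \<real>" using assms(1) by simp
qed

text \<open>The reciprocal of a real kernel is real, so
  \<open>f0 * (exp y - z2) * (exp (x + y) - z1)\<close> is real for all positive \<open>x\<close>
  and \<open>y\<close>. Freezing one factor leaves an affine function of a real variable, and two of
  its values determine that \<open>z\<close> is real.\<close>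

lemma lerch_kernel_real_imp:
  assumes z: "norm z1 \<le> 1" "norm z2 \<le> 1" and f: "f0 \<noteq> 0"
    and r: "\<And>q. lerch_kernel a z1 z2 q / f0 \<in> \<real>"
  shows "z1 \<in> \<real>" "z2 \<in> \<real>"
proof -
  have fac: "f0 * ((of_real (exp y) - z2) * (of_real (exp (x + y)) - z1)) \<in> \<real>" if "x > 0" "y > 0" for x y :: real
  proof -
    have "of_real (exp ((1 - a) * (x + y))) / (lerch_kernel a z1 z2 (ln x, ln y) / f0) \<in> \<real>"
      by (rule Reals_divide[OF Reals_of_real r])
    then show ?thesis
      using that by (simp add: lerch_kernel_def mult_ac del: of_real_add)
  qed
  have nz: "of_real (exp t) - z1 \<noteq> 0" "of_real (exp t) - z2 \<noteq> 0" if "t > 0" for t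
    using exp_neq_small that z by auto
  \<comment> \<open>The points \<open>(2, 1)\<close> and \<open>(1, 2)\<close> share
    \<open>x + y = 3\<close>, so only the factor with \<open>z2\<close> varies; below,
    \<open>(1, 1)\<close> and \<open>(2, 1)\<close> share \<open>y = 1\<close>.\<close>
  have A: "(f0 * (of_real (exp 3) - z1)) * (of_real (exp 1) - z2) \<in> \<real>" "(f0 * (of_real (exp 3) - z1)) * (of_real (exp 2) - z2) \<in> \<real>"
    using fac[of 2 1] fac[of 1 2] by (simp_all add: mult_ac)
  show "z2 \<in> \<real>"
    by (rule real_if_affine_real(2)[OF _ _ A]) (use f nz in auto)
  have B: "(f0 * (of_real (exp 1) - z2)) * (of_real (exp 2) - z1) \<in> \<real>" "(f0 * (of_real (exp 1) - z2)) * (of_real (exp 3) - z1) \<in> \<real>"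
    using fac[of 1 1] fac[of 2 1] by (simp_all add: mult_ac)
  show "z1 \<in> \<real>"
    by (rule real_if_affine_real(2)[OF _ _ B]) (use f nz in auto)
qed

section \<open>The kernel for \<open>z1 = z2 = 1\<close>\<close>

lemma integrable_reflect:
  fixes f :: "real \<Rightarrow> 'b::{banach, second_countable_topology}"
  shows "integrable lborel f \<Longrightarrow> integrable lborel (\<lambda>x. f (- x))"
  and "(LINT x|lborel. f (- x)) = (LINT x|lborel. f x)"
  using lborel_integrable_real_affine[of f "-1" 0] lborel_integral_real_affine[of "-1" f 0] by simp_all

lemma exp_integral_neg_axis:
  assumes "Re s > 0"
  shows "integrable lborel (\<lambda>x. indicator {..<0} x *\<^sub>R exp (s * of_real x))"
    and "(LINT x|lborel. indicator {..<0} x *\<^sub>R exp (s * of_real x)) = 1 / s"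
proof -
  have s: "s \<noteq> 0" using assms by auto
  have m [measurable]: "(\<lambda>x::real. exp (s * of_real x)) \<in> borel_measurable borel"
    by (intro borel_measurable_continuous_onI continuous_intros)
  show i: "integrable lborel (\<lambda>x. indicator {..<0} x *\<^sub>R exp (s * of_real x))"
  proof (rule Bochner_Integration.integrable_bound)
    \<comment> \<open>For \<open>x < 0\<close> the factor \<open>exp (1 - exp x)\<close> is at least
      1, so a Gamma integral serves as majorant.\<close>
    show "integrable lborel (\<lambda>x. exp 1 * (exp (Re s * x) * exp (- 1 * exp x)))"
      using assms by (intro integrable_mult_right Gamma_exp_integral_real(1)) auto
    show "AE x in lborel. norm (indicator {..<0} x *\<^sub>R exp (s * of_real x)) \<le> norm (exp 1 * (exp (Re s * x) * exp (- 1 * exp x)))"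
    proof (rule AE_I2)
      fix x :: real
      have "exp (1 - exp x) \<ge> 1" if "x < 0" using that by simp
      then have "x < 0 \<Longrightarrow> exp (Re s * x) * 1 \<le> exp (Re s * x) * exp (1 - exp x)"
        by (intro mult_left_mono) auto
      then show "norm (indicator {..<0} x *\<^sub>R exp (s * of_real x)) \<le> norm (exp 1 * (exp (Re s * x) * exp (- 1 * exp x)))"
        by (auto simp: indicator_def norm_exp_eq_Re exp_diff exp_minus field_simps)
    qed
  qed simp
  have "(LBINT x=-\<infinity>..ereal 0. exp (s * of_real x)) = exp (s * of_real 0) / s - 0"
  proof (rule interval_integral_FTC_integrable)
    show "((\<lambda>x. exp (s * of_real x) / s) has_vector_derivative exp (s * of_real x)) (at x)" for x
      using s by (auto intro!: derivative_eq_intros has_vector_derivative_real_field)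
    show "set_integrable lborel (einterval (- \<infinity>) (ereal 0)) (\<lambda>x. exp (s * of_real x))"
      using i by (simp add: set_integrable_def einterval_def lessThan_def)
    show "(((\<lambda>x. exp (s * of_real x) / s) \<circ> real_of_ereal) \<longlongrightarrow> exp (s * of_real 0) / s) (at_left (ereal 0))"
      unfolding ereal_tendsto_simps1 by (intro tendsto_intros s)
    have "((\<lambda>x. exp (Re s * x)) \<longlongrightarrow> 0) at_bot" using assms by real_asymp
    then have "((\<lambda>x. exp (s * of_real x)) \<longlongrightarrow> 0) at_bot"
      by (rule Lim_null_comparison[rotated]) (simp add: norm_exp_eq_Re)
    then show "(((\<lambda>x. exp (s * of_real x) / s) \<circ> real_of_ereal) \<longlongrightarrow> 0) (at_right (- \<infinity>))"
      unfolding ereal_tendsto_simps1 by (rule tendsto_divide_zero)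
  qed (auto intro!: continuous_intros)
  then show "(LINT x|lborel. indicator {..<0} x *\<^sub>R exp (s * of_real x)) = 1 / s"
    by (simp add: interval_lebesgue_integral_def set_lebesgue_integral_def einterval_def lessThan_def)
qed

lemma exp_integral_pos_axis:
  assumes "Re s < 0"
  shows "integrable lborel (\<lambda>x. indicator {0..} x *\<^sub>R exp (s * of_real x))"
    and "(LINT x|lborel. indicator {0..} x *\<^sub>R exp (s * of_real x)) = - 1 / s"
proof -
  let ?f = "\<lambda>x. indicator {..<0} (- x) *\<^sub>R exp (- s * of_real (- x))"
  let ?g = "\<lambda>x. indicator {0..} x *\<^sub>R exp (s * of_real x)"
  have m [measurable]: "(\<lambda>x::real. exp (s * of_real x)) \<in> borel_measurable borel"
    by (intro borel_measurable_continuous_onI continuous_intros)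
  have I: "integrable lborel ?f" "(LINT x|lborel. ?f x) = - 1 / s"
    using integrable_reflect[of "\<lambda>x. indicator {..<0} x *\<^sub>R exp (- s * of_real x)"] exp_integral_neg_axis[of "- s"] assms by simp_all
  have ae: "AE x in lborel. ?f x = ?g x"
    using AE_lborel_singleton[of 0] by eventually_elim (auto simp: indicator_def)
  have meas: "?f \<in> borel_measurable lborel" "?g \<in> borel_measurable lborel" using I(1) by auto
  show "integrable lborel ?g" using I(1) integrable_cong_AE[OF meas ae] by simp
  show "(LINT x|lborel. ?g x) = - 1 / s" using I(2) integral_cong_AE[OF meas ae] by simp
qed

lemma integrable_exp_logistic:
  assumes "0 < \<sigma>" "\<sigma> < 1"
  shows "integrable lborel (\<lambda>x. exp (\<sigma> * x) / (1 + exp x) :: real)"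
proof (rule Bochner_Integration.integrable_bound)
  have r: "integrable lborel (\<lambda>x. norm (indicator {..<0} x *\<^sub>R exp (of_real \<sigma> * complex_of_real x)))"
     "integrable lborel (\<lambda>x. norm (indicator {0..} x *\<^sub>R exp (of_real (\<sigma> - 1) * complex_of_real x)))"
    using assms by (intro integrable_norm exp_integral_neg_axis(1) exp_integral_pos_axis(1); simp)+
  show "integrable lborel (\<lambda>x. norm (indicator {..<0} x *\<^sub>R exp (of_real \<sigma> * complex_of_real x)) +
      norm (indicator {0..} x *\<^sub>R exp (of_real (\<sigma> - 1) * complex_of_real x)))"
    using r by (rule Bochner_Integration.integrable_add)
  show "AE x in lborel. norm (exp (\<sigma> * x) / (1 + exp x)) \<le> norm (norm (indicator {..<0} x *\<^sub>R exp (of_real \<sigma> * complex_of_real x)) +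
      norm (indicator {0..} x *\<^sub>R exp (of_real (\<sigma> - 1) * complex_of_real x)))"
  proof (rule AE_I2)
    fix x :: real
    have "exp (\<sigma> * x) / (1 + exp x) \<le> exp (\<sigma> * x) / 1" by (intro divide_left_mono) (auto intro!: mult_pos_pos add_pos_pos)
    moreover have "exp (\<sigma> * x) / (1 + exp x) \<le> exp (\<sigma> * x) / exp x" by (intro divide_left_mono) (auto intro!: mult_pos_pos add_pos_pos)
    then have "exp (\<sigma> * x) / (1 + exp x) \<le> exp ((\<sigma> - 1) * x)" unfolding exp_diff[symmetric] by (simp add: algebra_simps)
    moreover have "exp (\<sigma> * x) / (1 + exp x) \<ge> 0" by (simp add: add_nonneg_nonneg)
    ultimately show "norm (exp (\<sigma> * x) / (1 + exp x)) \<le> norm (norm (indicator {..<0} x *\<^sub>R exp (of_real \<sigma> * complex_of_real x)) +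
      norm (indicator {0..} x *\<^sub>R exp (of_real (\<sigma> - 1) * complex_of_real x)))"
      by (auto simp: indicator_def norm_exp_eq_Re)
  qed
qed simp

text \<open>By Tonelli, with the first coordinate integrated inside, the shear is a translation on
  every line.\<close>

lemma distr_lborel_shear: "distr lborel borel (\<lambda>q :: real \<times> real. (fst q - snd q, snd q)) = lborel"
proof (rule measure_eqI)
  fix A assume "A \<in> sets (distr lborel borel (\<lambda>q :: real \<times> real. (fst q - snd q, snd q)))"
  then have A [measurable]: "A \<in> sets (borel :: (real \<times> real) measure)" by simp
  have A2 [measurable]: "A \<in> sets (borel \<Otimes>\<^sub>M borel)" unfolding borel_prod by (rule A)
  have "emeasure (distr lborel borel (\<lambda>q. (fst q - snd q, snd q))) A = (\<integral>\<^sup>+q. indicator A (fst q - snd q, snd q) \<partial>lborel)"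
    by (subst nn_integral_indicator[symmetric], simp, subst nn_integral_distr) auto
  also have "\<dots> = (\<integral>\<^sup>+q. indicator A (fst q - snd q, snd q) \<partial>(lborel \<Otimes>\<^sub>M lborel))"
    by (simp add: lborel_prod)
  also have "\<dots> = (\<integral>\<^sup>+y. \<integral>\<^sup>+x. indicator A (x - y, y) \<partial>lborel \<partial>lborel)"
    by (subst lborel_pair.nn_integral_snd[symmetric]) (auto simp: split_beta)
  also have "\<dots> = (\<integral>\<^sup>+y. \<integral>\<^sup>+x. indicator A (x, y) \<partial>lborel \<partial>lborel)"
  proof (rule nn_integral_cong)
    fix y :: real
    show "(\<integral>\<^sup>+x. indicator A (x - y, y) \<partial>lborel) = (\<integral>\<^sup>+x. indicator A (x, y) \<partial>lborel)"
      by (subst nn_integral_real_affine[where c = 1 and t = y]) (auto simp: algebra_simps)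
  qed
  also have "\<dots> = (\<integral>\<^sup>+q. indicator A q \<partial>(lborel \<Otimes>\<^sub>M lborel))"
    by (subst lborel_pair.nn_integral_snd[symmetric]) (auto simp: split_beta)
  also have "\<dots> = emeasure lborel A" by (simp add: lborel_prod)
  finally show "emeasure (distr lborel borel (\<lambda>q. (fst q - snd q, snd q))) A = emeasure lborel A" .
qed simp

lemma lborel_shear:
  fixes G :: "real \<times> real \<Rightarrow> 'b::{banach, second_countable_topology}"
  assumes "integrable lborel G"
  shows "integrable lborel (\<lambda>q. G (fst q - snd q, snd q))"
    and "(LINT q|lborel. G (fst q - snd q, snd q)) = (LINT q|lborel. G q)"
proof -
  have [measurable]: "G \<in> borel_measurable borel" using borel_measurable_integrable[OF assms] by simp
  have "integrable (distr lborel borel (\<lambda>q. (fst q - snd q, snd q))) G"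
    unfolding distr_lborel_shear by (rule assms)
  then show "integrable lborel (\<lambda>q. G (fst q - snd q, snd q))" by (subst (asm) integrable_distr_eq) auto
  have "(LINT q|distr lborel borel (\<lambda>q. (fst q - snd q, snd q)). G q) = (LINT q|lborel. G (fst q - snd q, snd q))"
    by (rule integral_distr) auto
  then show "(LINT q|lborel. G (fst q - snd q, snd q)) = (LINT q|lborel. G q)"
    unfolding distr_lborel_shear ..
qed

section \<open>The singular part and its transform\<close>

text \<open>With \<open>x = exp (fst q)\<close> and \<open>y = exp (snd q)\<close> this is
  \<open>1 / (y * (x + y))\<close> restricted to \<open>snd q \<in> S\<close>; the cut at
  \<open>y = 1\<close> is the cut at 0 in \<open>snd q\<close>.\<close>

definition corner_kernel :: "real set \<Rightarrow> real \<times> real \<Rightarrow> complex" where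
  "corner_kernel S q = of_real (indicator S (snd q) / (exp (snd q) * (exp (fst q) + exp (snd q))))"

text \<open>For \<open>0 < Re s < 1\<close> this is the Beta integral B(s, 1 - s) =
  \<open>pi / sin (pi * s)\<close>.\<close>

definition logistic_transform :: "complex \<Rightarrow> complex" where
  "logistic_transform s = (LINT x|lborel. exp (s * of_real x) * of_real (1 / (1 + exp x)))"

lemma corner_kernel_measurable [measurable]: "S \<in> sets borel \<Longrightarrow> corner_kernel S \<in> borel_measurable borel"
proof -
  assume [measurable]: "S \<in> sets borel"
  show ?thesis unfolding corner_kernel_def[abs_def] by measurable
qed

text \<open>The substitution \<open>\<eta> = \<tau> + \<theta>\<close> separates the variables.\<close>

lemma corner_kernel_separate:
  "exp (s1 * of_real (fst q) + s2 * of_real (snd q)) * corner_kernel S q =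
    (exp (s1 * of_real (fst q - snd q)) * of_real (1 / (1 + exp (fst q - snd q)))) *
    (indicator S (snd q) *\<^sub>R exp ((s1 + s2 - 2) * of_real (snd q)))"
proof -
  let ?x = "fst q" and ?y = "snd q"
  have e: "exp (s1 * of_real (?x - ?y)) * exp ((s1 + s2 - 2) * of_real ?y) =
     exp (s1 * of_real ?x + s2 * of_real ?y) * of_real (exp (- 2 * ?y))"
    unfolding exp_of_real[symmetric] exp_add[symmetric] by (simp add: algebra_simps)
  have r: "exp (- 2 * ?y) * (1 / (1 + exp (?x - ?y))) = 1 / (exp ?y * (exp ?x + exp ?y))"
  proof -
    have "1 + exp (?x - ?y) = exp (- ?y) * (exp ?x + exp ?y)"
      by (simp add: exp_diff exp_minus field_simps)
    moreover have "exp (- 2 * ?y) = exp (- ?y) * exp (- ?y)" by (simp add: exp_add[symmetric])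
    ultimately show ?thesis by (simp add: exp_minus field_simps)
  qed
  have "(exp (s1 * of_real (?x - ?y)) * of_real (1 / (1 + exp (?x - ?y)))) * (indicator S ?y *\<^sub>R exp ((s1 + s2 - 2) * of_real ?y)) =
     (exp (s1 * of_real (?x - ?y)) * exp ((s1 + s2 - 2) * of_real ?y)) * of_real (1 / (1 + exp (?x - ?y)) * indicator S ?y)"
    by (simp add: scaleR_conv_of_real mult_ac)
  also have "\<dots> = exp (s1 * of_real ?x + s2 * of_real ?y) * of_real (exp (- 2 * ?y) * (1 / (1 + exp (?x - ?y))) * indicator S ?y)"
    unfolding e by (simp only: of_real_mult mult_ac)
  also have "\<dots> = exp (s1 * of_real ?x + s2 * of_real ?y) * corner_kernel S q"
    unfolding r corner_kernel_def by simp
  finally show ?thesis ..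
qed

lemma logistic_integrable:
  assumes "0 < Re s" "Re s < 1"
  shows "integrable lborel (\<lambda>x. exp (s * of_real x) * of_real (1 / (1 + exp x)))"
proof (rule Bochner_Integration.integrable_bound[OF integrable_exp_logistic[OF assms]])
  have "(\<lambda>x::real. exp (s * of_real x)) \<in> borel_measurable borel"
    by (intro borel_measurable_continuous_onI continuous_intros)
  then show "(\<lambda>x. exp (s * of_real x) * of_real (1 / (1 + exp x))) \<in> borel_measurable lborel" by measurable
qed (intro AE_I2, simp add: norm_mult norm_exp_eq_Re abs_mult del: of_real_divide of_real_add)

lemma laplace2_corner_kernel:
  assumes s1: "0 < Re s1" "Re s1 < 1"
    and S: "integrable lborel (\<lambda>y. indicator S y *\<^sub>R exp ((s1 + s2 - 2) * of_real y))"
  shows "integrable lborel (\<lambda>q. exp (s1 * of_real (fst q) + s2 * of_real (snd q)) * corner_kernel S q)"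
    and "laplace2 (corner_kernel S) (s1, s2) = logistic_transform s1 * (LINT y|lborel. indicator S y *\<^sub>R exp ((s1 + s2 - 2) * of_real y))"
  using lborel_shear[OF lborel_product_integral(1)[OF logistic_integrable[OF s1] S]]
    lborel_product_integral(2)[OF logistic_integrable[OF s1] S]
  unfolding laplace2_def fst_conv snd_conv corner_kernel_separate logistic_transform_def by simp_all

lemma laplace2_conv_iff:
  assumes [measurable]: "k \<in> borel_measurable borel"
  shows "laplace2_conv k (Re s1) (Re s2) \<longleftrightarrow> integrable lborel (\<lambda>q. exp (s1 * of_real (fst q) + s2 * of_real (snd q)) * k q)"
proof -
  have "(\<lambda>q::real \<times> real. exp (s1 * of_real (fst q) + s2 * of_real (snd q))) \<in> borel_measurable borel"
    by (intro borel_measurable_continuous_onI continuous_intros)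
  then have m: "(\<lambda>q. exp (s1 * of_real (fst q) + s2 * of_real (snd q)) * k q) \<in> borel_measurable lborel" by measurable
  show ?thesis
    unfolding laplace2_conv_def integrable_norm_iff[OF m, symmetric] by (simp add: norm_mult norm_exp_eq_Re)
qed

lemma laplace2_add:
  assumes [measurable]: "k \<in> borel_measurable borel" "l \<in> borel_measurable borel"
    and "laplace2_conv k (Re s1) (Re s2)" "laplace2_conv l (Re s1) (Re s2)"
  shows "laplace2 (\<lambda>q. k q + l q) (s1, s2) = laplace2 k (s1, s2) + laplace2 l (s1, s2)"
  using assms unfolding laplace2_def fst_conv snd_conv distrib_left
  by (intro Bochner_Integration.integral_add) (simp_all only: laplace2_conv_iff)

text \<open>A dummy second variable in \<open>{0..1}\<close> turns the transform into a slice of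
  \<open>laplace2\<close>, whose holomorphy is known; at \<open>s2 = 0\<close> the dummy integral
  equals 1.\<close>

lemma holo2_logistic_transform: 
  assumes "open U" "\<And>p. p \<in> U \<Longrightarrow> 0 < Re (fst p) \<and> Re (fst p) < 1"
  shows "holo2 (\<lambda>p. logistic_transform (fst p)) U"
proof -
  let ?k = "\<lambda>q :: real \<times> real. of_real (1 / (1 + exp (fst q)) * indicator {0..1} (snd q)) :: complex"
  let ?V = "{s. 0 < Re s} \<inter> {s. Re s < 1}"
  have k [measurable]: "?k \<in> borel_measurable borel" by measurable
  have i: "integrable lborel (\<lambda>y. indicator {0..1} y *\<^sub>R exp (t * of_real y))" for t :: complex
    by (rule borel_integrable_compact) (auto intro!: continuous_intros)
  have eq: "exp (s1 * of_real (fst q) + s2 * of_real (snd q)) * ?k q =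
      (exp (s1 * of_real (fst q)) * of_real (1 / (1 + exp (fst q)))) * (indicator {0..1} (snd q) *\<^sub>R exp (s2 * of_real (snd q)))" for s1 s2 q
    unfolding exp_add by (simp add: scaleR_conv_of_real)
  have I: "laplace2_conv ?k (Re s1) (Re s2)" "laplace2 ?k (s1, 0) = logistic_transform s1" if "s1 \<in> ?V" for s1 s2
    using lborel_product_integral[OF logistic_integrable i, of s1 s2] lborel_product_integral[OF logistic_integrable i, of s1 0] that
    unfolding laplace2_conv_iff[OF k] laplace2_def fst_conv snd_conv eq logistic_transform_def by simp_all
  have V: "open ?V" by (intro open_Int open_halfspace_Re_gt open_halfspace_Re_lt)
  have "holo2 (laplace2 ?k) (?V \<times> UNIV)"
    by (rule holo2_laplace2) (use I V in \<open>auto intro: open_Times\<close>)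
  from holo2_slice1[OF this, of 0] have "(\<lambda>w. laplace2 ?k (w, 0)) holomorphic_on ?V" by (simp add: Int_def)
  then have h: "logistic_transform holomorphic_on ?V" by (rule holomorphic_transform) (use I in auto)
  have "(\<lambda>w. logistic_transform w) field_differentiable (at x)" if "(x, y) \<in> U" for x y
    using assms(2)[OF that] h V by (intro holomorphic_on_imp_differentiable_at) auto
  moreover have "continuous_on U (\<lambda>p. logistic_transform (fst p))"
    by (rule continuous_on_compose2[OF holomorphic_on_imp_continuous_on[OF h]])
       (use assms in \<open>auto intro: continuous_intros\<close>)
  ultimately show ?thesis using assms(1) by (auto simp: holo2_def)
qed

section \<open>Bounds for \<open>Hfun\<close> and the regularised kernel\<close>

definition H_kernel :: "real \<Rightarrow> real \<times> real \<Rightarrow> real" where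
  "H_kernel a q = Hfun a (exp (fst q) + exp (snd q)) / (exp (exp (snd q)) - 1)
     + Hfun 1 (exp (snd q)) / (exp (fst q) + exp (snd q))"

text \<open>This is \<open>x / 2 \<le> sinh (x / 2)\<close>, proved from
  \<open>cosh \<ge> 1\<close>. It is the statement that \<open>Hfun (1/2)\<close> is nonpositive,
  the borderline case of the theorem.\<close>

lemma exp_half_bound:
  assumes "x \<ge> 0" shows "x * exp (x / 2) \<le> exp x - (1 :: real)"
proof -
  let ?g = "\<lambda>x. exp (x / 2) - exp (- x / 2) - x :: real"
  have "?g 0 \<le> ?g x"
  proof (rule DERIV_nonneg_imp_nondecreasing[OF assms])
    fix u :: real
    have "exp (u / 2) + exp (- u / 2) \<ge> 2"
    proof -
      have sq: "(exp (u / 4))\<^sup>2 = exp (u / 2)" "(exp (- u / 4))\<^sup>2 = exp (- u / 2)"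
        by (simp_all add: exp_double[symmetric])
      have "0 \<le> (exp (u / 4) - exp (- u / 4))\<^sup>2" by simp
      also have "\<dots> = exp (u / 2) + exp (- u / 2) - 2 * (exp (u / 4) * exp (- u / 4))"
        unfolding power2_diff sq by simp
      also have "exp (u / 4) * exp (- u / 4) = 1" unfolding exp_add[symmetric] by simp
      finally show ?thesis by simp
    qed
    then have "(?g has_real_derivative (exp (u / 2) + exp (- u / 2)) / 2 - 1) (at u)" "(exp (u / 2) + exp (- u / 2)) / 2 - 1 \<ge> 0"
      by (auto intro!: derivative_eq_intros simp: field_simps)
    then show "\<exists>y. (?g has_real_derivative y) (at u) \<and> 0 \<le> y" by blast
  qed
  then have "x \<le> exp (x / 2) - exp (- x / 2)" by simp
  then have "x * exp (x / 2) \<le> (exp (x / 2) - exp (- x / 2)) * exp (x / 2)" by (rule mult_right_mono) simp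
  also have "\<dots> = exp x - 1" by (simp add: left_diff_distrib exp_add[symmetric])
  finally show ?thesis .
qed

lemma exp_minus_1_ge: "exp t - 1 \<ge> (t :: real)"
  using exp_ge_add_one_self[of t] by linarith

lemma Hfun_nonpos:
  assumes "1 / 2 \<le> a" "t > 0" shows "Hfun a t \<le> 0"
proof -
  have "exp ((1 - a) * t) * t \<le> exp (t / 2) * t" using assms by (intro mult_right_mono) (auto simp: field_simps)
  also have "\<dots> \<le> exp t - 1" using exp_half_bound[of t] assms by (simp add: mult.commute)
  finally show ?thesis using assms by (simp add: Hfun_def field_simps)
qed

lemma Hfun_1_neg: assumes "t > 0" shows "Hfun 1 t < 0"
proof -
  have "t * 1 < t * exp (t / 2)" using assms by (intro mult_strict_left_mono) auto
  also have "\<dots> \<le> exp t - 1" using exp_half_bound[of t] assms by simp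
  finally show ?thesis using assms by (simp add: Hfun_def field_simps)
qed

lemma Hfun_abs_le_1:
  assumes a: "0 \<le> a" "a \<le> 1" and t: "t > 0" shows "\<bar>Hfun a t\<bar> \<le> 1"
proof -
  have e: "exp t - 1 > 0" using t by simp
  have "(1 - a) * t \<le> t" using a t by (intro mult_left_le_one_le) auto
  then have "t * exp ((1 - a) * t) \<le> t * exp t" "t * 1 \<le> t * exp ((1 - a) * t)"
    using a t by (auto intro!: mult_left_mono)
  moreover have "exp t - 1 \<le> t * exp t"
  proof -
    have "(1 - t) * exp t \<le> exp (- t) * exp t" using exp_ge_add_one_self[of "- t"] by (intro mult_right_mono) auto
    then show ?thesis by (simp add: exp_add[symmetric] left_diff_distrib)
  qed
  ultimately have "\<bar>t * exp ((1 - a) * t) - (exp t - 1)\<bar> \<le> t * (exp t - 1)"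
    using exp_minus_1_ge[of t] by (simp add: right_diff_distrib abs_le_iff)
  moreover have "Hfun a t = (t * exp ((1 - a) * t) - (exp t - 1)) / (t * (exp t - 1))"
    using t e by (simp add: Hfun_def field_simps)
  ultimately show ?thesis using t e by (simp add: abs_mult)
qed

text \<open>Decay of order \<open>1 / t\<close> is what makes the first integration converge up to
  \<open>\<sigma>1 < 1\<close>. For \<open>t > 1\<close> both terms of \<open>Hfun\<close> are at
  most \<open>2 / (a * t)\<close>, which gives the constant; for \<open>t \<le> 1\<close> the bound
  1 is enough.\<close>

lemma Hfun_abs_le:
  assumes a: "0 < a" "a \<le> 1" and t: "t > 0" shows "\<bar>Hfun a t\<bar> \<le> (4 / a) / (1 + t)"
proof (cases "t \<le> 1")
  case True
  have "\<bar>Hfun a t\<bar> \<le> 1" using a t by (intro Hfun_abs_le_1) auto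
  also have "\<dots> \<le> (4 / a) / (1 + t)"
  proof -
    have "a * (1 + t) \<le> 1 * 2" using a t True by (intro mult_mono) auto
    then have "a * (1 + t) \<le> 4" by simp
    moreover have "a * (1 + t) > 0" using a t by (intro mult_pos_pos) auto
    ultimately show ?thesis unfolding divide_divide_eq_left by (simp only: pos_le_divide_eq mult_1_left)
  qed
  finally show ?thesis .
next
  case False
  have e: "exp t - 1 > 0" using t by simp
  have "exp t \<ge> 2" using exp_ge_add_one_self[of t] False by linarith
  then have "exp t / 2 \<le> exp t - 1" by simp
  then have "exp ((1 - a) * t) / (exp t - 1) \<le> exp ((1 - a) * t) / (exp t / 2)"
    using e by (intro divide_left_mono) auto
  also have "\<dots> = 2 * exp (- (a * t))"
  proof -
    have "exp ((1 - a) * t) = exp t * exp (- (a * t))" by (simp add: exp_add[symmetric] algebra_simps)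
    then show ?thesis by simp
  qed
  also have "\<dots> \<le> 2 / (a * t)"
  proof -
    have "a * t \<le> exp (a * t)" using exp_ge_add_one_self[of "a * t"] by linarith
    then show ?thesis using a t by (simp add: exp_minus field_simps)
  qed
  finally have 1: "exp ((1 - a) * t) / (exp t - 1) \<le> 2 / (a * t)" .
  have 2: "1 / t \<le> 2 / (a * t)" using a t by (simp add: field_simps)
  have "exp ((1 - a) * t) / (exp t - 1) \<ge> 0" "1 / t \<ge> 0" using e t by auto
  then have "\<bar>Hfun a t\<bar> \<le> 2 / (a * t)" using 1 2 unfolding Hfun_def abs_le_iff by linarith
  also have "\<dots> = 4 / (a * (2 * t))" by simp
  also have "\<dots> \<le> 4 / (a * (1 + t))"
    using a t False by (intro frac_le mult_pos_pos mult_left_mono) auto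
  also have "\<dots> = (4 / a) / (1 + t)" by simp
  finally show ?thesis .
qed

text \<open>Each denominator is split into its pole and a rest: first \<open>1 / (x + y)\<close> is
  removed from the factor in \<open>x + y\<close>, then \<open>1 / y\<close> from the factor in
  \<open>y\<close> that multiplies it.\<close>

lemma lerch_kernel_1_1:
  "lerch_kernel a 1 1 q = of_real (H_kernel a q + 1 / (exp (snd q) * (exp (fst q) + exp (snd q))))"
proof -
  let ?x = "exp (fst q)" and ?y = "exp (snd q)"
  have p: "?x + ?y > 0" "?y > 0" by (auto intro: add_pos_pos)
  then have e: "exp (?x + ?y) - 1 \<noteq> 0" "exp ?y - 1 \<noteq> 0" "?x + ?y \<noteq> 0" "?y \<noteq> 0" by auto
  have "H_kernel a q + 1 / (?y * (?x + ?y)) = exp ((1 - a) * (?x + ?y)) / ((exp ?y - 1) * (exp (?x + ?y) - 1))"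
    unfolding H_kernel_def Hfun_def using e by (simp add: diff_divide_distrib mult.commute)
  then show ?thesis by (simp only: lerch_kernel_def) simp
qed

lemma H_kernel_eq:
  "of_real (H_kernel a q) = lerch_kernel a 1 1 q - corner_kernel {..<0} q - corner_kernel {0..} q"
  unfolding lerch_kernel_1_1 corner_kernel_def by (auto simp: indicator_def)

text \<open>For \<open>y \<ge> 1\<close> nothing is subtracted and the kernel decays exponentially.
  For \<open>y < 1\<close> the difference is \<open>H_kernel\<close>, bounded by a constant times
  \<open>1 / ((1 + x) * y)\<close>, which is integrable against the tilt for
  \<open>0 < \<sigma>1 < 1\<close> and \<open>\<sigma>2 > 1\<close>.\<close>

lemma regular_kernel_bound:
  assumes a: "0 < a" "a \<le> 1"
  shows "norm (lerch_kernel a 1 1 q - corner_kernel {..<0} q) \<le>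
    4 * exp (- a * exp (fst q)) * exp (- (1 + a) * exp (snd q)) +
    (4 / a + 1) * (1 / (1 + exp (fst q))) * (indicator {..<0} (snd q) * exp (- snd q))"
proof -
  let ?x = "exp (fst q)" and ?y = "exp (snd q)"
  have p: "?x > 0" "?x + ?y > 0" "?y > 0" by (auto intro: add_pos_pos)
  show ?thesis
  proof (cases "snd q < 0")
    case False
    have half: "1 / (exp t - 1) \<le> 2 * exp (- t)" if "t \<ge> 1" for t :: real
    proof -
      have "exp t / 2 \<le> exp t - 1" using exp_ge_add_one_self[of t] that by linarith
      then have "1 / (exp t - 1) \<le> 1 / (exp t / 2)" by (intro frac_le) simp_all
      also have "\<dots> = 2 * exp (- t)" by (simp add: exp_minus inverse_eq_divide)
      finally show ?thesis .
    qed
    have y: "?y \<ge> 1" "?x + ?y \<ge> 1" using False p by (auto simp: add_increasing)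
    have "norm (lerch_kernel a 1 1 q - corner_kernel {..<0} q) = norm (lerch_kernel a 1 1 q)"
      using False by (simp add: corner_kernel_def)
    also have "\<dots> = exp ((1 - a) * (?x + ?y)) * (1 / (exp ?y - 1) * (1 / (exp (?x + ?y) - 1)))"
    proof -
      have "lerch_kernel a 1 1 q = of_real (exp ((1 - a) * (?x + ?y)) * (1 / (exp ?y - 1) * (1 / (exp (?x + ?y) - 1))))"
        by (simp add: lerch_kernel_def)
      moreover have "exp ((1 - a) * (?x + ?y)) * (1 / (exp ?y - 1) * (1 / (exp (?x + ?y) - 1))) \<ge> 0"
        using p by simp
      ultimately show ?thesis by (simp only: norm_of_real abs_of_nonneg)
    qed
    also have "\<dots> \<le> exp ((1 - a) * (?x + ?y)) * ((2 * exp (- ?y)) * (2 * exp (- (?x + ?y))))"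
      using y p by (intro mult_left_mono mult_mono half) auto
    also have "\<dots> = 4 * (exp ((1 - a) * (?x + ?y)) * exp (- ?y) * exp (- (?x + ?y)))" by simp
    also have "exp ((1 - a) * (?x + ?y)) * exp (- ?y) * exp (- (?x + ?y)) = exp (- a * ?x) * exp (- (1 + a) * ?y)"
      unfolding exp_add[symmetric] by (simp add: algebra_simps)
    finally show ?thesis using False by simp
  next
    case True
    have K: "lerch_kernel a 1 1 q - corner_kernel {..<0} q = of_real (H_kernel a q)"
      using True by (simp add: lerch_kernel_1_1 corner_kernel_def)
    have 1: "\<bar>Hfun a (?x + ?y) / (exp ?y - 1)\<bar> \<le> (4 / a) / (1 + ?x) * (1 / ?y)"
    proof -
      have "\<bar>Hfun a (?x + ?y)\<bar> \<le> (4 / a) / (1 + (?x + ?y))" by (rule Hfun_abs_le[OF a p(2)])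
      also have "\<dots> \<le> (4 / a) / (1 + ?x)" using a p by (intro divide_left_mono mult_pos_pos add_pos_pos) auto
      finally have h: "\<bar>Hfun a (?x + ?y)\<bar> \<le> (4 / a) / (1 + ?x)" .
      have e: "exp ?y - 1 \<ge> ?y" by (rule exp_minus_1_ge)
      then have "1 / (exp ?y - 1) \<le> 1 / ?y" using p by (intro frac_le) auto
      then have "\<bar>Hfun a (?x + ?y)\<bar> * (1 / (exp ?y - 1)) \<le> (4 / a) / (1 + ?x) * (1 / ?y)"
        using e p a by (intro mult_mono h) (auto intro!: mult_nonneg_nonneg add_nonneg_nonneg)
      then show ?thesis using p by (simp add: abs_div)
    qed
    have 2: "\<bar>Hfun 1 ?y / (?x + ?y)\<bar> \<le> 1 / (1 + ?x) * (1 / ?y)"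
    proof -
      \<comment> \<open>From \<open>y \<le> 1\<close> follows
        \<open>y * (1 + x) \<le> x + y\<close>, which separates the variables.\<close>
      have "?y * ?x \<le> 1 * ?x" using True p by (intro mult_right_mono) auto
      then have "?y * (1 + ?x) \<le> ?x + ?y" by (simp add: algebra_simps)
      then have "1 / (?x + ?y) \<le> 1 / (?y * (1 + ?x))" using p by (intro frac_le mult_pos_pos add_pos_pos) auto
      moreover have "\<bar>Hfun 1 ?y\<bar> \<le> 1" using p by (intro Hfun_abs_le_1) auto
      ultimately have "\<bar>Hfun 1 ?y\<bar> * (1 / (?x + ?y)) \<le> 1 * (1 / (?y * (1 + ?x)))"
        using p by (intro mult_mono) auto
      then show ?thesis using p by (simp add: abs_div mult.commute)
    qed
    have "\<bar>H_kernel a q\<bar> \<le> (4 / a) / (1 + ?x) * (1 / ?y) + 1 / (1 + ?x) * (1 / ?y)"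
      unfolding H_kernel_def by (rule order_trans[OF abs_triangle_ineq add_mono[OF 1 2]])
    also have "\<dots> = (4 / a + 1) * (1 / (1 + ?x)) * (indicator {..<0} (snd q) * exp (- snd q))"
      using True by (simp add: exp_minus divide_inverse algebra_simps)
    finally show ?thesis unfolding K norm_of_real by (simp add: add_increasing)
  qed
qed

lemma laplace2_conv_regular_kernel:
  assumes a: "0 < a" "a \<le> 1" and \<sigma>: "0 < \<sigma>1" "\<sigma>1 < 1" "1 < \<sigma>2"
  shows "laplace2_conv (\<lambda>q. lerch_kernel a 1 1 q - corner_kernel {..<0} q) \<sigma>1 \<sigma>2"
  unfolding laplace2_conv_def
proof (rule Bochner_Integration.integrable_bound)
  let ?A = "\<lambda>q. 4 * ((exp (\<sigma>1 * fst q) * exp (- a * exp (fst q))) * (exp (\<sigma>2 * snd q) * exp (- (1 + a) * exp (snd q))))"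
  let ?B = "\<lambda>q. (4 / a + 1) * ((exp (\<sigma>1 * fst q) / (1 + exp (fst q))) * (norm (indicator {..<0} (snd q) *\<^sub>R exp (of_real (\<sigma>2 - 1) * complex_of_real (snd q)))))"
  show "integrable lborel (\<lambda>q. ?A q + ?B q)"
    using a \<sigma> by (intro Bochner_Integration.integrable_add integrable_mult_right lborel_product_integral(1)
       Gamma_exp_integral_real(1) integrable_exp_logistic integrable_norm exp_integral_neg_axis(1)) auto
  show "AE q in lborel. norm (exp (\<sigma>1 * fst q + \<sigma>2 * snd q) * norm (lerch_kernel a 1 1 q - corner_kernel {..<0} q)) \<le> norm (?A q + ?B q)"
  proof (rule AE_I2)
    fix q :: "real \<times> real"
    have "exp (\<sigma>1 * fst q + \<sigma>2 * snd q) * norm (lerch_kernel a 1 1 q - corner_kernel {..<0} q) \<le>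
       exp (\<sigma>1 * fst q + \<sigma>2 * snd q) * (4 * exp (- a * exp (fst q)) * exp (- (1 + a) * exp (snd q)) +
         (4 / a + 1) * (1 / (1 + exp (fst q))) * (indicator {..<0} (snd q) * exp (- snd q)))"
      by (intro mult_left_mono regular_kernel_bound a) simp
    also have "\<dots> = ?A q + ?B q"
    proof -
      have "norm (indicator {..<0} (snd q) *\<^sub>R exp (of_real (\<sigma>2 - 1) * complex_of_real (snd q))) = exp (\<sigma>2 * snd q) * (indicator {..<0} (snd q) * exp (- snd q))"
        by (simp add: norm_exp_eq_Re indicator_def exp_add[symmetric] algebra_simps)
      then show ?thesis unfolding exp_add[of "\<sigma>1 * fst q"] distrib_left by (simp only: divide_inverse mult_1_left mult_ac)
    qed
    finally show "norm (exp (\<sigma>1 * fst q + \<sigma>2 * snd q) * norm (lerch_kernel a 1 1 q - corner_kernel {..<0} q)) \<le> norm (?A q + ?B q)"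
      by simp
  qed
qed measurable

text \<open>Under \<open>s1 + s2\<close> the slit is the preimage of the point 2. Its complement is
  covered by the half-planes above, right of, below and left of 2; their preimages are convex and
  successive unions overlap.\<close>

lemma connected_slit_strip:
  "connected ({s1. 0 < Re s1 \<and> Re s1 < 1} \<times> {s2. 1 < Re s2} - {p. fst p + snd p = 2})"
proof -
  let ?S = "{s1. 0 < Re s1 \<and> Re s1 < 1} \<times> {s2. 1 < Re s2}"
  have S: "convex ?S"
    using convex_Int[OF convex_halfspace_Re_gt convex_halfspace_Re_lt, of 0 1]
    by (intro convex_Times convex_halfspace_Re_gt) (simp add: Int_def)
  let ?C = "\<lambda>T. ?S \<inter> (\<lambda>p. fst p + snd p) -` T"
  have c: "connected (?C T)" if "convex T" for T :: "complex set"
    using S that by (intro convex_connected convex_Int convex_linear_vimage linearI) (auto simp: scaleR_add_right)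
  have 1: "connected (?C {z. Im z > 0} \<union> ?C {z. Re z > 2})"
  proof (rule connected_Un)
    have "(1 / 2, Complex 2 1) \<in> ?C {z. Im z > 0} \<inter> ?C {z. Re z > 2}" by simp
    then show "?C {z. Im z > 0} \<inter> ?C {z. Re z > 2} \<noteq> {}" by blast
  qed (intro c convex_halfspace_Im_gt convex_halfspace_Re_gt)+
  have 2: "connected (?C {z. Im z > 0} \<union> ?C {z. Re z > 2} \<union> ?C {z. Im z < 0})"
  proof (rule connected_Un[OF 1])
    have "(1 / 2, Complex 2 (-1)) \<in> (?C {z. Im z > 0} \<union> ?C {z. Re z > 2}) \<inter> ?C {z. Im z < 0}" by simp
    then show "(?C {z. Im z > 0} \<union> ?C {z. Re z > 2}) \<inter> ?C {z. Im z < 0} \<noteq> {}" by blast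
  qed (intro c convex_halfspace_Im_lt)
  have 3: "connected (?C {z. Im z > 0} \<union> ?C {z. Re z > 2} \<union> ?C {z. Im z < 0} \<union> ?C {z. Re z < 2})"
  proof (rule connected_Un[OF 2])
    have "(1 / 2, Complex (5 / 4) 1) \<in> (?C {z. Im z > 0} \<union> ?C {z. Re z > 2} \<union> ?C {z. Im z < 0}) \<inter> ?C {z. Re z < 2}" by simp
    then show "(?C {z. Im z > 0} \<union> ?C {z. Re z > 2} \<union> ?C {z. Im z < 0}) \<inter> ?C {z. Re z < 2} \<noteq> {}" by blast
  qed (intro c convex_halfspace_Re_lt)
  have "?S - {p. fst p + snd p = 2} = ?C {z. Im z > 0} \<union> ?C {z. Re z > 2} \<union> ?C {z. Im z < 0} \<union> ?C {z. Re z < 2}"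
    by (auto simp: complex_eq_iff)
  then show ?thesis using 3 by simp
qed

section \<open>Crossing the polar line\<close>

text \<open>The continuation is \<open>?h\<close> on the slit strip, which reaches both sides of
  \<open>Re (s1 + s2) = 2\<close>. It is matched with the series on the right side and with the
  transform of \<open>H_kernel\<close> on the left, where \<open>\<sigma>1 + \<sigma>2 < 2\<close>
  places the target points.\<close>

lemma fvec_1_1_eq_laplace2:
  assumes a: "0 < a" "a \<le> 1" and \<sigma>: "0 < \<sigma>1" "\<sigma>1 < 1" "1 < \<sigma>2" "\<sigma>1 + \<sigma>2 < 2"
  shows "laplace2_conv (\<lambda>q. of_real (H_kernel a q)) \<sigma>1 \<sigma>2"
    and "fvec \<sigma>1 \<sigma>2 a 1 1 t1 t2 = laplace2 (\<lambda>q. of_real (H_kernel a q)) (Complex \<sigma>1 t1, Complex \<sigma>2 t2)"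
proof -
  let ?K = "\<lambda>q. lerch_kernel a 1 1 q - corner_kernel {..<0} q"
  let ?h = "\<lambda>p. laplace2 ?K p + logistic_transform (fst p) / (fst p + snd p - 2)"
  let ?S = "{s1. 0 < Re s1 \<and> Re s1 < 1} \<times> {s2. 1 < Re s2}"
  let ?U = "?S - {p. fst p + snd p = 2}"
  have K [measurable]: "?K \<in> borel_measurable borel" by measurable
  have Hk: "(\<lambda>q. of_real (H_kernel a q)) = (\<lambda>q. ?K q + - corner_kernel {0..} q)"
    by (simp add: H_kernel_eq fun_eq_iff)
  have "open ?S"
    using open_Int[OF open_halfspace_Re_gt[of 0] open_halfspace_Re_lt[of 1]]
    by (intro open_Times open_halfspace_Re_gt) (simp add: Int_def)
  moreover have "closed {p :: complex \<times> complex. fst p + snd p = 2}"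
    by (intro closed_Collect_eq continuous_intros)
  ultimately have U: "open ?U" by (rule open_Diff)
  have Kconv: "laplace2_conv ?K (Re s1) (Re s2)" if "(s1, s2) \<in> ?S" for s1 s2
    using that a by (intro laplace2_conv_regular_kernel) auto
  have h: "holo2 ?h ?U"
    using U by (intro holo2_add holo2_laplace2[OF U K] Kconv holo2_divide holo2_logistic_transform holo2_diff holo2_fst holo2_snd holo2_const) auto
  have pos: "laplace2_conv (corner_kernel {..<0}) (Re s1) (Re s2)"
      "laplace2 (corner_kernel {..<0}) (s1, s2) = logistic_transform s1 / (s1 + s2 - 2)"
    if "0 < Re s1" "Re s1 < 1" "Re (s1 + s2) > 2" for s1 s2
  proof -
    have e: "Re (s1 + s2 - 2) > 0" using that by simp
    show "laplace2_conv (corner_kernel {..<0}) (Re s1) (Re s2)"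
      using laplace2_corner_kernel(1)[OF that(1,2) exp_integral_neg_axis(1)[OF e]] by (subst laplace2_conv_iff) auto
    show "laplace2 (corner_kernel {..<0}) (s1, s2) = logistic_transform s1 / (s1 + s2 - 2)"
      using laplace2_corner_kernel(2)[OF that(1,2) exp_integral_neg_axis(1)[OF e]] exp_integral_neg_axis(2)[OF e] by simp
  qed
  have neg: "laplace2_conv (\<lambda>q. - corner_kernel {0..} q) (Re s1) (Re s2)"
      "laplace2 (\<lambda>q. - corner_kernel {0..} q) (s1, s2) = logistic_transform s1 / (s1 + s2 - 2)"
    if "0 < Re s1" "Re s1 < 1" "Re (s1 + s2) < 2" for s1 s2
  proof -
    have e: "Re (s1 + s2 - 2) < 0" using that by simp
    note I = laplace2_corner_kernel[OF that(1,2) exp_integral_pos_axis(1)[OF e]]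
    have "laplace2_conv (corner_kernel {0..}) (Re s1) (Re s2)"
      using I(1) by (subst laplace2_conv_iff) auto
    then show "laplace2_conv (\<lambda>q. - corner_kernel {0..} q) (Re s1) (Re s2)" by (simp add: laplace2_conv_def)
    have "laplace2 (\<lambda>q. - corner_kernel {0..} q) (s1, s2) = - laplace2 (corner_kernel {0..}) (s1, s2)"
      by (simp add: laplace2_def)
    then show "laplace2 (\<lambda>q. - corner_kernel {0..} q) (s1, s2) = logistic_transform s1 / (s1 + s2 - 2)"
      unfolding I(2) exp_integral_pos_axis(2)[OF e] by simp
  qed
  have fh: "fvec \<sigma>1 \<sigma>2 a 1 1 t1 t2 = ?h (Complex \<sigma>1 t1, Complex \<sigma>2 t2)"
  proof (rule fvec_eqI[OF a _ _ h connected_slit_strip])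
    have "(1 / 2, 3) \<in> ?U \<inter> Phi2_acr" by (simp add: Phi2_acr_def)
    then show "?U \<inter> Phi2_acr \<noteq> {}" by blast
    show "(Complex \<sigma>1 t1, Complex \<sigma>2 t2) \<in> ?U" using \<sigma> by (auto simp: complex_eq_iff)
    show "Gamma s1 * Gamma s2 * Phi2_series s1 s2 a 1 1 = ?h (s1, s2)" if s: "(s1, s2) \<in> ?U \<inter> Phi2_acr" for s1 s2
    proof -
      have r: "0 < Re s1" "Re s1 < 1" "Re (s1 + s2) > 2" using s by (auto simp: Phi2_acr_def)
      have "Gamma s1 * Gamma s2 * Phi2_series s1 s2 a 1 1 = laplace2 (lerch_kernel a 1 1) (s1, s2)"
        using s by (intro Phi2_series_eq_laplace2 a) auto
      also have "lerch_kernel a 1 1 = (\<lambda>q. ?K q + corner_kernel {..<0} q)" by simp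
      also have "laplace2 \<dots> (s1, s2) = laplace2 ?K (s1, s2) + laplace2 (corner_kernel {..<0}) (s1, s2)"
        using s by (intro laplace2_add K corner_kernel_measurable Kconv pos(1) r) auto
      finally show ?thesis using pos(2)[OF r] by simp
    qed
  qed (use \<sigma> in auto)
  have r: "0 < Re (Complex \<sigma>1 t1)" "Re (Complex \<sigma>1 t1) < 1" "Re (Complex \<sigma>1 t1 + Complex \<sigma>2 t2) < 2"
    and r0: "0 < Re (Complex \<sigma>1 0)" "Re (Complex \<sigma>1 0) < 1" "Re (Complex \<sigma>1 0 + Complex \<sigma>2 0) < 2"
    using \<sigma> by auto
  have Sc: "(Complex \<sigma>1 t1, Complex \<sigma>2 t2) \<in> ?S" using \<sigma> by simp
  have nm: "(\<lambda>q. - corner_kernel {0..} q) \<in> borel_measurable borel" by measurable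
  have "laplace2 (\<lambda>q. of_real (H_kernel a q)) (Complex \<sigma>1 t1, Complex \<sigma>2 t2) = ?h (Complex \<sigma>1 t1, Complex \<sigma>2 t2)"
    unfolding Hk laplace2_add[OF K nm Kconv[OF Sc] neg(1)[OF r]] neg(2)[OF r] by simp
  then show "fvec \<sigma>1 \<sigma>2 a 1 1 t1 t2 = laplace2 (\<lambda>q. of_real (H_kernel a q)) (Complex \<sigma>1 t1, Complex \<sigma>2 t2)"
    using fh by simp
  have "integrable lborel (\<lambda>q. exp (Complex \<sigma>1 0 * of_real (fst q) + Complex \<sigma>2 0 * of_real (snd q)) * ?K q +
      exp (Complex \<sigma>1 0 * of_real (fst q) + Complex \<sigma>2 0 * of_real (snd q)) * - corner_kernel {0..} q)"
    using Kconv[of "Complex \<sigma>1 0" "Complex \<sigma>2 0"] neg(1)[OF r0] \<sigma>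
    unfolding laplace2_conv_iff[OF K] laplace2_conv_iff[OF nm] by (intro Bochner_Integration.integrable_add) auto
  then have "laplace2_conv (\<lambda>q. of_real (H_kernel a q)) (Re (Complex \<sigma>1 0)) (Re (Complex \<sigma>2 0))"
    unfolding Hk distrib_left[symmetric] using K nm by (subst laplace2_conv_iff) auto
  then show "laplace2_conv (\<lambda>q. of_real (H_kernel a q)) \<sigma>1 \<sigma>2" by simp
qed

lemma continuous_on_H_kernel: "continuous_on UNIV (\<lambda>q. complex_of_real (H_kernel a q))"
proof -
  have "exp (fst q) + exp (snd q) \<noteq> 0" for q :: "real \<times> real"
    using add_pos_pos[OF exp_gt_zero[of "fst q"] exp_gt_zero[of "snd q"]] by linarith
  then show ?thesis unfolding H_kernel_def[abs_def] Hfun_def by (intro continuous_intros) auto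
qed

lemma H_kernel_neg:
  assumes "Hfun a (exp (fst q) + exp (snd q)) \<le> 0" shows "H_kernel a q < 0"
proof -
  have "Hfun a (exp (fst q) + exp (snd q)) / (exp (exp (snd q)) - 1) \<le> 0"
    using assms by (intro divide_nonpos_nonneg) auto
  moreover have "Hfun 1 (exp (snd q)) / (exp (fst q) + exp (snd q)) < 0"
    by (intro divide_neg_pos Hfun_1_neg add_pos_pos) auto
  ultimately show ?thesis by (simp add: H_kernel_def)
qed

text \<open>For \<open>a < 1 / 2\<close> some \<open>t\<close> has \<open>Hfun a t > 0\<close>. With
  \<open>t = x + y\<close> fixed and \<open>y\<close> small, the first summand grows like
  \<open>Hfun a t / y\<close>, whereas the second stays within \<open>1 / t\<close>. For large
  \<open>t\<close> the value \<open>Hfun a t\<close> is nonpositive, and so the kernel is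
  negative.\<close>

lemma H_kernel_changes_sign:
  assumes a: "0 < a" "a < 1 / 2"
  obtains q r where "H_kernel a q > 0" "H_kernel a r < 0"
proof -
  have "((\<lambda>t. Hfun a t) \<longlongrightarrow> 1 / 2 - a) (at_right 0)"
    unfolding Hfun_def by real_asymp
  from order_tendstoD(1)[OF this, of 0] a have "eventually (\<lambda>t. Hfun a t > 0) (at_right 0)" by simp
  moreover have "eventually (\<lambda>t::real. t > 0) (at_right 0)" by (rule eventually_at_right_less)
  ultimately have "eventually (\<lambda>t. Hfun a t > 0 \<and> t > 0) (at_right 0)" by (rule eventually_conj)
  then obtain t where t: "Hfun a t > 0" "t > 0" using eventually_happens by fastforce
  \<comment> \<open>The logarithm makes \<open>exp y - 1 < Hfun a t * t\<close>, so that the first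
    summand exceeds \<open>1 / t\<close>; the bound \<open>t / 2\<close> keeps
    \<open>x = t - y\<close> positive.\<close>
  define y where "y = min (t / 2) (ln (1 + Hfun a t * t / 2))"
  have "ln (1 + Hfun a t * t / 2) > 0" using mult_pos_pos[OF t] by (intro ln_gt_zero) simp
  then have y: "y > 0" "y < t" using t by (auto simp: y_def)
  have "exp y \<le> exp (ln (1 + Hfun a t * t / 2))" unfolding exp_le_cancel_iff y_def by simp
  also have "\<dots> = 1 + Hfun a t * t / 2" using t by (intro exp_ln add_pos_pos) auto
  finally have "exp y - 1 < Hfun a t * t" using mult_pos_pos[OF t] by linarith
  then have "1 / t < Hfun a t / (exp y - 1)" using t y by (simp add: field_simps)
  moreover have "\<bar>Hfun 1 y\<bar> \<le> 1" using y by (intro Hfun_abs_le_1) auto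
  then have "- 1 / t \<le> Hfun 1 y / t" using t by (intro divide_right_mono) auto
  ultimately have "Hfun a t / (exp y - 1) + Hfun 1 y / t > 0" by simp
  then have pos: "H_kernel a (ln (t - y), ln y) > 0" using y t by (simp add: H_kernel_def)
  have "((\<lambda>t. t * exp (- a * t) + exp (- t)) \<longlongrightarrow> 0) at_top" using a by real_asymp
  then have "eventually (\<lambda>t. t * exp (- a * t) + exp (- t) < 1) at_top" by (rule order_tendstoD(2)) simp
  then have "eventually (\<lambda>t. t * exp (- a * t) + exp (- t) < 1 \<and> t > 1) at_top"
    by (intro eventually_conj eventually_gt_at_top)
  then obtain s where s: "s * exp (- a * s) + exp (- s) < 1" "s > 1" using eventually_happens by fastforce
  have "(s * exp (- a * s) + exp (- s)) * exp s < 1 * exp s" using s by (intro mult_strict_right_mono) auto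
  then have "s * exp ((1 - a) * s) + 1 < exp s"
    by (simp add: distrib_right mult.assoc exp_add[symmetric] left_diff_distrib)
  then have "Hfun a s \<le> 0" using s by (simp add: Hfun_def field_simps)
  \<comment> \<open>The choice \<open>y = 1\<close> and \<open>x = s - 1\<close> gives
    \<open>x + y = s\<close>.\<close>
  then have "H_kernel a (ln (s - 1), ln 1) < 0" using s by (intro H_kernel_neg) simp
  then show ?thesis using pos that by blast
qed

section \<open>Criteria at a fixed pair of abscissae\<close>

text \<open>The closed unit disc meets the real axis in [-1, 1], so the interval conditions of the
  theorem only express that the parameter is real.\<close>

lemma real_unit_interval_iff:
  assumes "norm z \<le> 1" "z \<noteq> 1"
  shows "z \<in> \<real> \<and> -1 \<le> Re z \<and> Re z < 1 \<longleftrightarrow> z \<in> \<real>"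
proof
  assume "z \<in> \<real>"
  then obtain x where x: "z = of_real x" by (auto elim: Reals_cases)
  then have "\<bar>x\<bar> \<le> 1" "x \<noteq> 1" using assms by auto
  then show "z \<in> \<real> \<and> -1 \<le> Re z \<and> Re z < 1" using x by auto
qed simp

text \<open>The criterion is the same for every admissible pair
  \<open>(\<sigma>1, \<sigma>2)\<close>, which is how the equivalences quantified over all pairs
  follow.\<close>

lemma lerch_charfun_iff:
  assumes a: "0 < a" "a \<le> 1" and z: "norm z1 \<le> 1" "norm z2 \<le> 1"
    and \<sigma>: "\<sigma>1 > polar_weight z1" "\<sigma>2 > polar_weight z2"
  shows "(\<exists>M. is_charfun2 (Fvec \<sigma>1 \<sigma>2 a z1 z2) M) \<longleftrightarrow> z1 \<in> \<real> \<and> z2 \<in> \<real>"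
proof
  note T = continuous_on_lerch_kernel[OF z] laplace2_conv_lerch_kernel[OF a z \<sigma>] fvec_eq_laplace2[OF a z \<sigma>]
  {
    assume "\<exists>M. is_charfun2 (Fvec \<sigma>1 \<sigma>2 a z1 z2) M"
    then obtain M where M: "is_charfun2 (Fvec \<sigma>1 \<sigma>2 a z1 z2) M" ..
    have "lerch_kernel a z1 z2 q / fvec \<sigma>1 \<sigma>2 a z1 z2 0 0 \<in> \<real>" for q
      using charfun_imp(2)[OF T M, of q] by (simp add: complex_is_Real_iff)
    then show "z1 \<in> \<real> \<and> z2 \<in> \<real>"
      using lerch_kernel_real_imp[OF z charfun_imp(1)[OF T M]] by blast
  next
    assume "z1 \<in> \<real> \<and> z2 \<in> \<real>"
    then obtain x1 x2 where x: "z1 = of_real x1" "z2 = of_real x2" by (auto elim!: Reals_cases)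
    then have "x1 \<le> 1" "x2 \<le> 1" using z by auto
    from lerch_kernel_real_pos[OF this, of a]
    show "\<exists>M. is_charfun2 (Fvec \<sigma>1 \<sigma>2 a z1 z2) M"
      using charfun_exists[OF T] unfolding x by blast
  }
qed

lemma lerch_charfun_density:
  assumes a: "0 < a" "a \<le> 1" and z: "norm z1 \<le> 1" "norm z2 \<le> 1"
    and \<sigma>: "\<sigma>1 > polar_weight z1" "\<sigma>2 > polar_weight z2"
    and M: "is_charfun2 (Fvec \<sigma>1 \<sigma>2 a z1 z2) M"
  shows "has_density2 M (Pz \<sigma>1 \<sigma>2 a z1 z2)"
  by (rule charfun_density[OF continuous_on_lerch_kernel[OF z] laplace2_conv_lerch_kernel[OF a z \<sigma>] fvec_eq_laplace2[OF a z \<sigma>] M])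
     (simp add: Pz_def tilted_def lerch_kernel_def mult.assoc)

lemma H_charfun_iff:
  assumes a: "0 < a" "a \<le> 1" and \<sigma>: "0 < \<sigma>1" "\<sigma>1 < 1" "1 < \<sigma>2" "\<sigma>1 + \<sigma>2 < 2"
  shows "(\<exists>M. is_charfun2 (Fvec \<sigma>1 \<sigma>2 a 1 1) M) \<longleftrightarrow> 1 / 2 \<le> a"
proof
  note T = continuous_on_H_kernel fvec_1_1_eq_laplace2[OF a \<sigma>]
  {
    assume "\<exists>M. is_charfun2 (Fvec \<sigma>1 \<sigma>2 a 1 1) M"
    then obtain M where M: "is_charfun2 (Fvec \<sigma>1 \<sigma>2 a 1 1) M" ..
    \<comment> \<open>The kernel is real here, and multiplication by one fixed complex number makes
      it nonnegative; if it takes both signs, that number must be 0.\<close>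
    let ?w = "inverse (fvec \<sigma>1 \<sigma>2 a 1 1 0 0)"
    have r: "H_kernel a q * Im ?w = 0 \<and> H_kernel a q * Re ?w \<ge> 0" for q
      using charfun_imp(2)[OF T M, of q]
      unfolding divide_inverse Re_complex_of_real_times Im_complex_of_real_times .
    show "1 / 2 \<le> a"
    proof (rule ccontr)
      assume "\<not> 1 / 2 \<le> a"
      then have "a < 1 / 2" by simp
      then obtain q q' where q: "H_kernel a q > 0" "H_kernel a q' < 0"
        using H_kernel_changes_sign[OF a(1)] by blast
      have "Im ?w = 0" "Re ?w \<ge> 0" "Re ?w \<le> 0"
        using r[of q] r[of q'] q by (auto simp only: zero_le_mult_iff mult_eq_0_iff)
      then have "?w = 0" by (intro complex_eqI) auto
      then show False using charfun_imp(1)[OF T M] by simp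
    qed
  next
    assume "1 / 2 \<le> a"
    then have "\<forall>q. H_kernel a q < 0" by (intro allI H_kernel_neg Hfun_nonpos add_pos_pos) auto
    then show "\<exists>M. is_charfun2 (Fvec \<sigma>1 \<sigma>2 a 1 1) M"
      by (intro charfun_exists[OF T refl] disjI2)
  }
qed

lemma H_charfun_density:
  assumes a: "0 < a" "a \<le> 1" and \<sigma>: "0 < \<sigma>1" "\<sigma>1 < 1" "1 < \<sigma>2" "\<sigma>1 + \<sigma>2 < 2"
    and M: "is_charfun2 (Fvec \<sigma>1 \<sigma>2 a 1 1) M"
  shows "has_density2 M (P11 \<sigma>1 \<sigma>2 a)"
  by (rule charfun_density[OF continuous_on_H_kernel fvec_1_1_eq_laplace2[OF a \<sigma>] M])
     (simp only: P11_def tilted_def H_kernel_def fst_conv snd_conv)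

theorem theorem2p5:
  fixes a :: real and z1 z2 :: complex
  assumes "0 < a" "a \<le> 1"
    and "0 < norm z1" "norm z1 \<le> 1" "0 < norm z2" "norm z2 \<le> 1"
  shows
   "(z1 = 1 \<and> z2 = 1 \<longrightarrow>
      (((\<forall>\<sigma>1 \<sigma>2. 0 < \<sigma>1 \<and> \<sigma>1 < 1 \<and> 1 < \<sigma>2 \<and> 1 < \<sigma>1 + \<sigma>2 \<and> \<sigma>1 + \<sigma>2 < 2 \<longrightarrow>
          (\<exists>M. is_charfun2 (Fvec \<sigma>1 \<sigma>2 a 1 1) M)) \<longleftrightarrow> 1/2 \<le> a) \<and>
       (1/2 \<le> a \<longrightarrow>
          (\<forall>\<sigma>1 \<sigma>2 M. 0 < \<sigma>1 \<and> \<sigma>1 < 1 \<and> 1 < \<sigma>2 \<and> 1 < \<sigma>1 + \<sigma>2 \<and> \<sigma>1 + \<sigma>2 < 2 \<longrightarrow>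
             is_charfun2 (Fvec \<sigma>1 \<sigma>2 a 1 1) M \<longrightarrow> has_density2 M (P11 \<sigma>1 \<sigma>2 a)))))
    \<and>
    (z1 = 1 \<and> z2 \<noteq> 1 \<longrightarrow>
      (((\<forall>\<sigma>1 \<sigma>2. 1 < \<sigma>1 \<and> 0 < \<sigma>2 \<longrightarrow> (\<exists>M. is_charfun2 (Fvec \<sigma>1 \<sigma>2 a z1 z2) M))
          \<longleftrightarrow> (z2 \<in> \<real> \<and> -1 \<le> Re z2 \<and> Re z2 < 1)) \<and>
       (z2 \<in> \<real> \<and> -1 \<le> Re z2 \<and> Re z2 < 1 \<longrightarrow>
          (\<forall>\<sigma>1 \<sigma>2 M. 1 < \<sigma>1 \<and> 0 < \<sigma>2 \<longrightarrow>
             is_charfun2 (Fvec \<sigma>1 \<sigma>2 a z1 z2) M \<longrightarrow> has_density2 M (Pz \<sigma>1 \<sigma>2 a z1 z2)))))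
    \<and>
    (z1 \<noteq> 1 \<and> z2 = 1 \<longrightarrow>
      (((\<forall>\<sigma>1 \<sigma>2. 0 < \<sigma>1 \<and> 1 < \<sigma>2 \<longrightarrow> (\<exists>M. is_charfun2 (Fvec \<sigma>1 \<sigma>2 a z1 z2) M))
          \<longleftrightarrow> (z1 \<in> \<real> \<and> -1 \<le> Re z1 \<and> Re z1 < 1)) \<and>
       (z1 \<in> \<real> \<and> -1 \<le> Re z1 \<and> Re z1 < 1 \<longrightarrow>
          (\<forall>\<sigma>1 \<sigma>2 M. 0 < \<sigma>1 \<and> 1 < \<sigma>2 \<longrightarrow>
             is_charfun2 (Fvec \<sigma>1 \<sigma>2 a z1 z2) M \<longrightarrow> has_density2 M (Pz \<sigma>1 \<sigma>2 a z1 z2)))))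
    \<and>
    (z1 \<noteq> 1 \<and> z2 \<noteq> 1 \<longrightarrow>
      (((\<forall>\<sigma>1 \<sigma>2. 0 < \<sigma>1 \<and> 0 < \<sigma>2 \<longrightarrow> (\<exists>M. is_charfun2 (Fvec \<sigma>1 \<sigma>2 a z1 z2) M))
          \<longleftrightarrow> (z1 \<in> \<real> \<and> -1 \<le> Re z1 \<and> Re z1 < 1 \<and> z2 \<in> \<real> \<and> -1 \<le> Re z2 \<and> Re z2 < 1)) \<and>
       (z1 \<in> \<real> \<and> -1 \<le> Re z1 \<and> Re z1 < 1 \<and> z2 \<in> \<real> \<and> -1 \<le> Re z2 \<and> Re z2 < 1 \<longrightarrow>
          (\<forall>\<sigma>1 \<sigma>2 M. 0 < \<sigma>1 \<and> 0 < \<sigma>2 \<longrightarrow>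
             is_charfun2 (Fvec \<sigma>1 \<sigma>2 a z1 z2) M \<longrightarrow> has_density2 M (Pz \<sigma>1 \<sigma>2 a z1 z2)))))"
proof (intro conjI impI)
  note a = assms(1,2) and z = assms(4,6)
  {
    assume z12: "z1 = 1 \<and> z2 = 1"
    show "(\<forall>\<sigma>1 \<sigma>2. 0 < \<sigma>1 \<and> \<sigma>1 < 1 \<and> 1 < \<sigma>2 \<and> 1 < \<sigma>1 + \<sigma>2 \<and> \<sigma>1 + \<sigma>2 < 2 \<longrightarrow>
          (\<exists>M. is_charfun2 (Fvec \<sigma>1 \<sigma>2 a 1 1) M)) \<longleftrightarrow> 1/2 \<le> a" (is "?A \<longleftrightarrow> ?B")
    proof
      assume ?A
      \<comment> \<open>Any admissible pair suffices; here the sum is 3/2.\<close>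
      from this[rule_format, of "1/4" "5/4"] show ?B
        using H_charfun_iff[OF a, of "1/4" "5/4"] by simp
    next
      assume ?B then show ?A using H_charfun_iff[OF a] by blast
    qed
    show "\<forall>\<sigma>1 \<sigma>2 M. 0 < \<sigma>1 \<and> \<sigma>1 < 1 \<and> 1 < \<sigma>2 \<and> 1 < \<sigma>1 + \<sigma>2 \<and> \<sigma>1 + \<sigma>2 < 2 \<longrightarrow>
             is_charfun2 (Fvec \<sigma>1 \<sigma>2 a 1 1) M \<longrightarrow> has_density2 M (P11 \<sigma>1 \<sigma>2 a)"
      using H_charfun_density[OF a] by blast
  next
    assume z12: "z1 = 1 \<and> z2 \<noteq> 1"
    then have w: "polar_weight z1 = 1" "polar_weight z2 = 0" "z1 \<in> \<real>" by (auto simp: polar_weight_def)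
    show "(\<forall>\<sigma>1 \<sigma>2. 1 < \<sigma>1 \<and> 0 < \<sigma>2 \<longrightarrow> (\<exists>M. is_charfun2 (Fvec \<sigma>1 \<sigma>2 a z1 z2) M)) \<longleftrightarrow>
        (z2 \<in> \<real> \<and> -1 \<le> Re z2 \<and> Re z2 < 1)"
      using lerch_charfun_iff[OF a z, unfolded w] w(3) real_unit_interval_iff[OF z(2)] z12
      by (meson gt_ex)
    show "\<forall>\<sigma>1 \<sigma>2 M. 1 < \<sigma>1 \<and> 0 < \<sigma>2 \<longrightarrow>
             is_charfun2 (Fvec \<sigma>1 \<sigma>2 a z1 z2) M \<longrightarrow> has_density2 M (Pz \<sigma>1 \<sigma>2 a z1 z2)"
      using lerch_charfun_density[OF a z, unfolded w] by blast
  next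
    assume z12: "z1 \<noteq> 1 \<and> z2 = 1"
    then have w: "polar_weight z1 = 0" "polar_weight z2 = 1" "z2 \<in> \<real>" by (auto simp: polar_weight_def)
    show "(\<forall>\<sigma>1 \<sigma>2. 0 < \<sigma>1 \<and> 1 < \<sigma>2 \<longrightarrow> (\<exists>M. is_charfun2 (Fvec \<sigma>1 \<sigma>2 a z1 z2) M)) \<longleftrightarrow>
        (z1 \<in> \<real> \<and> -1 \<le> Re z1 \<and> Re z1 < 1)"
      using lerch_charfun_iff[OF a z, unfolded w] w(3) real_unit_interval_iff[OF z(1)] z12
      by (meson gt_ex)
    show "\<forall>\<sigma>1 \<sigma>2 M. 0 < \<sigma>1 \<and> 1 < \<sigma>2 \<longrightarrow>
             is_charfun2 (Fvec \<sigma>1 \<sigma>2 a z1 z2) M \<longrightarrow> has_density2 M (Pz \<sigma>1 \<sigma>2 a z1 z2)"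
      using lerch_charfun_density[OF a z, unfolded w] by blast
  next
    assume z12: "z1 \<noteq> 1 \<and> z2 \<noteq> 1"
    then have w: "polar_weight z1 = 0" "polar_weight z2 = 0" by (auto simp: polar_weight_def)
    show "(\<forall>\<sigma>1 \<sigma>2. 0 < \<sigma>1 \<and> 0 < \<sigma>2 \<longrightarrow> (\<exists>M. is_charfun2 (Fvec \<sigma>1 \<sigma>2 a z1 z2) M)) \<longleftrightarrow>
        (z1 \<in> \<real> \<and> -1 \<le> Re z1 \<and> Re z1 < 1 \<and> z2 \<in> \<real> \<and> -1 \<le> Re z2 \<and> Re z2 < 1)"
      using lerch_charfun_iff[OF a z, unfolded w] real_unit_interval_iff[OF z(1)] real_unit_interval_iff[OF z(2)] z12
      by (meson gt_ex)
    show "\<forall>\<sigma>1 \<sigma>2 M. 0 < \<sigma>1 \<and> 0 < \<sigma>2 \<longrightarrow>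
             is_charfun2 (Fvec \<sigma>1 \<sigma>2 a z1 z2) M \<longrightarrow> has_density2 M (Pz \<sigma>1 \<sigma>2 a z1 z2)"
      using lerch_charfun_density[OF a z, unfolded w] by blast
  }
qed

end
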